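(* Let $X$ be a positive Markov process (state space $[0,\infty]$). (i) $X$ is in $(0^+\cdot\infty,\ \infty\cdot 0^+)$-Laplace duality with some positive Markov process $Y$ if and only if $X$ is completely monotone, weakly-$[0,\infty)$ continuous at $0$ and has $\infty$ absorbing. When so, $Y$ is also completely monotone, weakly-$[0,\infty)$ continuous at $0$ and has $\infty$ absorbing; besides, under the conventions $0^+\cdot\infty$, $\infty\cdot 0^+$, $$\mathbb{E}_0[e^{-X_ty}]=\mathbb{P}^y(Y_t<\infty)\quad\text{and}\quad \mathbb{P}_x(X_t<\infty)=\mathbb{E}^0[e^{-xY_t}],\qquad (x,y)\in[0,\infty]^2,\ t\in[0,\infty).$$ (ii) $X$ is in $(0\cdot\infty^-,\ \infty^-\cdot 0)$-Laplace duality with some positive Markov process $Y$ if and only if $X$ is completely monotone, weakly-$(0,\infty]$ continuous at $\infty$ and has $0$ absorbing. When so, $Y$ is also completely monotone, weakly-$(0,\infty]$ continuous at $\infty$ and has $0$ absorbing; besides, under the conventions $0\cdot\infty^-$, $\infty^-\cdot 0$, $$\mathbb{E}_\infty[e^{-X_ty}]=\mathbb{P}^y(Y_t=0)\quad\text{and}\quad \mathbb{P}_x(X_t=0)=\mathbb{E}^\infty[e^{-xY_t}],\qquad (x,y)\in[0,\infty]^2,\ t\in[0,\infty).$$ (iii) $X$ is in $(0\cdot\infty^-,\ \infty\cdot 0^+)$-Laplace duality with some positive Markov process $Y$ if and only if $X$ is completely monotone and has $0$ and $\infty$ both absorbing. When so, $Y$ is completely monotone, weakly continuous at $0$ and at $\infty$,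 and, under the conventions $0\cdot\infty^-$, $\infty\cdot 0^+$, $$\mathbb{P}_x(X_t<\infty)=\mathbb{E}^0[e^{-xY_t}]\quad\text{and}\quad \mathbb{P}_x(X_t=0)=\mathbb{E}^\infty[e^{-xY_t}],\qquad x\in[0,\infty],\ t\in[0,\infty).$$ (iv) $X$ is in $(0^+\cdot\infty,\ \infty^-\cdot 0)$-Laplace duality with some positive Markov process $Y$ if and only if $X$ is completely monotone and weakly continuous at both $0$ and $\infty$. When so, $Y$ is completely monotone, has $0$ and $\infty$ both absorbing, and, under the conventions $0^+\cdot\infty$, $\infty^-\cdot 0$, $$\mathbb{E}_0[e^{-X_ty}]=\mathbb{P}^y(Y_t<\infty)\quad\text{and}\quad \mathbb{E}_\infty[e^{-X_ty}]=\mathbb{P}^y(Y_t=0),\qquad y\in[0,\infty],\ t\in[0,\infty).$$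
   Context: Positive Markov process: a time-homogeneous Markov process $X=(X_t)_{t\in[0,\infty)}$ with values in $[0,\infty]$ (Borel $\sigma$-field), under probabilities $(\mathbb{P}_x)_{x\in[0,\infty]}$ on a common measurable space, such that $x\mapsto\mathbb{P}_x(X_t\in A)$ is Borel for all $t$ and Borel $A$; $\mathbb{P}_x(X_0=x)=1$; and $\mathbb{P}_x(X_t\in A\mid\sigma(X_u:u\in[0,s]))=\mathbb{P}_{X_s}(X_{t-s}\in A)$ a.s.-$\mathbb{P}_x$ for $s\le t$. No path regularity is assumed. Write $p_t(x,\cdot)$ for the law of $X_t$ under $\mathbb{P}_x$ and $P_tf(x)=\mathbb{E}_x[f(X_t)]$. For a process $Y$ the laws and expectations are written $\mathbb{P}^y,\mathbb{E}^y$. Conventions: $e^{-\infty}=0$, and $x\cdot\infty=\infty\cdot x=\infty$ for $x\in(0,\infty]$. Under $0^+\cdot\infty$ one interprets $e^{-0\cdot\infty}=0$; under $0\cdot\infty^-$, $e^{-0\cdot\infty}=1$; under $\infty\cdot 0^+$, $e^{-\infty\cdot 0}=0$; under $\infty^-\cdot 0$, $e^{-\infty\cdot 0}=1$. In products the first factor always refers to the $X$-variable and the second to the $Y$-variable, so that a convention for $0\cdot\infty$ and one for $\infty\cdot0$ may be chosen independently. Laplace duality: for $\star_1\in\{0^+\cdot\infty,0\cdot\infty^-\}$ and $\star_2\in\{\infty\cdot0^+,\infty^-\cdot0\}$, $X$ is in $(\star_1,\star_2)$-Laplace duality with $Y$ if $\mathbb{E}_x[e^{-X_ty}]=\mathbb{E}^y[e^{-xY_t}]$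 for all $t\in[0,\infty)$, $(x,y)\in[0,\infty]^2$, with the products interpreted under $\star_1,\star_2$. Complete monotonicity: $\mathsf{cm}_{[0,\infty]}$ is the class of nonincreasing $f:[0,\infty]\to[0,\infty)$ whose restriction to $(0,\infty)$ is completely monotone ($C^\infty$ with $(-1)^nf^{(n)}\ge0$ for all $n\ge 0$). $X$ is completely monotone if $P_t\,\mathsf{cm}_{[0,\infty]}\subset\mathsf{cm}_{[0,\infty]}$ for all $t\in[0,\infty)$. Boundary notions (same for $Y$): $x\in\{0,\infty\}$ is absorbing for $X$ if $p_t(x,\cdot)=\delta_x$ for all $t$. $X$ is weakly continuous at $x\in[0,\infty]$ if $P_tf$ is continuous at $x$ for every continuous $f:[0,\infty]\to\mathbb{R}$ and every $t$. $X$ is weakly-$[0,\infty)$ continuous at $0$ if for all $t$ and all continuous $f:[0,\infty]\to\mathbb{R}$, $\mathbb{E}_x[f(X_t);X_t<\infty]\to\mathbb{E}_0[f(X_t);X_t<\infty]$ as $x\downarrow0$. $X$ is weakly-$(0,\infty]$ continuous at $\infty$ if for all $t$ and all continuous $f:[0,\infty]\to\mathbb{R}$, $\mathbb{E}_x[f(X_t);X_t>0]\to\mathbb{E}_\infty[f(X_t);X_t>0]$ as $x\uparrow\infty$. *)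

theory Defs
  imports "HOL-Probability.Probability"
begin

text \<open>The state space $[0,\infty]$ is the type \<^typ>\<open>ennreal\<close>. Times are real numbers, always
  restricted to $t \ge 0$; nothing is required of \<^term>\<open>X t\<close> for negative \<^term>\<open>t\<close>.\<close>

definition history :: "'a set \<Rightarrow> (real \<Rightarrow> 'a \<Rightarrow> ennreal) \<Rightarrow> real \<Rightarrow> 'a measure" where
  "history \<Omega> X s = sigma \<Omega> {X u -` A \<inter> \<Omega> | u A. 0 \<le> u \<and> u \<le> s \<and> A \<in> sets borel}"

text \<open>The measure \<^term>\<open>M\<close> only provides the common measurable space; its values play no role.
  \<^term>\<open>P x \<in> space (prob_algebra M)\<close> says that \<^term>\<open>P x\<close> is a probability measure on it.\<close>

locale positive_markov_process =
  fixes M :: "'a measure" and P :: "ennreal \<Rightarrow> 'a measure" and X :: "real \<Rightarrow> 'a \<Rightarrow> ennreal"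
  assumes prob: "\<And>x. P x \<in> space (prob_algebra M)"
    and X_measurable: "\<And>t. 0 \<le> t \<Longrightarrow> X t \<in> borel_measurable M"
    and kernel_measurable: "\<And>t A. 0 \<le> t \<Longrightarrow> A \<in> sets borel \<Longrightarrow>
      (\<lambda>x. \<P>(\<omega> in P x. X t \<omega> \<in> A)) \<in> borel_measurable borel"
    and start: "\<And>x. \<P>(\<omega> in P x. X 0 \<omega> = x) = 1"
    and markov: "\<And>x s t A. 0 \<le> s \<Longrightarrow> s \<le> t \<Longrightarrow> A \<in> sets borel \<Longrightarrow>
      AE \<omega> in P x.
        real_cond_exp (P x) (history (space M) X s) (indicator {\<omega>' \<in> space M. X t \<omega>' \<in> A}) \<omega>
        = \<P>(\<omega>' in P (X s \<omega>). X (t - s) \<omega>' \<in> A)"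

definition transition_law ::
    "(ennreal \<Rightarrow> 'a measure) \<Rightarrow> (real \<Rightarrow> 'a \<Rightarrow> ennreal) \<Rightarrow> real \<Rightarrow> ennreal \<Rightarrow> ennreal measure" where
  "transition_law P X t x = distr (P x) borel (X t)"

definition semigroup_op ::
    "(ennreal \<Rightarrow> 'a measure) \<Rightarrow> (real \<Rightarrow> 'a \<Rightarrow> ennreal) \<Rightarrow> real \<Rightarrow> (ennreal \<Rightarrow> real) \<Rightarrow> ennreal \<Rightarrow> real" where
  "semigroup_op P X t f x = (\<integral>\<omega>. f (X t \<omega>) \<partial>P x)"


text \<open>The two independent conventions, for $0 \cdot \infty$ and for $\infty \cdot 0$, where the
  first factor is the \<^term>\<open>X\<close>-variable. An undetermined product is given the value $\infty$ or $0$
  according to whether its negative exponential is to be $0$ or $1$.\<close>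

datatype zero_infty_convention = ZeroPlus_Infty | Zero_InftyMinus
datatype infty_zero_convention = Infty_ZeroPlus | InftyMinus_Zero

fun zero_times_infty :: "zero_infty_convention \<Rightarrow> ennreal" where
  "zero_times_infty ZeroPlus_Infty = \<infinity>"
| "zero_times_infty Zero_InftyMinus = 0"

fun infty_times_zero :: "infty_zero_convention \<Rightarrow> ennreal" where
  "infty_times_zero Infty_ZeroPlus = \<infinity>"
| "infty_times_zero InftyMinus_Zero = 0"

definition conv_times ::
    "zero_infty_convention \<Rightarrow> infty_zero_convention \<Rightarrow> ennreal \<Rightarrow> ennreal \<Rightarrow> ennreal" where
  "conv_times c1 c2 x y =
     (if x = 0 \<and> y = \<infinity> then zero_times_infty c1
      else if x = \<infinity> \<and> y = 0 then infty_times_zero c2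
      else x * y)"

definition exp_neg :: "ennreal \<Rightarrow> real" where
  "exp_neg u = (if u = \<infinity> then 0 else exp (- enn2real u))"

definition laplace_kernel ::
    "zero_infty_convention \<Rightarrow> infty_zero_convention \<Rightarrow> ennreal \<Rightarrow> ennreal \<Rightarrow> real" where
  "laplace_kernel c1 c2 x y = exp_neg (conv_times c1 c2 x y)"

definition laplace_dual ::
    "zero_infty_convention \<Rightarrow> infty_zero_convention \<Rightarrow>
     (ennreal \<Rightarrow> 'a measure) \<Rightarrow> (real \<Rightarrow> 'a \<Rightarrow> ennreal) \<Rightarrow>
     (ennreal \<Rightarrow> 'b measure) \<Rightarrow> (real \<Rightarrow> 'b \<Rightarrow> ennreal) \<Rightarrow> bool" where
  "laplace_dual c1 c2 P X Q Y \<longleftrightarrow>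
     (\<forall>t\<ge>0. \<forall>x y. (\<integral>\<omega>. laplace_kernel c1 c2 (X t \<omega>) y \<partial>P x)
                 = (\<integral>\<omega>. laplace_kernel c1 c2 x (Y t \<omega>) \<partial>Q y))"


text \<open>Complete monotonicity on $(0,\infty)$; values at other reals are irrelevant, as derivatives
  at $r > 0$ depend only on values near $r$.\<close>

definition completely_monotone_pos :: "(real \<Rightarrow> real) \<Rightarrow> bool" where
  "completely_monotone_pos g \<longleftrightarrow>
     (\<forall>n. \<forall>r>0. (deriv ^^ n) g field_differentiable at r \<and> 0 \<le> (- 1) ^ n * (deriv ^^ n) g r)"

definition cm_ennreal :: "(ennreal \<Rightarrow> real) set" where
  "cm_ennreal = {f. antimono f \<and> (\<forall>x. 0 \<le> f x) \<and> completely_monotone_pos (\<lambda>r. f (ennreal r))}"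

definition completely_monotone_process ::
    "(ennreal \<Rightarrow> 'a measure) \<Rightarrow> (real \<Rightarrow> 'a \<Rightarrow> ennreal) \<Rightarrow> bool" where
  "completely_monotone_process P X \<longleftrightarrow> (\<forall>t\<ge>0. semigroup_op P X t ` cm_ennreal \<subseteq> cm_ennreal)"


definition absorbing ::
    "(ennreal \<Rightarrow> 'a measure) \<Rightarrow> (real \<Rightarrow> 'a \<Rightarrow> ennreal) \<Rightarrow> ennreal \<Rightarrow> bool" where
  "absorbing P X x \<longleftrightarrow> (\<forall>t\<ge>0. transition_law P X t x = return borel x)"

definition weakly_continuous_at ::
    "(ennreal \<Rightarrow> 'a measure) \<Rightarrow> (real \<Rightarrow> 'a \<Rightarrow> ennreal) \<Rightarrow> ennreal \<Rightarrow> bool" where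
  "weakly_continuous_at P X x \<longleftrightarrow>
     (\<forall>t\<ge>0. \<forall>f :: ennreal \<Rightarrow> real. continuous_on UNIV f \<longrightarrow> isCont (semigroup_op P X t f) x)"

definition weakly_finite_continuous_at_0 ::
    "(ennreal \<Rightarrow> 'a measure) \<Rightarrow> (real \<Rightarrow> 'a \<Rightarrow> ennreal) \<Rightarrow> bool" where
  "weakly_finite_continuous_at_0 P X \<longleftrightarrow>
     (\<forall>t\<ge>0. \<forall>f :: ennreal \<Rightarrow> real. continuous_on UNIV f \<longrightarrow>
        ((\<lambda>x. LINT \<omega>:{\<omega> \<in> space (P x). X t \<omega> < \<infinity>}|P x. f (X t \<omega>)) \<longlongrightarrow>
         (LINT \<omega>:{\<omega> \<in> space (P 0). X t \<omega> < \<infinity>}|P 0. f (X t \<omega>))) (at_right 0))"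

definition weakly_positive_continuous_at_infty ::
    "(ennreal \<Rightarrow> 'a measure) \<Rightarrow> (real \<Rightarrow> 'a \<Rightarrow> ennreal) \<Rightarrow> bool" where
  "weakly_positive_continuous_at_infty P X \<longleftrightarrow>
     (\<forall>t\<ge>0. \<forall>f :: ennreal \<Rightarrow> real. continuous_on UNIV f \<longrightarrow>
        ((\<lambda>x. LINT \<omega>:{\<omega> \<in> space (P x). X t \<omega> > 0}|P x. f (X t \<omega>)) \<longlongrightarrow>
         (LINT \<omega>:{\<omega> \<in> space (P \<infinity>). X t \<omega> > 0}|P \<infinity>. f (X t \<omega>))) (at_left \<infinity>))"


text \<open>HOL cannot quantify existentially over sample-space types, so existence of a dual process is
  stated on path space \<^typ>\<open>real \<Rightarrow> ennreal\<close>, where every positive Markov process has a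
  version with the same finite-dimensional laws.\<close>

definition has_laplace_dual ::
    "zero_infty_convention \<Rightarrow> infty_zero_convention \<Rightarrow>
     (ennreal \<Rightarrow> 'a measure) \<Rightarrow> (real \<Rightarrow> 'a \<Rightarrow> ennreal) \<Rightarrow> bool" where
  "has_laplace_dual c1 c2 P X \<longleftrightarrow>
     (\<exists>(N :: (real \<Rightarrow> ennreal) measure) Q Y.
        positive_markov_process N Q Y \<and> laplace_dual c1 c2 P X Q Y)"

end

theory Submission
  imports Defs
begin

text \<open>By the theorems of Hausdorff and Bernstein, a bounded function on \<open>(0, \<infinity>)\<close> is completely
  monotone iff its alternating differences are nonnegative iff it is \<open>r \<mapsto> \<integral> exp (- r z) q(dz)\<close> for a
  measure \<open>q\<close> on \<open>[0, \<infinity>]\<close>. The middle condition is stable under mixtures and pointwise limits, so a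
  process is completely monotone as soon as its semigroup maps the functions \<open>exp (- x y)\<close>,
  \<open>0 < y < \<infinity>\<close>, to completely monotone ones, which duality provides at once. Conversely, for a
  completely monotone \<open>X\<close> the representing measures of \<open>x \<mapsto> E_x[exp (- X_t y)]\<close> form a kernel in \<open>y\<close>;
  the boundary conditions on \<open>X\<close> say exactly that the representation extends to \<open>x = 0\<close> and
  \<open>x = \<infinity>\<close> under the given conventions. Uniqueness of Laplace transforms makes the kernels a
  semigroup, and Kolmogorov's extension theorem turns it into the dual process. The four cases differ
  only in the meaning of the two boundary conditions, and exchanging the roles of \<open>X\<close> and \<open>Y\<close>
  exchanges the two conventions.\<close>

section \<open>The exponential on the extended half-line\<close>

text \<open>The map \<open>exp_neg\<close> is a decreasing homeomorphism of [0, \<infinity>] onto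
  [0, 1]. It turns Laplace transforms at integers into moments, so uniqueness rests on
  Stone-Weierstrass, and Bernstein's theorem on Hausdorff's theorem applied on finer and finer
  dyadic grids. The obstacle is the boundary: a function in \<open>cm_ennreal\<close> may jump at 0
  and at \<infinity>, whatever the conventions of the duality. It is therefore always represented
  with the pair \<open>Zero_InftyMinus\<close>, \<open>Infty_ZeroPlus\<close>, for which the kernel
  is constantly 1 at x = 0 and constantly 0 at x = \<infinity>; the jumps become atoms of the
  representing law at \<infinity> and at 0. The conventions of the duality enter through
  \<open>boundary_0\<close> and \<open>boundary_infty\<close>: at its endpoint a convention makes
  the kernel either constant, which amounts to absorption, or continuous in x for every z, which
  amounts to weak continuity. Dual laws are chosen separately for each t and y. Measurability in y
  and the semigroup property survive this choice because the transforms of the dual laws are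
  integrals against the given kernels.\<close>

lemma exp_neg_0 [simp]: "exp_neg 0 = 1"
  and exp_neg_top [simp]: "exp_neg \<top> = 0"
  and exp_neg_nonneg [simp]: "0 \<le> exp_neg z"
  and exp_neg_le_1 [simp]: "exp_neg z \<le> 1"
  by (auto simp: exp_neg_def)

lemma exp_neg_ennreal: "0 \<le> r \<Longrightarrow> exp_neg (ennreal r) = exp (- r)"
  by (simp add: exp_neg_def)

lemma exp_neg_add: "exp_neg (x + y) = exp_neg x * exp_neg y"
  by (cases x; cases y) (auto simp: exp_neg_ennreal exp_add[symmetric] simp flip: ennreal_plus)

lemma exp_neg_strict_antimono: "x < y \<Longrightarrow> exp_neg y < exp_neg x"
  by (cases x; cases y) (auto simp: exp_neg_ennreal ennreal_less_iff)

lemma exp_neg_less_iff [simp]: "exp_neg x < exp_neg y \<longleftrightarrow> y < x"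
  by (metis exp_neg_strict_antimono less_asym linorder_neqE)

lemma exp_neg_le_iff [simp]: "exp_neg x \<le> exp_neg y \<longleftrightarrow> y \<le> x"
  by (metis exp_neg_less_iff linorder_not_le)

lemma exp_neg_eq_iff [simp]: "exp_neg x = exp_neg y \<longleftrightarrow> x = y"
  by (metis exp_neg_less_iff linorder_neqE order_less_irrefl)

lemma exp_neg_power: "exp_neg z ^ n = exp_neg (of_nat n * z)"
  by (induction n) (auto simp: exp_neg_add distrib_right)

text \<open>The inverse of \<open>exp_neg\<close> on [0, 1]. It brings limits of measures on the
  real line, and real-valued paths, back to [0, \<infinity>].\<close>

definition neg_ln :: "real \<Rightarrow> ennreal" where
  "neg_ln u = (if u \<le> 0 then \<infinity> else ennreal (- ln u))"

lemma exp_neg_neg_ln: "0 \<le> u \<Longrightarrow> u \<le> 1 \<Longrightarrow> exp_neg (neg_ln u) = u"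
  by (auto simp: neg_ln_def exp_neg_ennreal)

lemma neg_ln_exp_neg [simp]: "neg_ln (exp_neg z) = z"
  by (simp add: exp_neg_neg_ln flip: exp_neg_eq_iff)

lemma measurable_neg_ln [measurable]: "neg_ln \<in> borel_measurable borel"
  unfolding neg_ln_def by measurable

text \<open>Near a finite point \<open>exp_neg\<close> is the real exponential of
  \<open>- enn2real\<close>. At \<open>\<top>\<close>, where \<open>enn2real\<close> jumps to 0, the
  limit is checked through the order, with \<open>neg_ln a\<close> as the threshold beyond which
  \<open>exp_neg\<close> is below \<open>a\<close>.\<close>

lemma continuous_exp_neg: "continuous_on UNIV exp_neg"
proof -
  have "(exp_neg \<longlongrightarrow> exp_neg z) (at z)" for z
  proof (cases z)
    case (real r)
    have "\<forall>\<^sub>F w in at z. w < \<top>"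
      by (rule order_tendstoD[OF tendsto_ident_at]) (simp add: real)
    then have "\<forall>\<^sub>F w in at z. exp (- enn2real w) = exp_neg w"
      by eventually_elim (simp add: exp_neg_def)
    moreover have "((\<lambda>w. exp (- enn2real w)) \<longlongrightarrow> exp (- r)) (at z)"
      using real by (intro tendsto_intros) auto
    ultimately show ?thesis
      using real by (simp add: exp_neg_ennreal tendsto_cong)
  next
    case top
    show ?thesis
    proof (rule order_tendstoI)
      fix a assume a: "exp_neg z < a"
      show "\<forall>\<^sub>F w in at z. exp_neg w < a"
      proof (cases "a \<le> 1")
        case True
        have "\<forall>\<^sub>F w in at z. neg_ln a < w"
          by (rule order_tendstoD[OF tendsto_ident_at])
            (use a True top in \<open>simp add: exp_neg_neg_ln flip: exp_neg_less_iff\<close>)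
        then show ?thesis
        proof eventually_elim
            case (elim w)
            then have "exp_neg w < exp_neg (neg_ln a)"
              by simp
            also have "\<dots> = a"
              using a True top by (intro exp_neg_neg_ln) auto
            finally show ?case .
          qed
      next
        case False
        then show ?thesis
          by (intro always_eventually allI) (meson exp_neg_le_1 le_less_trans not_le)
      qed
    next
      fix a assume "a < exp_neg z"
      then show "\<forall>\<^sub>F w in at z. a < exp_neg w"
        using top by (intro always_eventually allI) (metis exp_neg_nonneg exp_neg_top less_le_trans)
    qed
  qed
  then show ?thesis
    by (simp add: continuous_on_def)
qed

lemma measurable_exp_neg [measurable]: "exp_neg \<in> borel_measurable borel"
  by (rule borel_measurable_continuous_onI[OF continuous_exp_neg])

lemma tendsto_exp_neg [tendsto_intros]:
  "(f \<longlongrightarrow> l) F \<Longrightarrow> ((\<lambda>x. exp_neg (f x)) \<longlongrightarrow> exp_neg l) F"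
  using continuous_on_tendsto_compose[OF continuous_exp_neg] by force

lemma abs_exp_neg_power_le [simp]: "\<bar>exp_neg z ^ n\<bar> \<le> 1"
  by (simp add: power_le_one)

section \<open>Polynomials in the exponential\<close>

text \<open>Polynomials in the single function \<open>exp_neg\<close> form an algebra with constants
  on a compact space, and they separate points because \<open>exp_neg\<close> is injective.\<close>

lemma exp_neg_Stone_Weierstrass:
  fixes f :: "ennreal \<Rightarrow> real"
  assumes "continuous_on UNIV f" "0 < e"
  shows "\<exists>p. \<forall>z. \<bar>f z - poly p (exp_neg z)\<bar> < e"
proof -
  have "function_ring_on {f. \<exists>p. f = (\<lambda>z. poly p (exp_neg z))} UNIV"
  proof
    show "compact (UNIV :: ennreal set)"
      by (rule compact_UNIV)
  next
    fix f assume "f \<in> {f. \<exists>p. f = (\<lambda>z. poly p (exp_neg z))}"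
    then show "continuous_on UNIV f"
      by (auto intro!: continuous_intros continuous_exp_neg)
  next
    fix f g :: "ennreal \<Rightarrow> real"
    assume "f \<in> {f. \<exists>p. f = (\<lambda>z. poly p (exp_neg z))}" "g \<in> {f. \<exists>p. f = (\<lambda>z. poly p (exp_neg z))}"
    then obtain p q where "f = (\<lambda>z. poly p (exp_neg z))" "g = (\<lambda>z. poly q (exp_neg z))"
      by auto
    then show "(\<lambda>z. f z + g z) \<in> {f. \<exists>p. f = (\<lambda>z. poly p (exp_neg z))}"
      and "(\<lambda>z. f z * g z) \<in> {f. \<exists>p. f = (\<lambda>z. poly p (exp_neg z))}"
      by (auto intro: exI[of _ "p + q"] exI[of _ "p * q"])
  next
    fix c show "(\<lambda>_. c) \<in> {f. \<exists>p. f = (\<lambda>z. poly p (exp_neg z))}"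
      by (auto intro: exI[of _ "[:c:]"])
  next
    fix x y :: ennreal assume "x \<noteq> y"
    then show "\<exists>f\<in>{f. \<exists>p. f = (\<lambda>z. poly p (exp_neg z))}. f x \<noteq> f y"
      by (intro bexI[of _ "\<lambda>z. poly [:0, 1:] (exp_neg z)"]) (simp, blast)
  qed
  from function_ring_on.Stone_Weierstrass_basic[OF this assms] show ?thesis
    by auto
qed

text \<open>A functional monotone class argument: powers give polynomials by linearity, polynomials
  give continuous functions by uniform approximation, these give indicators of the rays
  \<open>{..<a}\<close> by bounded limits, and Dynkin's theorem gives all Borel sets.\<close>

lemma exp_neg_monotone_class:
  assumes pow: "\<And>n. H (\<lambda>z. exp_neg z ^ n)"
    and add: "\<And>f g. H f \<Longrightarrow> H g \<Longrightarrow> H (\<lambda>z. f z + g z)"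
    and scale: "\<And>c f. H f \<Longrightarrow> H (\<lambda>z. c * f z)"
    and lim: "\<And>F C f. (\<And>i::nat. H (F i)) \<Longrightarrow> (\<And>i z. \<bar>F i z\<bar> \<le> C) \<Longrightarrow>
      (\<And>z. (\<lambda>i. F i z) \<longlonglongrightarrow> f z) \<Longrightarrow> H f"
    and A: "A \<in> sets borel"
  shows "H (indicator A :: ennreal \<Rightarrow> real)"
proof -
  have zero: "H (\<lambda>_. 0)"
    using scale[OF pow, of 0] by simp
  have poly: "H (\<lambda>z. poly p (exp_neg z))" for p
  proof -
    have "H (\<lambda>z. \<Sum>i\<le>n. coeff p i * exp_neg z ^ i)" for n
    proof (induction n)
      case 0
      then show ?case
        using scale[OF pow, of _ 0] by simp
    next
      case (Suc n)
      then show ?case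
        using add[OF Suc scale[OF pow]] by (simp only: sum.atMost_Suc)
    qed
    then show ?thesis
      by (simp add: poly_altdef)
  qed
  have cont: "H f" if f: "continuous_on UNIV f" for f
  proof -
    have "\<forall>i::nat. \<exists>p. \<forall>z. \<bar>f z - poly p (exp_neg z)\<bar> < 1 / Suc i"
      using exp_neg_Stone_Weierstrass[OF f] by simp
    then obtain p where p: "\<And>i z. \<bar>f z - poly (p i) (exp_neg z)\<bar> < 1 / Suc i"
      by metis
    have "compact (range f)"
      using compact_continuous_image[OF f compact_UNIV] .
    then obtain C where C: "\<And>z. \<bar>f z\<bar> \<le> C"
      by (meson compact_imp_bounded bounded_real rangeI)
    show ?thesis
    proof (rule lim)
      show "H (\<lambda>z. poly (p i) (exp_neg z))" for i
        by (rule poly)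
      show "\<bar>poly (p i) (exp_neg z)\<bar> \<le> C + 1" for i z
      proof -
        have "1 / Suc i \<le> (1::real)"
          by simp
        then show ?thesis
          using p[of z i] C[of z] by linarith
      qed
      show "(\<lambda>i. poly (p i) (exp_neg z)) \<longlonglongrightarrow> f z" for z
      proof (rule LIM_zero_cancel, rule tendsto_rabs_zero_cancel)
        show "(\<lambda>i. \<bar>poly (p i) (exp_neg z) - f z\<bar>) \<longlonglongrightarrow> 0"
          by (rule tendsto_sandwich[OF _ _ tendsto_const lim_inverse_n'[THEN LIMSEQ_Suc]])
            (use p in \<open>auto simp: abs_minus_commute less_imp_le\<close>)
      qed
    qed
  qed
  have "sets (borel :: ennreal measure) = sigma_sets UNIV (range lessThan)"
    by (subst borel_Iio) (simp add: sets_measure_of)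
  then have A': "A \<in> sigma_sets UNIV (range lessThan)"
    using A by simp
  have stable: "Int_stable (range (lessThan :: ennreal \<Rightarrow> _))"
  proof (rule Int_stableI_image)
    show "\<exists>c\<in>UNIV. {..<a} \<inter> {..<b} = {..<c}" for a b :: ennreal
      by (rule bexI[of _ "min a b"]) auto
  qed
  show ?thesis
  proof (rule sigma_sets_induct_disjoint[OF stable _ A', where P = "\<lambda>A. H (indicator A)"])
    show "range lessThan \<subseteq> Pow (UNIV :: ennreal set)"
      by simp
  next
    fix A :: "ennreal set" assume "A \<in> range lessThan"
    then obtain a where A: "A = {..<a}" by auto
    show "H (indicator A)"
    proof (rule lim)
      fix i :: nat
      \<comment> \<open>A continuous ramp that vanishes for \<open>z \<ge> a\<close>. For
        \<open>z < a\<close> the difference is positive, so the ramp is eventually equal to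
        1.\<close>
      let ?F = "\<lambda>z. max 0 (min 1 (real i * (exp_neg z - exp_neg a)))"
      show "H ?F"
        by (intro cont continuous_intros continuous_exp_neg)
      show "\<bar>?F z\<bar> \<le> 1" for z
        by auto
    next
      fix z
      show "(\<lambda>i. max 0 (min 1 (real i * (exp_neg z - exp_neg a)))) \<longlonglongrightarrow> indicator A z"
      proof (cases "z < a")
        case False
        then have "real i * (exp_neg z - exp_neg a) \<le> 0" for i
          by (auto simp: mult_le_0_iff not_less)
        then show ?thesis
          using False by (simp add: A max_absorb1 min.coboundedI2)
      next
        case True
        then have pos: "exp_neg a < exp_neg z"
          by simp
        then obtain N :: nat where N: "1 < real N * (exp_neg z - exp_neg a)"
          using reals_Archimedean3[of "exp_neg z - exp_neg a"] by auto
        have "\<forall>\<^sub>F i in sequentially. max 0 (min 1 (real i * (exp_neg z - exp_neg a))) = 1"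
          using eventually_ge_at_top[of N]
        proof eventually_elim
          case (elim i)
          have "real N * (exp_neg z - exp_neg a) \<le> real i * (exp_neg z - exp_neg a)"
            using elim pos by (intro mult_right_mono) auto
          then show ?case
            using N by simp
        qed
        then show ?thesis
          using True by (simp add: A tendsto_eventually)
      qed
    qed
  next
    show "H (indicator {})"
    proof -
      have "indicator {} = (\<lambda>z :: ennreal. 0 :: real)"
        by (simp add: fun_eq_iff)
      then show ?thesis
        using zero by simp
    qed
  next
    fix A :: "ennreal set" assume "H (indicator A)"
    from add[OF pow scale[OF this], of 0 "-1"]
    have "H (\<lambda>z. exp_neg z ^ 0 + - 1 * indicator A z)" .
    also have "(\<lambda>z. exp_neg z ^ 0 + - 1 * indicator A z) = (indicator (UNIV - A) :: ennreal \<Rightarrow> real)"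
      by (auto simp: fun_eq_iff indicator_def)
    finally show "H (indicator (UNIV - A))" .
  next
    fix A :: "nat \<Rightarrow> ennreal set"
    assume disj: "disjoint_family A" and A: "\<And>i. H (indicator (A i))"
    have *: "H (\<lambda>z. \<Sum>k<n. indicator (A k) z)" for n
      by (induction n) (auto intro!: zero add A)
    have sum_eq: "(\<Sum>k<n. indicator (A k) z) = (indicator (\<Union>k<n. A k) z :: real)" for n z
      using disj by (intro indicator_UN_disjoint[symmetric]) (auto simp: disjoint_family_on_def)
    show "H (indicator (\<Union> (range A)))"
    proof (rule lim[OF *])
      show "\<bar>\<Sum>k<n. indicator (A k) z\<bar> \<le> (1::real)" for n z
        unfolding sum_eq by (simp add: indicator_def)
      show "(\<lambda>n. \<Sum>k<n. indicator (A k) z) \<longlonglongrightarrow> (indicator (\<Union> (range A)) z :: real)" for z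
        unfolding sum_eq by (rule LIMSEQ_indicator_UN)
    qed
  qed
qed

section \<open>Laplace transforms determine probability measures\<close>

lemma prob_algebraD:
  assumes "q \<in> space (prob_algebra M)"
  shows "prob_space q" "sets q = sets M" "space q = space M" "measurable q = measurable M"
  using assms by (auto simp: space_prob_algebra dest: sets_eq_imp_space_eq intro: measurable_cong_sets)

lemma prob_algebra_integrable_bounded:
  fixes f :: "'a \<Rightarrow> real"
  assumes q: "q \<in> space (prob_algebra M)" and f: "f \<in> borel_measurable M"
    and bnd: "\<And>z. z \<in> space M \<Longrightarrow> \<bar>f z\<bar> \<le> C"
  shows "integrable q f"
proof -
  interpret prob_space q
    using q by (rule prob_algebraD)
  show ?thesis
    using f bnd prob_algebraD[OF q] by (intro integrable_const_bound[of _ C]) auto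
qed

text \<open>The bounded Borel functions whose integral depends measurably on the parameter satisfy
  the closure conditions of \<open>exp_neg_monotone_class\<close>, the limit condition by dominated
  convergence. The zeroth power integrates to 1, so only positive moments have to be
  supplied.\<close>

lemma measurable_exp_neg_moments:
  assumes q: "\<And>y. y \<in> space N \<Longrightarrow> q y \<in> space (prob_algebra borel)"
    and meas: "\<And>n. 0 < n \<Longrightarrow> (\<lambda>y. \<integral>z. exp_neg z ^ n \<partial>q y) \<in> borel_measurable N"
  shows "q \<in> N \<rightarrow>\<^sub>M prob_algebra borel"
proof -
  define H where "H f \<longleftrightarrow> f \<in> borel_measurable borel \<and> (\<exists>C. \<forall>z. \<bar>f z\<bar> \<le> C) \<and>
    (\<lambda>y. integral\<^sup>L (q y) f) \<in> borel_measurable N" for f :: "ennreal \<Rightarrow> real"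
  have H_ind: "H (indicator A)" if "A \<in> sets borel" for A
    using _ _ _ _ that
  proof (rule exp_neg_monotone_class)
    show "H (\<lambda>z. exp_neg z ^ n)" for n
    proof (cases "n = 0")
      case True
      have "(\<lambda>y. measure (q y) (space (q y))) \<in> borel_measurable N \<longleftrightarrow>
          (\<lambda>y. 1 :: real) \<in> borel_measurable N"
        using prob_algebraD(1)[OF q] by (intro measurable_cong) (simp add: prob_space.prob_space)
      then show ?thesis
        using True by (auto simp: H_def)
    next
      case False
      then show ?thesis
        using meas[of n] by (auto simp: H_def intro!: exI[of _ 1] power_le_one)
    qed
  next
    fix f g assume *: "H f" "H g"
    then obtain C D where C: "\<And>z. \<bar>f z\<bar> \<le> C" and D: "\<And>z. \<bar>g z\<bar> \<le> D"
      and meas: "f \<in> borel_measurable borel" "g \<in> borel_measurable borel"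
      by (auto simp: H_def)
    have "(\<integral>z. f z + g z \<partial>q y) = integral\<^sup>L (q y) f + integral\<^sup>L (q y) g" if "y \<in> space N" for y
      using q[OF that] meas C D
      by (intro Bochner_Integration.integral_add prob_algebra_integrable_bounded) auto
    then have "(\<lambda>y. \<integral>z. f z + g z \<partial>q y) \<in> borel_measurable N \<longleftrightarrow>
        (\<lambda>y. integral\<^sup>L (q y) f + integral\<^sup>L (q y) g) \<in> borel_measurable N"
      by (intro measurable_cong) auto
    moreover have "\<bar>f z + g z\<bar> \<le> C + D" for z
      using C[of z] D[of z] by linarith
    ultimately show "H (\<lambda>z. f z + g z)"
      using * by (auto simp: H_def)
  next
    fix c f assume "H f"
    then obtain C where "\<And>z. \<bar>f z\<bar> \<le> C"
      by (auto simp: H_def)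
    then have "\<bar>c * f z\<bar> \<le> \<bar>c\<bar> * C" for z
      by (simp add: abs_mult mult_left_mono)
    then show "H (\<lambda>z. c * f z)"
      using \<open>H f\<close> by (auto simp: H_def)
  next
    fix F :: "nat \<Rightarrow> ennreal \<Rightarrow> real" and C f
    assume H: "\<And>i. H (F i)" and bnd: "\<And>i z. \<bar>F i z\<bar> \<le> C" and lim: "\<And>z. (\<lambda>i. F i z) \<longlonglongrightarrow> f z"
    have F [measurable]: "F i \<in> borel_measurable borel" for i
      using H by (simp add: H_def)
    have f [measurable]: "f \<in> borel_measurable borel"
      using lim by (intro borel_measurable_LIMSEQ_real[OF _ F]) auto
    have "(\<lambda>i. integral\<^sup>L (q y) (F i)) \<longlonglongrightarrow> integral\<^sup>L (q y) f" if "y \<in> space N" for y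
      using prob_algebraD[OF q[OF that]]
        prob_algebra_integrable_bounded[OF q[OF that], of "\<lambda>_. C"] bnd lim
      by (intro integral_dominated_convergence[where w = "\<lambda>_. C"]) auto
    moreover have "(\<lambda>y. integral\<^sup>L (q y) (F i)) \<in> borel_measurable N" for i
      using H[of i] by (simp add: H_def)
    ultimately have "(\<lambda>y. integral\<^sup>L (q y) f) \<in> borel_measurable N"
      by (rule borel_measurable_LIMSEQ_real)
    moreover have "\<bar>f z\<bar> \<le> C" for z
      using bnd lim by (intro LIMSEQ_le_const2[OF tendsto_rabs[OF lim]]) auto
    ultimately show "H f"
      by (auto simp: H_def)
  qed
  show ?thesis
  proof (rule measurable_prob_algebra_generated[of _ UNIV "sets borel"])
    show "sets (borel :: ennreal measure) = sigma_sets UNIV (sets borel)"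
      using sets.sigma_sets_eq[of "borel :: ennreal measure"] by simp
    show "(\<lambda>y. emeasure (q y) A) \<in> borel_measurable N" if "A \<in> sets borel" for A
    proof -
      have "emeasure (q y) A = ennreal (\<integral>z. indicator A z \<partial>q y)" if "y \<in> space N" for y
        using prob_algebraD[OF q[OF that]] \<open>A \<in> sets borel\<close>
        by (simp add: finite_measure.emeasure_eq_measure[OF prob_space.finite_measure])
      then show ?thesis
        using H_ind[OF that] by (subst measurable_cong[of _ _ "\<lambda>y. ennreal (\<integral>z. indicator A z \<partial>q y)"])
          (auto simp: H_def)
    qed
  qed (use q in \<open>auto simp: space_prob_algebra sets.Int_stable\<close>)
qed

text \<open>Uniqueness is read off from the preceding measurability lemma, applied to the
  two-element family \<open>r\<close>; this spares a second monotone class argument.\<close>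

lemma exp_neg_moments_unique:
  assumes p: "p \<in> space (prob_algebra borel)" and q: "q \<in> space (prob_algebra borel)"
    and eq: "\<And>n. 0 < n \<Longrightarrow> (\<integral>z. exp_neg z ^ n \<partial>p) = (\<integral>z. exp_neg z ^ n \<partial>q)"
  shows "p = q"
proof -
  \<comment> \<open>On the trivial \<open>\<sigma>\<close>-algebra, measurable functions are constant.\<close>
  define N where "N = sigma (UNIV :: bool set) {}"
  define r where "r b = (if b then p else q)" for b
  have "r \<in> N \<rightarrow>\<^sub>M prob_algebra borel"
  proof (rule measurable_exp_neg_moments)
    show "r b \<in> space (prob_algebra borel)" for b
      using p q by (simp add: r_def)
    show "(\<lambda>b. \<integral>z. exp_neg z ^ n \<partial>r b) \<in> borel_measurable N" if "0 < n" for n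
    proof -
      have "(\<lambda>b. \<integral>z. exp_neg z ^ n \<partial>r b) = (\<lambda>b. \<integral>z. exp_neg z ^ n \<partial>p)"
        using eq[OF that] by (auto simp: r_def)
      then show ?thesis
        by simp
    qed
  qed
  have "measure p A = measure q A" if "A \<in> sets borel" for A
  proof -
    have "(\<lambda>b. measure (r b) A) \<in> borel_measurable N"
      using \<open>r \<in> N \<rightarrow>\<^sub>M prob_algebra borel\<close> that by measurable
    then have "(\<lambda>b. measure (r b) A) -` {measure p A} \<inter> space N \<in> sets N"
      by (rule measurable_sets) simp
    moreover have "True \<in> (\<lambda>b. measure (r b) A) -` {measure p A} \<inter> space N"
      by (simp add: N_def r_def)
    moreover have "sets N = {{}, UNIV}"
      by (simp add: N_def sigma_sets_empty_eq)
    ultimately have "False \<in> (\<lambda>b. measure (r b) A) -` {measure p A} \<inter> space N"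
      by auto
    then show ?thesis
      by (simp add: r_def)
  qed
  then show ?thesis
    using prob_algebraD[OF p] prob_algebraD[OF q]
    by (intro measure_eqI) (auto simp: finite_measure.emeasure_eq_measure[OF prob_space.finite_measure])
qed

section \<open>Alternating differences and the Hausdorff moment problem\<close>

text \<open>The m-th power of the operator I - S, where S is composition with \<open>s\<close>. The
  shift is a parameter so that sequences (\<open>s = Suc\<close>) and functions on the half-line
  (\<open>s\<close> a translation by \<open>h\<close>) share one theory.\<close>

primrec alt_diff :: "nat \<Rightarrow> ('a \<Rightarrow> 'a) \<Rightarrow> ('a \<Rightarrow> real) \<Rightarrow> 'a \<Rightarrow> real" where
  "alt_diff 0 s g x = g x"
| "alt_diff (Suc m) s g x = alt_diff m s g x - alt_diff m s g (s x)"

text \<open>Powers of one operator commute, so the additional difference may also be taken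
  first.\<close>

lemma alt_diff_Suc': "alt_diff m s (\<lambda>x. g x - g (s x)) x = alt_diff (Suc m) s g x"
  by (induction m arbitrary: x) auto

lemma alt_diff_cmult: "alt_diff m s (\<lambda>x. c * g x) x = c * alt_diff m s g x"
  by (induction m arbitrary: x) (auto simp: right_diff_distrib)

lemma alt_diff_add: "alt_diff m s (\<lambda>x. f x + g x) x = alt_diff m s f x + alt_diff m s g x"
  by (induction m arbitrary: x) auto

lemma alt_diff_const: "alt_diff m s (\<lambda>_. c) x = (if m = 0 then c else 0)"
  by (induction m arbitrary: x) auto

lemma tendsto_alt_diff:
  assumes "\<And>x. ((\<lambda>i. g i x) \<longlongrightarrow> f x) F"
  shows "((\<lambda>i. alt_diff m s (g i) x) \<longlongrightarrow> alt_diff m s f x) F"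
  by (induction m arbitrary: x) (auto intro!: tendsto_diff assms)

lemma alt_diff_integral:
  assumes "\<And>x. integrable M (\<lambda>z. g x z)"
  shows "integrable M (\<lambda>z. alt_diff m s (\<lambda>x. g x z) x) \<and>
    alt_diff m s (\<lambda>x. \<integral>z. g x z \<partial>M) x = (\<integral>z. alt_diff m s (\<lambda>x. g x z) x \<partial>M)"
  by (induction m arbitrary: x) (auto simp: assms)

text \<open>Used with f the inclusion of a grid in the line: \<open>Suc\<close> on indices becomes a
  translation.\<close>

lemma alt_diff_reindex:
  assumes "\<And>x. f (s x) = t (f x)"
  shows "alt_diff m s (\<lambda>x. g (f x)) x = alt_diff m t g (f x)"
  by (induction m arbitrary: x) (auto simp: assms)

text \<open>The binomial expansion of the identity as ((I - S) + S)^m, evaluated at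
  \<open>k\<close>.\<close>

lemma sum_binomial_alt_diff:
  "(\<Sum>i\<le>m. real (m choose i) * alt_diff (m - i) Suc c (k + i)) = c k"
proof (induction m arbitrary: k)
  case 0
  then show ?case by simp
next
  case (Suc m)
  let ?a = "\<lambda>m. alt_diff m Suc c"
  let ?S = "\<lambda>k. \<Sum>i\<le>m. real (m choose i) * ?a (m - i) (k + i)"
  have "(\<Sum>i\<le>Suc m. real (Suc m choose i) * ?a (Suc m - i) (k + i)) =
      ?a (Suc m) k + (\<Sum>i\<le>m. real (m choose Suc i) * ?a (m - i) (k + Suc i)) + ?S (Suc k)"
    unfolding sum.atMost_Suc_shift by (simp add: distrib_right sum.distrib)
  also have "?a (Suc m) k + (\<Sum>i\<le>m. real (m choose Suc i) * ?a (m - i) (k + Suc i)) =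
      (\<Sum>i\<le>Suc m. real (m choose i) * ?a (Suc m - i) (k + i))"
    unfolding sum.atMost_Suc_shift by simp
  also have "\<dots> = (\<Sum>i\<le>m. real (m choose i) * ?a (Suc m - i) (k + i))"
    by simp
  also have "\<dots> = ?S k - ?S (Suc k)"
    unfolding sum_subtractf[symmetric]
    by (intro sum.cong refl) (simp add: Suc_diff_le right_diff_distrib)
  finally show ?case
    by (simp add: Suc.IH)
qed

text \<open>This is the normalised k-th factorial moment of the weights. The identity \<open>(n
  choose j) * (j choose k) = (n choose k) * (n - k choose j - k)\<close> cancels the normalisation
  and leaves the previous sum.\<close>

lemma sum_binomial_ratio_alt_diff:
  assumes "k \<le> n"
  shows "(\<Sum>j\<le>n. real (n choose j) * alt_diff (n - j) Suc c j * (real (j choose k) / real (n choose k))) = c k"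
proof -
  let ?f = "\<lambda>j. real (n choose j) * alt_diff (n - j) Suc c j * (real (j choose k) / real (n choose k))"
  have "sum ?f {..n} = sum ?f {k..n}"
    by (rule sum.mono_neutral_right) auto
  also have "\<dots> = (\<Sum>i\<le>n - k. ?f (k + i))"
    by (rule sum.reindex_bij_witness[of _ "\<lambda>i. k + i" "\<lambda>j. j - k"]) (use assms in auto)
  also have "\<dots> = (\<Sum>i\<le>n - k. real (n - k choose i) * alt_diff (n - k - i) Suc c (k + i))"
  proof (rule sum.cong[OF refl])
    fix i assume "i \<in> {..n - k}"
    then have "real (n choose (k + i)) * real ((k + i) choose k) = real (n choose k) * real (n - k choose i)"
      using choose_mult[of k "k + i" n] assms by (simp flip: of_nat_mult)
    moreover have "real (n choose k) > 0"
      using assms by simp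
    ultimately show "?f (k + i) = real (n - k choose i) * alt_diff (n - k - i) Suc c (k + i)"
      by (simp add: field_simps)
  qed
  also have "\<dots> = c k"
    by (rule sum_binomial_alt_diff)
  finally show ?thesis .
qed

lemma binomial_Suc_real: "real (Suc k) * real (j choose Suc k) = real (j choose k) * (real j - real k)"
proof (cases "Suc k \<le> j")
  case True
  then have "(j choose Suc k) * Suc k = (j choose k) * (j - k)"
    using choose_mult[of k "Suc k" j] by simp
  then have "real (j choose Suc k) * real (Suc k) = real (j choose k) * real (j - k)"
    by (metis of_nat_mult)
  then show ?thesis
    using True by (simp add: of_nat_diff mult.commute)
next
  case False
  then show ?thesis
    by (cases "j = k") (auto simp: binomial_eq_0)
qed

text \<open>The error must be uniform in j. Passing from k to k + 1 multiplies the two expressions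
  by j / n and by (j - k) / (n - k), which differ by at most k / (n - k); the factors multiplying
  the errors stay in [0, 1].\<close>

lemma binomial_ratio_approx:
  "\<exists>e. e \<longlonglongrightarrow> 0 \<and> (\<forall>n>k. \<forall>j\<le>n. \<bar>(real j / real n) ^ k - real (j choose k) / real (n choose k)\<bar> \<le> e n)"
proof (induction k)
  case 0
  then show ?case
    by (intro exI[of _ "\<lambda>_. 0"]) auto
next
  case (Suc k)
  then obtain e where e: "e \<longlonglongrightarrow> 0"
    and bnd: "\<And>n j. k < n \<Longrightarrow> j \<le> n \<Longrightarrow>
      \<bar>(real j / real n) ^ k - real (j choose k) / real (n choose k)\<bar> \<le> e n"
    by auto
  show ?case
  proof (intro exI[of _ "\<lambda>n. e n + real k / (real n - real k)"] conjI allI impI)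
    have "(\<lambda>n. real k / (real n - real k)) \<longlonglongrightarrow> 0"
      by real_asymp
    then show "(\<lambda>n. e n + real k / (real n - real k)) \<longlonglongrightarrow> 0"
      using tendsto_add[OF e] by simp
  next
    fix n j assume n: "Suc k < n" and j: "j \<le> n"
    define a where "a = (real j / real n) ^ k"
    define b where "b = real j / real n"
    define a' where "a' = real (j choose k) / real (n choose k)"
    define b' where "b' = (real j - real k) / (real n - real k)"
    have b: "0 \<le> b" "b \<le> 1"
      using j n by (auto simp: b_def)
    have a': "0 \<le> a'" "a' \<le> 1"
      using binomial_right_mono[OF j, of k] n by (auto simp: a'_def divide_le_eq)
    have "real (j choose Suc k) / real (n choose Suc k) =
        (real (Suc k) * real (j choose Suc k)) / (real (Suc k) * real (n choose Suc k))"
      by simp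
    also have "\<dots> = a' * b'"
      unfolding binomial_Suc_real a'_def b'_def by simp
    finally have ratio: "real (j choose Suc k) / real (n choose Suc k) = a' * b'" .
    have "b - b' = real k * (real n - real j) / (real n * (real n - real k))"
      using n by (simp add: b_def b'_def field_simps)
    moreover have "\<dots> \<le> real k * real n / (real n * (real n - real k))"
      using n by (intro divide_right_mono mult_left_mono) auto
    moreover have "0 \<le> real k * (real n - real j) / (real n * (real n - real k))"
      using n j by (intro divide_nonneg_nonneg mult_nonneg_nonneg) auto
    ultimately have bb: "\<bar>b - b'\<bar> \<le> real k / (real n - real k)"
      using n by simp
    have "\<bar>a * b - a' * b'\<bar> = \<bar>(a - a') * b + a' * (b - b')\<bar>"
      by (simp add: algebra_simps)
    also have "\<dots> \<le> \<bar>a - a'\<bar> * b + a' * \<bar>b - b'\<bar>"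
      using b a' by (metis abs_mult abs_of_nonneg abs_triangle_ineq)
    also have "\<dots> \<le> \<bar>a - a'\<bar> * 1 + 1 * \<bar>b - b'\<bar>"
      using b a' by (intro add_mono mult_mono) auto
    also have "\<dots> \<le> e n + real k / (real n - real k)"
      using bnd[of n j] bb n j by (simp add: a_def a'_def)
    finally show "\<bar>(real j / real n) ^ Suc k - real (j choose Suc k) / real (n choose Suc k)\<bar>
        \<le> e n + real k / (real n - real k)"
      unfolding ratio by (simp add: a_def b_def mult.commute)
  qed
qed

text \<open>The Bernstein-type distributions putting mass \<open>(n choose j) \<cdot> alt_diff (n - j) Suc c j\<close> at
  \<open>j / n\<close> have factorial moments exactly \<open>c\<close>; any weak limit point solves the moment problem.\<close>

lemma hausdorff_moment:
  fixes c :: "nat \<Rightarrow> real"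
  assumes c0: "c 0 = 1" and pos: "\<And>m k. 0 \<le> alt_diff m Suc c k"
  shows "\<exists>q\<in>space (prob_algebra borel). \<forall>k. (\<integral>z. exp_neg z ^ k \<partial>q) = c k"
proof -
  define w where "w n j = (if j \<le> n then real (n choose j) * alt_diff (n - j) Suc c j else 0)" for n j
  have w_nonneg: "0 \<le> w n j" for n j
    by (simp add: w_def pos)
  have w_ratio: "(\<Sum>j\<le>n. w n j * (real (j choose k) / real (n choose k))) = c k" if "k \<le> n" for n k
    using sum_binomial_ratio_alt_diff[OF that, of c] by (simp add: w_def)
  have w_sum: "(\<Sum>j\<le>n. w n j) = 1" for n
    using w_ratio[of 0 n] by (simp add: c0)
  have w_total: "(\<integral>\<^sup>+j. ennreal (w n j) \<partial>count_space UNIV) = 1" for n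
  proof -
    have "(\<integral>\<^sup>+j. ennreal (w n j) \<partial>count_space UNIV) = (\<Sum>j\<le>n. ennreal (w n j))"
      by (rule nn_integral_count_space'[of "{..n}"]) (auto simp: w_def)
    then show ?thesis
      by (simp add: w_nonneg w_sum)
  qed
  define p where "p n = embed_pmf (w n)" for n
  have pmf_p: "pmf (p n) j = w n j" for n j
    unfolding p_def using w_nonneg w_total by (rule pmf_embed_pmf)
  have set_p: "set_pmf (p n) \<subseteq> {..n}" for n
    by (auto simp: set_pmf_eq pmf_p w_def)
  define \<mu> where "\<mu> n = distr (measure_pmf (p n)) borel (\<lambda>j. real j / real n)" for n
  have \<mu>_distribution: "real_distribution (\<mu> n)" for n
    unfolding \<mu>_def real_distribution_def real_distribution_axioms_def
    by (auto intro!: prob_space.prob_space_distr prob_space_measure_pmf)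
  have "tight \<mu>"
    unfolding tight_def
  proof (intro conjI allI impI \<mu>_distribution)
    fix \<epsilon> :: real assume "\<epsilon> > 0"
    \<comment> \<open>All mass lies in [0, 1], also for n = 0, where the quotient is 0 / 0 = 0. The
      endpoint -1 keeps the atom at 0 inside the left-open interval.\<close>
    have "measure (\<mu> n) {-1<..1} = 1" for n
    proof -
      interpret real_distribution "\<mu> n"
        by (rule \<mu>_distribution)
      have "AE u in \<mu> n. u \<in> {-1<..1}"
        unfolding \<mu>_def using set_p[of n]
        by (subst AE_distr_iff) (auto simp: AE_measure_pmf_iff divide_le_eq less_le_trans[OF _ divide_nonneg_nonneg])
      then show ?thesis
        by (simp add: prob_eq_1)
    qed
    then show "\<exists>a b. a < b \<and> (\<forall>n. 1 - \<epsilon> < measure (\<mu> n) {a<..b})"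
      using \<open>\<epsilon> > 0\<close> by (intro exI[of _ "-1"] exI[of _ 1]) auto
  qed
  from tight_imp_convergent_subsubsequence[OF this strict_mono_id]
  obtain r M where r: "strict_mono r" and M: "real_distribution M" and conv: "weak_conv_m (\<mu> \<circ> r) M"
    by (auto simp: comp_def id_def)
  interpret M: real_distribution M
    by (rule M)
  \<comment> \<open>Clamping makes the powers bounded and continuous on the whole line, as weak
    convergence demands, and leaves their values on the supports of the approximating measures
    unchanged.\<close>
  define cl where "cl u = max 0 (min 1 u)" for u :: real
  have [measurable]: "cl \<in> borel_measurable borel"
    unfolding cl_def by measurable
  define q where "q = distr M borel (\<lambda>u. neg_ln (cl u))"
  have "q \<in> space (prob_algebra borel)"
    by (auto simp: q_def space_prob_algebra intro!: M.prob_space_distr)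
  moreover have "(\<integral>z. exp_neg z ^ k \<partial>q) = c k" for k
  proof -
    have "(\<integral>z. exp_neg z ^ k \<partial>q) = (\<integral>u. exp_neg (neg_ln (cl u)) ^ k \<partial>M)"
      unfolding q_def by (subst integral_distr) auto
    also have "\<dots> = (\<integral>u. cl u ^ k \<partial>M)"
      by (simp add: exp_neg_neg_ln cl_def)
    finally have q_eq: "(\<integral>z. exp_neg z ^ k \<partial>q) = (\<integral>u. cl u ^ k \<partial>M)" .
    have "(\<lambda>n. integral\<^sup>L ((\<mu> \<circ> r) n) (\<lambda>u. cl u ^ k)) \<longlonglongrightarrow> (\<integral>u. cl u ^ k \<partial>M)"
    proof (rule weak_conv_imp_integral_bdd_continuous_conv[OF _ M conv])
      show "real_distribution ((\<mu> \<circ> r) n)" for n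
        by (simp add: \<mu>_distribution)
      show "isCont (\<lambda>u. cl u ^ k) u" for u
        unfolding cl_def by (intro continuous_intros)
      show "norm (cl u ^ k) \<le> 1" for u
        by (simp add: cl_def power_le_one)
    qed
    moreover from binomial_ratio_approx[of k] obtain e where e: "e \<longlonglongrightarrow> 0" and
      bnd: "\<forall>n>k. \<forall>j\<le>n. \<bar>(real j / real n) ^ k - real (j choose k) / real (n choose k)\<bar> \<le> e n"
      by (elim exE conjE)
    \<comment> \<open>The k-th power moment of \<open>\<mu> n\<close> differs by at most
      \<open>e n\<close> from the normalised factorial moment, which equals \<open>c k\<close>
      exactly.\<close>
    have "(\<lambda>n. integral\<^sup>L (\<mu> n) (\<lambda>u. cl u ^ k)) \<longlonglongrightarrow> c k"
    proof (rule LIM_zero_cancel, rule Lim_null_comparison[OF _ e])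
      show "\<forall>\<^sub>F n in sequentially. norm (integral\<^sup>L (\<mu> n) (\<lambda>u. cl u ^ k) - c k) \<le> e n"
        using eventually_gt_at_top[of k]
      proof eventually_elim
        case (elim n)
        have "integral\<^sup>L (\<mu> n) (\<lambda>u. cl u ^ k) = (\<integral>j. cl (real j / real n) ^ k \<partial>measure_pmf (p n))"
          unfolding \<mu>_def by (subst integral_distr) auto
        also have "\<dots> = (\<Sum>j\<le>n. cl (real j / real n) ^ k * w n j)"
          using set_p[of n] by (subst integral_measure_pmf_real[of "{..n}"]) (auto simp: pmf_p)
        also have "\<dots> = (\<Sum>j\<le>n. (real j / real n) ^ k * w n j)"
          using elim by (intro sum.cong) (auto simp: cl_def)
        finally have "integral\<^sup>L (\<mu> n) (\<lambda>u. cl u ^ k) - c k =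
            (\<Sum>j\<le>n. (real j / real n) ^ k * w n j) - (\<Sum>j\<le>n. w n j * (real (j choose k) / real (n choose k)))"
          using elim w_ratio[of k n] by simp
        also have "\<dots> = (\<Sum>j\<le>n. w n j * ((real j / real n) ^ k - real (j choose k) / real (n choose k)))"
          by (simp add: sum_subtractf[symmetric] algebra_simps)
        also have "norm \<dots> \<le> (\<Sum>j\<le>n. w n j * e n)"
          using bnd elim w_nonneg
          by (intro sum_norm_le) (simp add: abs_mult mult_left_mono)
        also have "\<dots> = e n"
          by (simp add: w_sum flip: sum_distrib_right)
        finally show ?case .
      qed
    qed
    from LIMSEQ_subseq_LIMSEQ[OF this r]
    have "(\<lambda>n. integral\<^sup>L ((\<mu> \<circ> r) n) (\<lambda>u. cl u ^ k)) \<longlonglongrightarrow> c k"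
      by (simp add: comp_def)
    ultimately show ?thesis
      unfolding q_eq by (rule LIMSEQ_unique)
  qed
  ultimately show ?thesis
    by blast
qed

section \<open>Bernstein's theorem\<close>

definition alt_nonneg :: "(real \<Rightarrow> real) \<Rightarrow> bool" where
  "alt_nonneg g \<longleftrightarrow> (\<forall>m h x. 0 < h \<longrightarrow> 0 < x \<longrightarrow> 0 \<le> alt_diff m (\<lambda>x. x + h) g x)"

lemma alt_nonnegD: "alt_nonneg g \<Longrightarrow> 0 < h \<Longrightarrow> 0 < x \<Longrightarrow> 0 \<le> alt_diff m (\<lambda>x. x + h) g x"
  by (simp add: alt_nonneg_def)

lemma alt_nonneg_nonneg: "alt_nonneg g \<Longrightarrow> 0 < x \<Longrightarrow> 0 \<le> g x"
  using alt_nonnegD[of g 1 x 0] by simp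

lemma alt_nonneg_antimono: "alt_nonneg g \<Longrightarrow> 0 < x \<Longrightarrow> x \<le> y \<Longrightarrow> g y \<le> g x"
  using alt_nonnegD[of g "y - x" x 1] by (cases "x = y") auto

text \<open>By convexity, the \<open>N\<close> steps of length \<open>d\<close> before \<open>x\<close> all drop at least as much as the one
  after \<open>x\<close>.\<close>

lemma alt_nonneg_drop:
  assumes g: "alt_nonneg g" and le1: "\<And>x. 0 < x \<Longrightarrow> g x \<le> 1"
    and d: "0 < d" and x: "real N * d < x"
  shows "real N * (g x - g (x + d)) \<le> 1"
proof -
  define f where "f i = g (x - real i * d)" for i
  have pos: "0 < x - real i * d" if "i \<le> N" for i
  proof -
    have "real i * d \<le> real N * d"
      using that d by (intro mult_right_mono) auto
    then show ?thesis
      using x by linarith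
  qed
  have step: "g x - g (x + d) \<le> f (Suc i) - f i" if "i < N" for i
    using that
  proof (induction i)
    case 0
    then show ?case
      using alt_nonnegD[OF g d pos[of 1], of 2] by (simp add: f_def numeral_2_eq_2)
  next
    case (Suc i)
    \<comment> \<open>A nonnegative second difference at the leftmost of three consecutive grid
      points says that drops shrink to the right.\<close>
    then have "0 \<le> alt_diff 2 (\<lambda>x. x + d) g (x - real (Suc (Suc i)) * d)"
      by (intro alt_nonnegD[OF g d] pos) auto
    then show ?case
      using Suc by (simp add: f_def numeral_2_eq_2 algebra_simps)
  qed
  have "real N * (g x - g (x + d)) = (\<Sum>i<N. g x - g (x + d))"
    by simp
  also have "\<dots> \<le> (\<Sum>i<N. f (Suc i) - f i)"
    using step by (intro sum_mono) auto
  also have "\<dots> = f N - f 0"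
    by (rule sum_lessThan_telescope)
  also have "\<dots> \<le> 1"
    using le1[OF pos[of N]] alt_nonneg_nonneg[OF g pos[of 0]] by (simp add: f_def)
  finally show ?thesis .
qed

text \<open>If s - r < r / (N + 1), then N steps of length s - r to the left of r stay inside the
  half-line, so \<open>alt_nonneg_drop\<close> bounds the drop from r to s by 1 / N.\<close>

lemma alt_nonneg_right_continuous:
  assumes g: "alt_nonneg g" and le1: "\<And>x. 0 < x \<Longrightarrow> g x \<le> 1" and r: "0 < r"
  shows "(g \<longlongrightarrow> g r) (at_right r)"
proof (rule tendstoI)
  fix e :: real assume "0 < e"
  then obtain N :: nat where N: "1 < real N * e"
    using reals_Archimedean3 by blast
  have "\<forall>\<^sub>F s in at_right r. r < s \<and> s < r + r / (real N + 1)"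
    using r eventually_at_right[of r "r + 1"] by (intro eventually_conj eventually_at_right_less
      eventually_at_rightI[of r "r + r / (real N + 1)"]) auto
  then show "\<forall>\<^sub>F s in at_right r. dist (g s) (g r) < e"
  proof eventually_elim
    case (elim s)
    then have "(real N + 1) * (s - r) < r"
      by (simp add: field_simps)
    then have "real N * (s - r) < r"
      using elim by (simp add: algebra_simps)
    then have *: "real N * (g r - g s) \<le> 1"
      using alt_nonneg_drop[OF g le1, of "s - r" N r] elim by simp
    have "real N * (g r - g s) < real N * e"
      using * N by linarith
    then have "g r - g s < e"
      by (simp add: mult_less_cancel_left)
    moreover have "g s \<le> g r"
      using alt_nonneg_antimono[OF g r] elim by simp
    ultimately show ?case
      by (simp add: dist_real_def)
  qed
qed

lemma alt_diff_Suc_cong: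
  "(\<And>i. k \<le> i \<Longrightarrow> c i = c' i) \<Longrightarrow> alt_diff m Suc c k = alt_diff m Suc c' k"
  by (induction m arbitrary: k) auto

text \<open>In every alternating difference at 0 the entry with index 0 has coefficient 1. Hence
  raising that entry raises the difference by the same amount.\<close>

lemma alt_diff_Suc_delta: "alt_diff m Suc (\<lambda>k. if k = 0 then a else 0) 0 = a"
proof (induction m)
  case (Suc m)
  have "alt_diff m Suc (\<lambda>k. if k = 0 then a else 0) (Suc 0) = alt_diff m Suc (\<lambda>_. 0) (Suc 0)"
    by (rule alt_diff_Suc_cong) auto
  then show ?case
    using Suc by (simp add: alt_diff_const)
qed simp

text \<open>The delicate index is k = 0, where the sequence has the value 1 in place of a value of
  g. Shift the grid to the right by x > 0, so that the differences of g are nonnegative; replacing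
  the entry g x by 1 adds 1 - g x, again nonnegative. Then x decreases to 0, and right continuity of
  g gives the limit.\<close>

lemma alt_nonneg_grid:
  assumes g: "alt_nonneg g" and le1: "\<And>x. 0 < x \<Longrightarrow> g x \<le> 1" and h: "0 < h"
  defines "c \<equiv> \<lambda>k. if k = 0 then 1 else g (real k * h)"
  shows "0 \<le> alt_diff m Suc c k"
proof (cases "k = 0")
  case False
  have "alt_diff m Suc c k = alt_diff m Suc (\<lambda>k. g (real k * h)) k"
    using False by (intro alt_diff_Suc_cong) (auto simp: c_def)
  also have "\<dots> = alt_diff m (\<lambda>x. x + h) g (real k * h)"
    by (rule alt_diff_reindex) (simp add: algebra_simps)
  finally show ?thesis
    using alt_nonnegD[OF g h] h False by simp
next
  case True
  define c' where "c' x k = (if k = 0 then 1 else g (real k * h + x))" for x and k :: nat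
  have "0 \<le> alt_diff m Suc (c' x) 0" if x: "0 < x" for x
  proof -
    have "c' x = (\<lambda>k. g (real k * h + x) + (if k = 0 then 1 - g x else 0))"
      by (auto simp: c'_def)
    then have "alt_diff m Suc (c' x) 0 = alt_diff m Suc (\<lambda>k. g (real k * h + x)) 0 + (1 - g x)"
      by (simp only: alt_diff_add alt_diff_Suc_delta)
    also have "alt_diff m Suc (\<lambda>k. g (real k * h + x)) 0 = alt_diff m (\<lambda>x. x + h) g (real 0 * h + x)"
      by (rule alt_diff_reindex) (simp add: algebra_simps)
    finally show ?thesis
      using alt_nonnegD[OF g h x, of m] le1[OF x] by simp
  qed
  then have ev: "\<forall>\<^sub>F x in at_right 0. 0 \<le> alt_diff m Suc (c' x) 0"
    by (intro eventually_at_rightI[of 0 1]) auto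
  have "((\<lambda>x. alt_diff m Suc (c' x) 0) \<longlongrightarrow> alt_diff m Suc c 0) (at_right 0)"
  proof (rule tendsto_alt_diff)
    fix k
    show "((\<lambda>x. c' x k) \<longlongrightarrow> c k) (at_right 0)"
    proof (cases "k = 0")
      case False
      then have "(g \<longlongrightarrow> g (real k * h)) (at_right (real k * h))"
        using h by (intro alt_nonneg_right_continuous[OF g le1]) auto
      then show ?thesis
        using False by (simp add: c_def c'_def filterlim_at_right_to_0[of _ _ "real k * h"] add.commute)
    qed (simp add: c_def c'_def)
  qed
  from tendsto_lowerbound[OF this ev] True show ?thesis
    by simp
qed

text \<open>A positive limit r keeps the product away from the discontinuity of multiplication at 0
  and \<open>\<top>\<close>: for \<open>z = \<top>\<close> the exponential is eventually 0.\<close>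

lemma tendsto_exp_neg_mult:
  assumes "(f \<longlongrightarrow> r) F" "0 < r"
  shows "((\<lambda>i. exp_neg (ennreal (f i) * z)) \<longlongrightarrow> exp_neg (ennreal r * z)) F"
proof (cases "z = \<top>")
  case True
  have "\<forall>\<^sub>F i in F. 0 < f i"
    using assms by (rule order_tendstoD)
  then have "\<forall>\<^sub>F i in F. exp_neg (ennreal (f i) * z) = 0"
    by eventually_elim (simp add: True ennreal_mult_top)
  then show ?thesis
    using assms(2) by (simp add: True ennreal_mult_top tendsto_eventually)
next
  case False
  then have "((\<lambda>i. z * ennreal (f i)) \<longlongrightarrow> z * ennreal r) F"
    using assms(1) by (intro ennreal_tendsto_cmult tendsto_ennrealI) (simp add: less_top)
  then show ?thesis
    by (intro tendsto_exp_neg) (simp add: mult.commute)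
qed

text \<open>For each n, Hausdorff's theorem on the grid of mesh \<open>1 / 2 ^ n\<close> yields a
  law whose transform agrees with g at the positive grid points. By uniqueness these laws coincide,
  and right continuity extends the formula from dyadic points to all r. If g tends to less than 1 at
  0, the missing mass is an atom at \<open>\<top>\<close>, where the exponential vanishes.\<close>

theorem Bernstein:
  assumes g: "alt_nonneg g" and le1: "\<And>x. 0 < x \<Longrightarrow> g x \<le> 1"
  shows "\<exists>q\<in>space (prob_algebra borel). \<forall>r>0. g r = (\<integral>z. exp_neg (ennreal r * z) \<partial>q)"
proof -
  have "\<exists>q\<in>space (prob_algebra borel). \<forall>k. (\<integral>z. exp_neg (ennreal (real k / 2 ^ n) * z) \<partial>q) =
      (if k = 0 then 1 else g (real k / 2 ^ n))" for n
  proof -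
    obtain q where q: "q \<in> space (prob_algebra borel)"
      and moments: "\<And>k. (\<integral>z. exp_neg z ^ k \<partial>q) = (if k = 0 then 1 else g (real k * (1 / 2 ^ n)))"
      using hausdorff_moment[of "\<lambda>k. if k = 0 then 1 else g (real k * (1 / 2 ^ n))",
          OF _ alt_nonneg_grid[OF g le1, of "1 / 2 ^ n"]] by auto
    \<comment> \<open>Rescaling turns the k-th moment into the Laplace transform at
      \<open>k / 2 ^ n\<close>.\<close>
    let ?q = "distr q borel (\<lambda>z. ennreal (2 ^ n) * z)"
    have "?q \<in> space (prob_algebra borel)"
      using prob_algebraD[OF q] by (auto simp: space_prob_algebra intro!: prob_space.prob_space_distr)
    moreover have "(\<integral>z. exp_neg (ennreal (real k / 2 ^ n) * z) \<partial>?q) =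
        (if k = 0 then 1 else g (real k / 2 ^ n))" for k
    proof -
      have "ennreal (real k / 2 ^ n) * (ennreal (2 ^ n) * z) = of_nat k * z" for z
        by (simp add: ennreal_of_nat_eq_real_of_nat mult.assoc[symmetric] flip: ennreal_mult)
      then show ?thesis
        using prob_algebraD[OF q] moments[of k] by (subst integral_distr) (auto simp: exp_neg_power)
    qed
    ultimately show ?thesis
      by blast
  qed
  then obtain Q where Q: "\<And>n. Q n \<in> space (prob_algebra borel)"
    and Q_int: "\<And>n k. (\<integral>z. exp_neg (ennreal (real k / 2 ^ n) * z) \<partial>Q n) =
      (if k = 0 then 1 else g (real k / 2 ^ n))"
    by metis
  \<comment> \<open>The integers lie on every grid, and the transform at positive integers
    determines the law.\<close>
  have Q_eq: "Q n = Q 0" for n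
  proof (rule exp_neg_moments_unique[OF Q Q])
    fix j :: nat assume "0 < j"
    have "real (j * 2 ^ n) / 2 ^ n = real j"
      by simp
    then show "(\<integral>z. exp_neg z ^ j \<partial>Q n) = (\<integral>z. exp_neg z ^ j \<partial>Q 0)"
      using Q_int[where k = "j * 2 ^ n" and n = n] Q_int[where k = j and n = 0]
      by (simp add: exp_neg_power ennreal_of_nat_eq_real_of_nat)
  qed
  interpret prob_space "Q 0"
    by (rule prob_algebraD[OF Q])
  note [measurable_cong] = prob_algebraD(2)[OF Q[of 0]]
  have "g r = (\<integral>z. exp_neg (ennreal r * z) \<partial>Q 0)" if r: "0 < r" for r
  proof -
    \<comment> \<open>The successor puts the dyadic point \<open>b n\<close> strictly above r, at
      distance at most \<open>(1 / 2) ^ n\<close>, so that right continuity applies.\<close>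
    define k where "k n = Suc (nat \<lfloor>r * 2 ^ n\<rfloor>)" for n
    define b where "b n = real (k n) / 2 ^ n" for n
    have k: "r * 2 ^ n < real (k n)" "real (k n) \<le> r * 2 ^ n + 1" for n
      using r unfolding k_def by (auto simp: of_nat_nat) linarith+
    have b: "r < b n" "b n \<le> r + (1 / 2) ^ n" for n
      using k[of n] by (auto simp: b_def field_simps)
    have "(\<lambda>n. r + (1 / 2) ^ n) \<longlonglongrightarrow> r + 0"
      by (intro tendsto_intros) auto
    then have b_lim: "b \<longlonglongrightarrow> r"
      using b by (intro tendsto_sandwich[of "\<lambda>_. r" b _ "\<lambda>n. r + (1 / 2) ^ n"]) (auto intro!: always_eventually less_imp_le)
    have "filterlim b (at_right r) sequentially"
      using b_lim b(1) by (auto simp: filterlim_at intro!: always_eventually less_imp_neq[symmetric])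
    then have "(\<lambda>n. g (b n)) \<longlonglongrightarrow> g r"
      using alt_nonneg_right_continuous[OF g le1 r] by (rule filterlim_compose[rotated])
    moreover have "g (b n) = (\<integral>z. exp_neg (ennreal (b n) * z) \<partial>Q 0)" for n
      using Q_int[where k = "k n" and n = n] by (simp add: Q_eq[of n] b_def k_def)
    moreover have "(\<lambda>n. \<integral>z. exp_neg (ennreal (b n) * z) \<partial>Q 0) \<longlonglongrightarrow> (\<integral>z. exp_neg (ennreal r * z) \<partial>Q 0)"
      using tendsto_exp_neg_mult[OF b_lim r]
      by (intro integral_dominated_convergence[where w = "\<lambda>_. 1"]) auto
    ultimately show ?thesis
      by (auto intro: LIMSEQ_unique)
  qed
  then show ?thesis
    using Q by blast
qed

section \<open>Complete monotonicity\<close>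

text \<open>The sequence \<open>F\<close> supplies all derivatives at once. Since
  \<open>deriv\<close> is local, agreement on the open half-line passes from one order to the
  next.\<close>

lemma completely_monotone_posI:
  assumes eq: "\<And>r. 0 < r \<Longrightarrow> g r = F 0 r"
    and deriv: "\<And>n r. 0 < r \<Longrightarrow> (F n has_real_derivative F (Suc n) r) (at r)"
    and sign: "\<And>n r. 0 < r \<Longrightarrow> 0 \<le> (- 1) ^ n * F n r"
  shows "completely_monotone_pos g"
proof -
  have *: "(deriv ^^ n) g r = F n r" if "0 < r" for n r
    using that
  proof (induction n arbitrary: r)
    case (Suc n)
    have ev: "\<forall>\<^sub>F x in nhds r. (deriv ^^ n) g x = F n x"
      using eventually_nhds_in_open[of "{0<..}" r] Suc by (auto elim: eventually_mono)
    have "(deriv ^^ Suc n) g r = deriv (F n) r"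
      using deriv_cong_ev[OF ev refl] by simp
    also have "\<dots> = F (Suc n) r"
      using deriv[OF Suc.prems] by (rule DERIV_imp_deriv)
    finally show ?case .
  qed (simp add: eq)
  have "(deriv ^^ n) g field_differentiable at r" if "0 < r" for n r
  proof -
    have "\<forall>\<^sub>F x in nhds r. (deriv ^^ n) g x = F n x"
      using eventually_nhds_in_open[of "{0<..}" r] that * by (auto elim: eventually_mono)
    then have "((deriv ^^ n) g has_real_derivative F (Suc n) r) (at r)"
      using deriv[OF that] by (subst DERIV_cong_ev[OF refl _ refl])
    then show ?thesis
      by (auto simp: field_differentiable_def)
  qed
  then show ?thesis
    using sign * by (auto simp: completely_monotone_pos_def)
qed

lemma completely_monotone_posD:
  assumes "completely_monotone_pos g" "0 < r"
  shows "((deriv ^^ n) g has_real_derivative (deriv ^^ Suc n) g r) (at r)"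
    "0 \<le> (- 1) ^ n * (deriv ^^ n) g r"
  using assms unfolding completely_monotone_pos_def by (auto simp: DERIV_deriv_iff_field_differentiable)

text \<open>Each (-1)^n g^(n) is nonincreasing, because its derivative is the negative of the
  nonnegative function (-1)^(n+1) g^(n+1).\<close>

lemma completely_monotone_pos_diff:
  assumes g: "completely_monotone_pos g" and h: "0 < h"
  shows "completely_monotone_pos (\<lambda>x. g x - g (x + h))"
proof (rule completely_monotone_posI)
  let ?F = "\<lambda>n x. (deriv ^^ n) g x - (deriv ^^ n) g (x + h)"
  fix n and r :: real assume r: "0 < r"
  show "(?F n has_real_derivative ?F (Suc n) r) (at r)"
    using completely_monotone_posD(1)[OF g, of "r + h" n] r h
    by (intro DERIV_diff completely_monotone_posD(1)[OF g r]) (simp add: DERIV_shift)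
  have "(- 1) ^ n * (deriv ^^ n) g (r + h) \<le> (- 1) ^ n * (deriv ^^ n) g r"
  proof (rule DERIV_nonpos_imp_nonincreasing[where f = "\<lambda>x. (- 1) ^ n * (deriv ^^ n) g x"])
    fix x assume "r \<le> x"
    then have x: "0 < x"
      using r by simp
    show "\<exists>y. ((\<lambda>x. (- 1) ^ n * (deriv ^^ n) g x) has_real_derivative y) (at x) \<and> y \<le> 0"
      using DERIV_cmult[OF completely_monotone_posD(1)[OF g x], of "(- 1) ^ n" n]
        completely_monotone_posD(2)[OF g x, of "Suc n"]
      by (intro exI[of _ "(- 1) ^ n * (deriv ^^ Suc n) g x"]) simp
  qed (use h in simp)
  then show "0 \<le> (- 1) ^ n * ?F n r"
    by (simp add: right_diff_distrib)
qed simp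

lemma completely_monotone_pos_alt_nonneg:
  assumes "completely_monotone_pos g"
  shows "alt_nonneg g"
proof -
  have "0 \<le> alt_diff m (\<lambda>x. x + h) g x" if "0 < h" "0 < x" for m h x
    using assms that(2)
  proof (induction m arbitrary: g x)
    case 0
    then show ?case
      using completely_monotone_posD(2)[of g x 0] by simp
  next
    case (Suc m)
    have "0 \<le> alt_diff m (\<lambda>x. x + h) (\<lambda>x. g x - g (x + h)) x"
      using Suc.prems that by (intro Suc.IH completely_monotone_pos_diff)
    then show ?case
      by (subst (asm) alt_diff_Suc')
  qed
  then show ?thesis
    by (simp add: alt_nonneg_def)
qed

text \<open>The n-th derivative in r of exp (- r z). The value at \<open>z = \<top>\<close> is 0
  because there the exponential is constantly 0 for r > 0.\<close>

definition exp_neg_deriv :: "nat \<Rightarrow> real \<Rightarrow> ennreal \<Rightarrow> real" where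
  "exp_neg_deriv n r z = (if z = \<top> then 0 else (- enn2real z) ^ n * exp (- r * enn2real z))"

lemma measurable_exp_neg_deriv [measurable]: "exp_neg_deriv n r \<in> borel_measurable borel"
  unfolding exp_neg_deriv_def by measurable

lemma exp_neg_deriv_0: "0 < r \<Longrightarrow> exp_neg_deriv 0 r z = exp_neg (ennreal r * z)"
  by (cases z) (auto simp: exp_neg_deriv_def exp_neg_ennreal ennreal_mult_top simp flip: ennreal_mult)

lemma DERIV_exp_neg_deriv:
  "((\<lambda>r. exp_neg_deriv n r z) has_real_derivative exp_neg_deriv (Suc n) r z) (at r within S)"
  unfolding exp_neg_deriv_def by (auto intro!: derivative_eq_intros)

text \<open>A single term of the exponential series is at most the whole sum.\<close>

lemma power_le_fact_exp:
  assumes "0 \<le> (x :: real)"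
  shows "x ^ n \<le> fact n * exp x"
proof -
  have "x ^ n /\<^sub>R fact n \<le> (\<Sum>k. x ^ k /\<^sub>R fact k)"
    using sum_le_suminf[OF summable_exp_generic, of "{n}" x] assms by simp
  then show ?thesis
    by (simp add: exp_def field_simps)
qed

text \<open>From (r u)^n <= n! exp (r u) and s >= r. The bound is uniform in z and in s, so it
  serves as the dominating constant when differentiating under the integral.\<close>

lemma exp_neg_deriv_bound:
  assumes "0 < r" "r \<le> s"
  shows "\<bar>exp_neg_deriv n s z\<bar> \<le> fact n / r ^ n"
proof (cases "z = \<top>")
  case False
  define u where "u = enn2real z"
  have u: "0 \<le> u"
    by (simp add: u_def)
  have "(r * u) ^ n * exp (- s * u) \<le> (fact n * exp (r * u)) * exp (- s * u)"
    using u assms by (intro mult_right_mono power_le_fact_exp) auto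
  also have "\<dots> = fact n * exp ((r - s) * u)"
    by (simp add: exp_add[symmetric] left_diff_distrib)
  also have "\<dots> \<le> fact n * 1"
    using u assms by (intro mult_left_mono) (auto simp: mult_nonpos_nonneg)
  finally have "u ^ n * exp (- s * u) \<le> fact n / r ^ n"
    using assms by (simp add: power_mult_distrib field_simps)
  then show ?thesis
    using False u by (simp add: exp_neg_deriv_def abs_mult power_abs flip: u_def)
qed (use assms in \<open>simp add: exp_neg_deriv_def\<close>)

text \<open>Differentiation under the integral by dominated convergence. On \<open>{r / 2..}\<close>
  the next derivative of the integrand is bounded uniformly in z, so the mean value inequality
  bounds all difference quotients by one constant.\<close>

lemma completely_monotone_pos_laplace:
  assumes q: "q \<in> space (prob_algebra borel)" and C: "0 \<le> C"
  shows "completely_monotone_pos (\<lambda>r. C * (\<integral>z. exp_neg (ennreal r * z) \<partial>q))"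
proof (rule completely_monotone_posI)
  interpret prob_space q
    by (rule prob_algebraD[OF q])
  note [measurable_cong] = prob_algebraD(2)[OF q]
  let ?I = "\<lambda>n r. \<integral>z. exp_neg_deriv n r z \<partial>q"
  show "C * (\<integral>z. exp_neg (ennreal r * z) \<partial>q) = C * ?I 0 r" if "0 < r" for r
    using that by (simp add: exp_neg_deriv_0)
  fix n and r :: real assume r: "0 < r"
  show "0 \<le> (- 1) ^ n * (C * ?I n r)"
  proof -
    have "(- 1) ^ n * (C * ?I n r) = C * (\<integral>z. (- 1) ^ n * exp_neg_deriv n r z \<partial>q)"
      by simp
    also have "\<dots> \<ge> 0"
    proof (intro mult_nonneg_nonneg[OF C] Bochner_Integration.integral_nonneg)
      show "0 \<le> (- 1) ^ n * exp_neg_deriv n r z" for z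
        by (auto simp: exp_neg_deriv_def power_mult_distrib[symmetric] mult.assoc[symmetric])
    qed
    finally show ?thesis .
  qed
  have integrable: "integrable q (exp_neg_deriv m s)" if "0 < s" for m s
    using exp_neg_deriv_bound[OF that order_refl]
    by (intro integrable_const_bound[of _ "fact m / s ^ m"]) auto
  have "(?I n has_real_derivative ?I (Suc n) r) (at r)"
    unfolding has_field_derivative_iff tendsto_at_iff_sequentially
  proof (intro allI impI)
    fix X :: "nat \<Rightarrow> real" assume X: "\<forall>i. X i \<in> UNIV - {r}" and lim: "X \<longlonglongrightarrow> r"
    have "\<forall>\<^sub>F i in sequentially. r / 2 < X i"
      using lim r by (intro order_tendstoD) auto
    then obtain N where N: "\<And>i. N \<le> i \<Longrightarrow> r / 2 < X i"
      by (auto simp: eventually_sequentially)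
    \<comment> \<open>Dropping the first N terms keeps the whole sequence in the region where the
      uniform bound holds.\<close>
    define Y where "Y i = X (i + N)" for i
    have Y: "r / 2 < Y i" "Y i \<noteq> r" for i
      using X N by (auto simp: Y_def)
    have Y_lim: "Y \<longlonglongrightarrow> r"
      unfolding Y_def using lim by (rule LIMSEQ_ignore_initial_segment)
    have "(\<lambda>i. \<integral>z. (exp_neg_deriv n (Y i) z - exp_neg_deriv n r z) / (Y i - r) \<partial>q)
        \<longlonglongrightarrow> ?I (Suc n) r"
    proof (rule integral_dominated_convergence)
      let ?B = "fact (Suc n) / (r / 2) ^ Suc n :: real"
      show "integrable q (\<lambda>_. ?B)"
        by simp
      show "AE z in q. (\<lambda>i. (exp_neg_deriv n (Y i) z - exp_neg_deriv n r z) / (Y i - r))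
          \<longlonglongrightarrow> exp_neg_deriv (Suc n) r z"
      proof (rule AE_I2)
        fix z
        have "(\<lambda>y. (exp_neg_deriv n y z - exp_neg_deriv n r z) / (y - r)) \<midarrow>r\<rightarrow> exp_neg_deriv (Suc n) r z"
          using DERIV_exp_neg_deriv[of n z r UNIV] by (simp add: has_field_derivative_iff)
        from filterlim_compose[OF this, of Y sequentially]
        show "(\<lambda>i. (exp_neg_deriv n (Y i) z - exp_neg_deriv n r z) / (Y i - r))
          \<longlonglongrightarrow> exp_neg_deriv (Suc n) r z"
          using Y_lim Y by (simp add: filterlim_at)
      qed
      show "AE z in q. norm ((exp_neg_deriv n (Y i) z - exp_neg_deriv n r z) / (Y i - r)) \<le> ?B" for i
      proof (rule AE_I2)
        fix z
        have "norm (exp_neg_deriv n (Y i) z - exp_neg_deriv n r z) \<le> ?B * norm (Y i - r)"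
        proof (rule field_differentiable_bound[OF _ DERIV_exp_neg_deriv])
          show "convex {r / 2..}"
            by (rule convex_real_interval)
          show "norm (exp_neg_deriv (Suc n) s z) \<le> ?B" if "s \<in> {r / 2..}" for s
            using exp_neg_deriv_bound[of "r / 2" s "Suc n" z] that r by simp
        qed (use Y[of i] r in auto)
        then show "norm ((exp_neg_deriv n (Y i) z - exp_neg_deriv n r z) / (Y i - r)) \<le> ?B"
          using Y[of i] by (simp add: norm_divide divide_le_eq)
      qed
    qed auto
    moreover have "(\<integral>z. (exp_neg_deriv n (Y i) z - exp_neg_deriv n r z) / (Y i - r) \<partial>q) =
        (?I n (Y i) - ?I n r) / (Y i - r)" for i
      using integrable[of "Y i" n] integrable[OF r, of n] Y(1)[of i] r
      by (simp add: Bochner_Integration.integral_diff)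
    ultimately have "(\<lambda>i. (?I n (Y i) - ?I n r) / (Y i - r)) \<longlonglongrightarrow> ?I (Suc n) r"
      by (simp only:)
    then show "((\<lambda>y. (?I n y - ?I n r) / (y - r)) \<circ> X) \<longlonglongrightarrow> ?I (Suc n) r"
      unfolding Y_def comp_def by (rule LIMSEQ_offset)
  qed
  then show "((\<lambda>r. C * ?I n r) has_real_derivative C * ?I (Suc n) r) (at r)"
    by (rule DERIV_cmult)
qed

lemma alt_nonneg_cmult: "alt_nonneg g \<Longrightarrow> 0 \<le> c \<Longrightarrow> alt_nonneg (\<lambda>x. c * g x)"
  by (simp add: alt_nonneg_def alt_diff_cmult)

text \<open>Smoothness is recovered from Bernstein's theorem: up to a factor, the restriction to the
  open half-line is a Laplace transform. From here on the class is handled through differences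
  alone.\<close>

lemma cm_ennreal_iff:
  "f \<in> cm_ennreal \<longleftrightarrow> antimono f \<and> (\<forall>x. 0 \<le> f x) \<and> alt_nonneg (\<lambda>r. f (ennreal r))"
proof
  assume "f \<in> cm_ennreal"
  then show "antimono f \<and> (\<forall>x. 0 \<le> f x) \<and> alt_nonneg (\<lambda>r. f (ennreal r))"
    by (auto simp: cm_ennreal_def intro: completely_monotone_pos_alt_nonneg)
next
  assume *: "antimono f \<and> (\<forall>x. 0 \<le> f x) \<and> alt_nonneg (\<lambda>r. f (ennreal r))"
  \<comment> \<open>The summand 1 keeps the scaling factor positive when f vanishes
    identically.\<close>
  define C where "C = f 0 + 1"
  have C: "0 < C" "f x \<le> C" for x
    using * antimonoD[of f 0 x] by (auto simp: C_def add_nonneg_pos intro: order_trans[of _ "f 0"])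
  obtain q where q: "q \<in> space (prob_algebra borel)"
    and eq: "\<And>r. 0 < r \<Longrightarrow> 1 / C * f (ennreal r) = (\<integral>z. exp_neg (ennreal r * z) \<partial>q)"
    using Bernstein[OF alt_nonneg_cmult[of "\<lambda>r. f (ennreal r)" "1 / C"]] * C by auto
  have "completely_monotone_pos (\<lambda>r. f (ennreal r))"
  proof -
    have cm: "completely_monotone_pos (\<lambda>r. C * (\<integral>z. exp_neg (ennreal r * z) \<partial>q))"
      using completely_monotone_pos_laplace[OF q] C by simp
    show ?thesis
    proof (rule completely_monotone_posI)
      show "f (ennreal r) = (deriv ^^ 0) (\<lambda>r. C * (\<integral>z. exp_neg (ennreal r * z) \<partial>q)) r" if "0 < r" for r
        using eq[OF that] C(1) by (simp add: field_simps)
    qed (use completely_monotone_posD[OF cm] in auto)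
  qed
  then show "f \<in> cm_ennreal"
    using * by (simp add: cm_ennreal_def)
qed

lemma cm_ennrealD:
  assumes "f \<in> cm_ennreal"
  shows "antimono f" "0 \<le> f x" "alt_nonneg (\<lambda>r. f (ennreal r))" "f x \<le> f 0" "f \<infinity> \<le> f x"
  using assms by (auto simp: cm_ennreal_iff intro: antimonoD)

lemma cm_ennreal_const: "0 \<le> c \<Longrightarrow> (\<lambda>_. c) \<in> cm_ennreal"
  by (simp add: cm_ennreal_iff alt_nonneg_def alt_diff_const antimono_def)

lemma cm_ennreal_cmult: "f \<in> cm_ennreal \<Longrightarrow> 0 \<le> c \<Longrightarrow> (\<lambda>x. c * f x) \<in> cm_ennreal"
  by (auto simp: cm_ennreal_iff alt_nonneg_cmult antimono_def intro: mult_left_mono)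

lemma cm_ennreal_add:
  assumes "f \<in> cm_ennreal" "g \<in> cm_ennreal"
  shows "(\<lambda>x. f x + g x) \<in> cm_ennreal"
  using assms by (auto simp: cm_ennreal_iff alt_nonneg_def alt_diff_add antimono_def intro: add_mono)

lemma cm_ennreal_lim:
  assumes f: "\<And>i :: nat. f i \<in> cm_ennreal" and lim: "\<And>x. (\<lambda>i. f i x) \<longlonglongrightarrow> g x"
  shows "g \<in> cm_ennreal"
  unfolding cm_ennreal_iff
proof (intro conjI allI antimonoI)
  show "g y \<le> g x" if "x \<le> y" for x y
    using antimonoD[OF cm_ennrealD(1)[OF f] that] by (intro LIMSEQ_le[OF lim lim]) auto
  show "0 \<le> g x" for x
    using cm_ennrealD(2)[OF f] by (intro LIMSEQ_le_const[OF lim]) auto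
  show "alt_nonneg (\<lambda>r. g (ennreal r))"
    unfolding alt_nonneg_def
  proof (intro allI impI)
    fix m and h x :: real assume "0 < h" "0 < x"
    then show "0 \<le> alt_diff m (\<lambda>x. x + h) (\<lambda>r. g (ennreal r)) x"
      using alt_nonnegD[OF cm_ennrealD(3)[OF f]]
      by (intro LIMSEQ_le_const[OF tendsto_alt_diff[where g = "\<lambda>i r. f i (ennreal r)", OF lim]]) auto
  qed
qed

lemma cm_ennreal_integral:
  assumes f: "\<And>z. (\<lambda>x. f x z) \<in> cm_ennreal" and int: "\<And>x. integrable q (f x)"
  shows "(\<lambda>x. \<integral>z. f x z \<partial>q) \<in> cm_ennreal"
  unfolding cm_ennreal_iff
proof (intro conjI allI antimonoI)
  show "(\<integral>z. f y z \<partial>q) \<le> (\<integral>z. f x z \<partial>q)" if "x \<le> y" for x y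
    using antimonoD[OF cm_ennrealD(1)[OF f] that] by (intro integral_mono int) auto
  show "0 \<le> (\<integral>z. f x z \<partial>q)" for x
    using cm_ennrealD(2)[OF f] by (intro Bochner_Integration.integral_nonneg) auto
  show "alt_nonneg (\<lambda>r. \<integral>z. f (ennreal r) z \<partial>q)"
    unfolding alt_nonneg_def
  proof (intro allI impI)
    fix m and h x :: real assume *: "0 < h" "0 < x"
    have "alt_diff m (\<lambda>x. x + h) (\<lambda>r. \<integral>z. f (ennreal r) z \<partial>q) x =
        (\<integral>z. alt_diff m (\<lambda>x. x + h) (\<lambda>r. f (ennreal r) z) x \<partial>q)"
      using alt_diff_integral[of q "\<lambda>r z. f (ennreal r) z"] int by blast
    also have "\<dots> \<ge> 0"
      using alt_nonnegD[OF cm_ennrealD(3)[OF f]] * by (intro Bochner_Integration.integral_nonneg) auto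
    finally show "0 \<le> alt_diff m (\<lambda>x. x + h) (\<lambda>r. \<integral>z. f (ennreal r) z \<partial>q) x" .
  qed
qed

text \<open>The substitution \<open>u = exp_neg z\<close> reverses the order and turns f into a
  monotone function of a real variable; the clamp extends it to all reals.\<close>

lemma antimono_borel_measurable_ennreal:
  fixes f :: "ennreal \<Rightarrow> real"
  assumes "antimono f"
  shows "f \<in> borel_measurable borel"
proof -
  have "mono (\<lambda>u. f (neg_ln (max 0 (min 1 u))))"
  proof (rule monoI)
    fix u v :: real assume "u \<le> v"
    then have "max 0 (min 1 u) \<le> max 0 (min 1 v)"
      by auto
    then have "exp_neg (neg_ln (max 0 (min 1 u))) \<le> exp_neg (neg_ln (max 0 (min 1 v)))"
      by (simp add: exp_neg_neg_ln)
    then show "f (neg_ln (max 0 (min 1 u))) \<le> f (neg_ln (max 0 (min 1 v)))"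
      using antimonoD[OF assms] by simp
  qed
  then have "(\<lambda>u. f (neg_ln (max 0 (min 1 u)))) \<in> borel_measurable borel"
    by (rule borel_measurable_mono)
  then have "(\<lambda>z. f (neg_ln (max 0 (min 1 (exp_neg z))))) \<in> borel_measurable borel"
    by (rule measurable_compose[rotated]) simp
  then show ?thesis
    by (simp add: min_absorb2 max_absorb2)
qed

lemma cm_ennreal_measurable: "f \<in> cm_ennreal \<Longrightarrow> f \<in> borel_measurable borel"
  by (intro antimono_borel_measurable_ennreal cm_ennrealD)

section \<open>The Laplace kernel\<close>

lemma laplace_kernel_eq:
  "laplace_kernel c1 c2 x y =
    (if x = 0 \<and> y = \<top> then of_bool (c1 = Zero_InftyMinus)
     else if x = \<top> \<and> y = 0 then of_bool (c2 = InftyMinus_Zero)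
     else exp_neg (x * y))"
  by (cases c1; cases c2) (auto simp: laplace_kernel_def conv_times_def)

lemma laplace_kernel_pos: "0 < r \<Longrightarrow> laplace_kernel c1 c2 x (ennreal r) = exp_neg (x * ennreal r)"
  by (simp add: laplace_kernel_eq)

lemma laplace_kernel_pos': "0 < r \<Longrightarrow> laplace_kernel c1 c2 (ennreal r) y = exp_neg (ennreal r * y)"
  by (simp add: laplace_kernel_eq)

lemma laplace_kernel_simps [simp]:
  "laplace_kernel c1 c2 0 y = (if y = \<top> then of_bool (c1 = Zero_InftyMinus) else 1)"
  "laplace_kernel c1 c2 \<top> y = (if y = 0 then of_bool (c2 = InftyMinus_Zero) else 0)"
  "laplace_kernel c1 c2 x 0 = (if x = \<top> then of_bool (c2 = InftyMinus_Zero) else 1)"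
  "laplace_kernel c1 c2 x \<top> = (if x = 0 then of_bool (c1 = Zero_InftyMinus) else 0)"
  by (auto simp: laplace_kernel_eq ennreal_mult_top ennreal_top_mult)

lemma laplace_kernel_bounds [simp]: "0 \<le> laplace_kernel c1 c2 x y" "laplace_kernel c1 c2 x y \<le> 1"
  by (auto simp: laplace_kernel_def)

lemma measurable_laplace_kernel [measurable (raw)]:
  assumes [measurable]: "f \<in> borel_measurable M" "g \<in> borel_measurable M"
  shows "(\<lambda>x. laplace_kernel c1 c2 (f x) (g x)) \<in> borel_measurable M"
  unfolding laplace_kernel_eq by measurable

lemma laplace_kernel_integrable [simp]:
  assumes "q \<in> space (prob_algebra borel)"
  shows "integrable q (\<lambda>x. laplace_kernel c1 c2 x y)" "integrable q (laplace_kernel c1 c2 x)"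
  by (rule prob_algebra_integrable_bounded[OF assms, of _ 1]; simp)+

text \<open>On the open half-line the kernel g is multiplicative in x, so its m-th difference with
  step h is g x (1 - g h)^m. Each choice of convention keeps the kernel nonincreasing up to the
  endpoints.\<close>

lemma laplace_kernel_cm: "(\<lambda>x. laplace_kernel c1 c2 x y) \<in> cm_ennreal"
  unfolding cm_ennreal_iff
proof (intro conjI allI antimonoI)
  fix x x' :: ennreal assume "x \<le> x'"
  then have "exp_neg (x' * y) \<le> exp_neg (x * y)"
    by (simp add: mult_right_mono)
  then show "laplace_kernel c1 c2 x' y \<le> laplace_kernel c1 c2 x y"
    using \<open>x \<le> x'\<close> by (cases "x = 0"; cases "x' = \<top>"; cases "y = 0"; cases "y = \<top>")
      (auto simp: laplace_kernel_eq ennreal_mult_top top_unique)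
next
  let ?g = "\<lambda>r. laplace_kernel c1 c2 (ennreal r) y"
  have "alt_diff m (\<lambda>x. x + h) ?g x = ?g x * (1 - ?g h) ^ m" if "0 < h" "0 < x" for m h x
    using that(2)
  proof (induction m arbitrary: x)
    case (Suc m)
    have "?g (x + h) = exp_neg (ennreal (x + h) * y)"
      using Suc.prems \<open>0 < h\<close> by (intro laplace_kernel_pos') auto
    also have "\<dots> = exp_neg (ennreal x * y + ennreal h * y)"
      using Suc.prems \<open>0 < h\<close> by (simp add: distrib_right)
    also have "\<dots> = ?g x * ?g h"
      using Suc.prems \<open>0 < h\<close> by (simp add: exp_neg_add laplace_kernel_pos')
    finally have "?g (x + h) = ?g x * ?g h" .
    then show ?case
      using Suc \<open>0 < h\<close> by (simp add: algebra_simps)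
  qed simp
  then show "alt_nonneg ?g"
    by (simp add: alt_nonneg_def)
qed simp

text \<open>With these two conventions the kernel is constantly 1 at x = 0 and constantly 0 at x =
  \<infinity>, so \<open>b = f \<infinity>\<close> and \<open>C = f 0 - f \<infinity>\<close> make
  the formula exact at both ends. A jump of f at 0 is an atom of \<open>q\<close> at \<infinity>, a
  jump at \<infinity> is an atom at 0.\<close>

lemma cm_ennreal_representation:
  assumes f: "f \<in> cm_ennreal"
  shows "\<exists>q\<in>space (prob_algebra borel). \<exists>b\<ge>0. \<exists>C\<ge>0. \<forall>x.
    f x = b + C * (\<integral>z. laplace_kernel Zero_InftyMinus Infty_ZeroPlus x z \<partial>q)"
proof (cases "f 0 = f \<infinity>")
  case True
  then have "f x = f \<infinity>" for x
    using cm_ennrealD(4,5)[OF f, of x] by simp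
  then show ?thesis
    using cm_ennrealD(2)[OF f]
    by (intro bexI[of _ "return borel 0"] exI[of _ "f \<infinity>"] conjI exI[of _ 0])
      (auto simp: space_prob_algebra prob_space_return)
next
  case False
  define b where "b = f \<infinity>"
  define C where "C = f 0 - f \<infinity>"
  have C: "0 < C" and b: "0 \<le> b"
    using False cm_ennrealD(4)[OF f, of \<infinity>] cm_ennrealD(2)[OF f] by (auto simp: C_def b_def)
  define g where "g r = 1 / C * (f (ennreal r) + - b)" for r
  have "alt_nonneg g"
    unfolding alt_nonneg_def
  proof (intro allI impI)
    fix m and h x :: real assume *: "0 < h" "0 < x"
    have "alt_diff m (\<lambda>x. x + h) g x =
        1 / C * (alt_diff m (\<lambda>x. x + h) (\<lambda>r. f (ennreal r)) x + (if m = 0 then - b else 0))"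
      unfolding g_def alt_diff_cmult alt_diff_add alt_diff_const ..
    also have "\<dots> \<ge> 0"
      using alt_nonnegD[OF cm_ennrealD(3)[OF f] *, of m] C cm_ennrealD(5)[OF f, of "ennreal x"]
      by (auto simp: b_def)
    finally show "0 \<le> alt_diff m (\<lambda>x. x + h) g x" .
  qed
  moreover have "g r \<le> 1" for r
    using C cm_ennrealD(4)[OF f, of "ennreal r"] by (simp add: g_def b_def C_def divide_le_eq)
  ultimately obtain q where q: "q \<in> space (prob_algebra borel)"
    and eq: "\<And>r. 0 < r \<Longrightarrow> g r = (\<integral>z. exp_neg (ennreal r * z) \<partial>q)"
    using Bernstein[of g] by auto
  interpret prob_space q
    by (rule prob_algebraD[OF q])
  have "f x = b + C * (\<integral>z. laplace_kernel Zero_InftyMinus Infty_ZeroPlus x z \<partial>q)" for x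
  proof -
    consider "x = 0" | r where "0 < r" "x = ennreal r" | "x = \<top>"
      by (cases x) (auto simp: order_le_less)
    then show ?thesis
    proof cases
      case 1
      then show ?thesis
        by (simp add: b_def C_def prob_space)
    next
      case 2
      then show ?thesis
        using eq[of r] C by (simp add: laplace_kernel_pos' g_def field_simps)
    next
      case 3
      then show ?thesis
        by (simp add: b_def)
    qed
  qed
  then show ?thesis
    using q b C by (meson less_imp_le)
qed

text \<open>By the representation of f and Fubini it suffices to treat the kernels themselves as
  functions of w. For 0 < z < \<infinity> this is the hypothesis; at z = 0 and z = \<infinity> the
  kernel is the indicator of \<open>w < \<top>\<close> and of \<open>w = 0\<close>, a bounded limit
  of exponentials with parameters 1 / n and n.\<close>

lemma laplace_mixture_cm:
  assumes p: "p \<in> borel \<rightarrow>\<^sub>M prob_algebra borel"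
    and cm: "\<And>r. 0 < r \<Longrightarrow> (\<lambda>x. \<integral>w. exp_neg (w * ennreal r) \<partial>p x) \<in> cm_ennreal"
    and f: "f \<in> cm_ennreal"
  shows "(\<lambda>x. integral\<^sup>L (p x) f) \<in> cm_ennreal"
proof -
  let ?k = "laplace_kernel Zero_InftyMinus Infty_ZeroPlus"
  have p_prob: "p x \<in> space (prob_algebra borel)" for x
    using measurable_space[OF p] by simp
  have lim: "(\<lambda>x. \<integral>w. ?k w z \<partial>p x) \<in> cm_ennreal"
    if r: "\<And>n. 0 < r n" and lim: "\<And>w. (\<lambda>n. exp_neg (w * ennreal (r n))) \<longlonglongrightarrow> ?k w z"
    for z and r :: "nat \<Rightarrow> real"
  proof (rule cm_ennreal_lim[OF cm[OF r]])
    fix x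
    interpret prob_space "p x"
      by (rule prob_algebraD[OF p_prob])
    show "(\<lambda>n. \<integral>w. exp_neg (w * ennreal (r n)) \<partial>p x) \<longlonglongrightarrow> (\<integral>w. ?k w z \<partial>p x)"
      using lim prob_algebraD[OF p_prob[of x]]
      by (intro integral_dominated_convergence[where w = "\<lambda>_. 1"]) auto
  qed
  have k: "(\<lambda>x. \<integral>w. ?k w z \<partial>p x) \<in> cm_ennreal" for z
  proof -
    consider "z = 0" | r where "0 < r" "z = ennreal r" | "z = \<top>"
      by (cases z) (auto simp: order_le_less)
    then show ?thesis
    proof cases
      case 1
      show ?thesis
      proof (rule lim)
        fix w
        show "(\<lambda>n. exp_neg (w * ennreal (1 / real (Suc n)))) \<longlonglongrightarrow> ?k w z"
        proof (cases "w = \<top>")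
          case True
          have "w * ennreal (1 / real (Suc n)) = \<top>" for n
            using True by (simp add: ennreal_top_mult)
          then show ?thesis
            using True 1 by simp
        next
          case False
          have "(\<lambda>n. w * ennreal (1 / real (Suc n))) \<longlonglongrightarrow> w * ennreal 0"
            using False lim_inverse_n'[THEN LIMSEQ_Suc]
            by (intro ennreal_tendsto_cmult tendsto_ennrealI) (auto simp: less_top)
          from tendsto_exp_neg[OF this] show ?thesis
            using False 1 by simp
        qed
      qed simp
    next
      case 2
      then show ?thesis
        using cm[of r] by (simp add: laplace_kernel_pos)
    next
      case 3
      show ?thesis
      proof (rule lim)
        fix w
        show "(\<lambda>n. exp_neg (w * ennreal (real (Suc n)))) \<longlonglongrightarrow> ?k w z"
        proof (cases "w = 0")
          case False
          then have "exp_neg w < exp_neg 0"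
            by (simp add: zero_less_iff_neq_zero del: exp_neg_0)
          then have "(\<lambda>n. exp_neg w ^ n) \<longlonglongrightarrow> 0"
            by (intro LIMSEQ_power_zero) simp
          then have "(\<lambda>n. exp_neg w ^ Suc n) \<longlonglongrightarrow> 0"
            by (rule LIMSEQ_Suc)
          then show ?thesis
            using False 3 unfolding exp_neg_power
            by (simp add: ennreal_of_nat_eq_real_of_nat mult.commute del: of_nat_Suc)
        qed (use 3 in simp)
      qed simp
    qed
  qed
  obtain q b C where q: "q \<in> space (prob_algebra borel)" and bC: "0 \<le> b" "0 \<le> C"
    and f_eq: "\<And>x. f x = b + C * (\<integral>z. ?k x z \<partial>q)"
    using cm_ennreal_representation[OF f] by blast
  have "integral\<^sup>L (p x) f = b + C * (\<integral>z. \<integral>w. ?k w z \<partial>p x \<partial>q)" for x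
  proof -
    interpret p: prob_space "p x"
      by (rule prob_algebraD[OF p_prob])
    interpret q: prob_space q
      by (rule prob_algebraD[OF q])
    interpret pq: pair_prob_space "p x" q ..
    note [measurable_cong] = prob_algebraD(2)[OF p_prob[of x]] prob_algebraD(2)[OF q]
    have int: "integrable (p x) (\<lambda>w. \<integral>z. ?k w z \<partial>q)"
      using q by (intro p.integrable_const_bound[of _ 1] AE_I2) (auto intro!: q.integral_le_const)
    have "integrable (p x \<Otimes>\<^sub>M q) (\<lambda>(w, z). ?k w z)"
      by (intro pq.integrable_const_bound[of _ 1] AE_I2) auto
    then have "(\<integral>w. \<integral>z. ?k w z \<partial>q \<partial>p x) = (\<integral>z. \<integral>w. ?k w z \<partial>p x \<partial>q)"
      using pq.Fubini_integral[of ?k] by (simp add: split_beta')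
    moreover have "integral\<^sup>L (p x) f = (\<integral>w. b + C * (\<integral>z. ?k w z \<partial>q) \<partial>p x)"
      by (intro Bochner_Integration.integral_cong refl f_eq)
    ultimately show ?thesis
      using int by (simp add: p.prob_space)
  qed
  moreover have "(\<lambda>x. b + C * (\<integral>z. \<integral>w. ?k w z \<partial>p x \<partial>q)) \<in> cm_ennreal"
  proof (intro cm_ennreal_add cm_ennreal_cmult cm_ennreal_const cm_ennreal_integral bC k)
    fix x
    note [measurable_cong] = prob_algebraD(2)[OF p_prob[of x]]
    interpret p: prob_space "p x"
      by (rule prob_algebraD[OF p_prob])
    show "integrable q (\<lambda>z. \<integral>w. ?k w z \<partial>p x)"
      using p_prob[of x] by (intro prob_algebra_integrable_bounded[OF q, of _ 1])
        (auto intro!: p.integral_le_const)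
  qed
  ultimately show ?thesis
    by simp
qed

section \<open>Dual probability kernels\<close>

definition dual_kernels ::
    "zero_infty_convention \<Rightarrow> infty_zero_convention \<Rightarrow>
     (ennreal \<Rightarrow> ennreal measure) \<Rightarrow> (ennreal \<Rightarrow> ennreal measure) \<Rightarrow> bool" where
  "dual_kernels c1 c2 p q \<longleftrightarrow>
    (\<forall>x y. (\<integral>w. laplace_kernel c1 c2 w y \<partial>p x) = (\<integral>z. laplace_kernel c1 c2 x z \<partial>q y))"

text \<open>The weights
  \<open>laplace_kernel c1 c2 w 0\<close> and \<open>1 - laplace_kernel c1 c2 w \<top>\<close> are the indicators of
  \<open>w < \<top>\<close> and \<open>0 < w\<close>, or constantly \<open>1\<close>, according to the convention at the other end.\<close>

definition boundary_0 ::
    "zero_infty_convention \<Rightarrow> infty_zero_convention \<Rightarrow> (ennreal \<Rightarrow> ennreal measure) \<Rightarrow> bool" where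
  "boundary_0 c1 c2 p \<longleftrightarrow> (case c1 of
     Zero_InftyMinus \<Rightarrow> p 0 = return borel 0
   | ZeroPlus_Infty \<Rightarrow> (\<forall>f. continuous_on UNIV f \<longrightarrow>
       ((\<lambda>x. \<integral>w. laplace_kernel c1 c2 w 0 * f w \<partial>p x) \<longlongrightarrow>
         (\<integral>w. laplace_kernel c1 c2 w 0 * f w \<partial>p 0)) (at_right 0)))"

definition boundary_infty ::
    "zero_infty_convention \<Rightarrow> infty_zero_convention \<Rightarrow> (ennreal \<Rightarrow> ennreal measure) \<Rightarrow> bool" where
  "boundary_infty c1 c2 p \<longleftrightarrow> (case c2 of
     Infty_ZeroPlus \<Rightarrow> p \<infinity> = return borel \<infinity>
   | InftyMinus_Zero \<Rightarrow> (\<forall>f. continuous_on UNIV f \<longrightarrow>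
       ((\<lambda>x. \<integral>w. (1 - laplace_kernel c1 c2 w \<infinity>) * f w \<partial>p x) \<longlongrightarrow>
         (\<integral>w. (1 - laplace_kernel c1 c2 w \<infinity>) * f w \<partial>p \<infinity>)) (at_left \<infinity>)))"

lemma continuous_on_ennreal_bounded:
  fixes f :: "ennreal \<Rightarrow> real"
  assumes "continuous_on UNIV f"
  obtains C where "\<And>z. \<bar>f z\<bar> \<le> C"
proof -
  have "bounded (range f)"
    using compact_continuous_image[OF assms compact_UNIV] by (rule compact_imp_bounded)
  then show ?thesis
    using that by (auto simp: bounded_real)
qed

text \<open>The weight \<open>v\<close> may be discontinuous, for instance the indicator of
  finiteness. Hence f alone is approximated uniformly by a polynomial in \<open>exp_neg\<close>, and
  the bound on \<open>v\<close> carries the error through the integrals.\<close>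

lemma weighted_weak_convergence:
  fixes v f :: "ennreal \<Rightarrow> real"
  assumes p: "\<And>x. p x \<in> space (prob_algebra borel)"
    and v: "v \<in> borel_measurable borel" and v1: "\<And>w. \<bar>v w\<bar> \<le> 1"
    and lim: "\<And>n. ((\<lambda>x. \<integral>w. v w * exp_neg w ^ n \<partial>p x) \<longlongrightarrow> (\<integral>w. v w * exp_neg w ^ n \<partial>p a)) F"
    and f: "continuous_on UNIV f"
  shows "((\<lambda>x. \<integral>w. v w * f w \<partial>p x) \<longlongrightarrow> (\<integral>w. v w * f w \<partial>p a)) F"
proof -
  note [measurable] = v borel_measurable_continuous_onI[OF f]
  have [measurable]: "(\<lambda>w. poly s (exp_neg w)) \<in> borel_measurable borel" for s
    by (intro borel_measurable_continuous_onI continuous_intros continuous_exp_neg)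
  have int: "integrable (p x) (\<lambda>w. v w * g w)"
    if [measurable]: "g \<in> borel_measurable borel" and g: "\<And>w. \<bar>g w\<bar> \<le> C" for g C x
  proof (rule prob_algebra_integrable_bounded[OF p])
    show "\<bar>v w * g w\<bar> \<le> 1 * C" for w
      unfolding abs_mult using v1 g by (intro mult_mono) auto
  qed measurable
  have int_pow: "integrable (p x) (\<lambda>w. v w * exp_neg w ^ n)" for n x
    by (rule int[of _ 1]) (auto intro: power_le_one)
  have poly: "((\<lambda>x. \<integral>w. v w * poly s (exp_neg w) \<partial>p x) \<longlongrightarrow> (\<integral>w. v w * poly s (exp_neg w) \<partial>p a)) F" for s
  proof -
    have "(\<integral>w. v w * poly s (exp_neg w) \<partial>p x) =
        (\<Sum>i\<le>degree s. coeff s i * (\<integral>w. v w * exp_neg w ^ i \<partial>p x))" for x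
    proof -
      have "(\<integral>w. v w * poly s (exp_neg w) \<partial>p x) =
          (\<integral>w. (\<Sum>i\<le>degree s. coeff s i * (v w * exp_neg w ^ i)) \<partial>p x)"
        by (simp add: poly_altdef sum_distrib_left mult_ac)
      also have "\<dots> = (\<Sum>i\<le>degree s. \<integral>w. coeff s i * (v w * exp_neg w ^ i) \<partial>p x)"
        by (intro Bochner_Integration.integral_sum integrable_mult_right int_pow)
      finally show ?thesis
        by simp
    qed
    then show ?thesis
      by (auto intro!: tendsto_sum tendsto_mult_left lim)
  qed
  show ?thesis
  proof (rule tendstoI)
    fix e :: real assume e: "0 < e"
    obtain s where s: "\<And>z. \<bar>f z - poly s (exp_neg z)\<bar> < e / 3"
      using exp_neg_Stone_Weierstrass[OF f, of "e / 3"] e by auto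
    obtain C where C: "\<And>z. \<bar>f z\<bar> \<le> C"
      using continuous_on_ennreal_bounded[OF f] by blast
    have approx: "\<bar>(\<integral>w. v w * f w \<partial>p x) - (\<integral>w. v w * poly s (exp_neg w) \<partial>p x)\<bar> \<le> e / 3" for x
    proof -
      interpret prob_space "p x"
        by (rule prob_algebraD[OF p])
      have "\<bar>poly s (exp_neg z)\<bar> \<le> C + e / 3" for z
        using s[of z] C[of z] by linarith
      then have "(\<integral>w. v w * f w \<partial>p x) - (\<integral>w. v w * poly s (exp_neg w) \<partial>p x) =
          (\<integral>w. v w * f w - v w * poly s (exp_neg w) \<partial>p x)"
        using C by (intro Bochner_Integration.integral_diff[symmetric] int) auto
      also have "\<bar>\<dots>\<bar> \<le> (\<integral>w. \<bar>v w * f w - v w * poly s (exp_neg w)\<bar> \<partial>p x)"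
        by (rule integral_abs_bound)
      also have "\<dots> \<le> e / 3"
      proof (rule integral_le_const)
        have bnd: "\<bar>v w * f w - v w * poly s (exp_neg w)\<bar> \<le> e / 3" for w
        proof -
          have "\<bar>v w * f w - v w * poly s (exp_neg w)\<bar> = \<bar>v w\<bar> * \<bar>f w - poly s (exp_neg w)\<bar>"
            by (simp add: abs_mult[symmetric] right_diff_distrib)
          also have "\<dots> \<le> 1 * (e / 3)"
            using v1 s by (intro mult_mono) (auto intro: less_imp_le)
          finally show ?thesis
            by simp
        qed
        then show "AE w in p x. \<bar>v w * f w - v w * poly s (exp_neg w)\<bar> \<le> e / 3"
          by simp
        have "(\<lambda>w. \<bar>v w * f w - v w * poly s (exp_neg w)\<bar>) \<in> borel_measurable borel"
          by measurable
        then show "integrable (p x) (\<lambda>w. \<bar>v w * f w - v w * poly s (exp_neg w)\<bar>)"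
          using bnd by (intro prob_algebra_integrable_bounded[OF p, of _ "e / 3"]) auto
      qed
      finally show ?thesis .
    qed
    have "\<forall>\<^sub>F x in F. dist (\<integral>w. v w * poly s (exp_neg w) \<partial>p x) (\<integral>w. v w * poly s (exp_neg w) \<partial>p a) < e / 3"
      using poly e by (intro tendstoD) auto
    then show "\<forall>\<^sub>F x in F. dist (\<integral>w. v w * f w \<partial>p x) (\<integral>w. v w * f w \<partial>p a) < e"
    proof eventually_elim
      case (elim x)
      then show ?case
        using approx[of x] approx[of a] unfolding dist_real_def by linarith
    qed
  qed
qed

text \<open>Makes the weighted moments integrals of the kernel itself, to which duality applies.
  Only n = 0 sees the convention at \<infinity>, and there the weight absorbs it.\<close>

lemma laplace_kernel_of_nat:
  "laplace_kernel c1 c2 w (of_nat n) = laplace_kernel c1 c2 w 0 * exp_neg w ^ n"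
  by (cases "n = 0"; cases "w = \<top>")
    (auto simp: laplace_kernel_eq exp_neg_power ennreal_top_mult mult.commute)

text \<open>The counterpart at the other endpoint: subtracting the kernel at \<open>\<top>\<close>
  removes the atom at w = 0 exactly when the convention for 0 and \<infinity> counts it.\<close>

lemma laplace_kernel_of_nat':
  "laplace_kernel c1 InftyMinus_Zero w (of_nat n) - laplace_kernel c1 InftyMinus_Zero w \<top> =
    (1 - laplace_kernel c1 InftyMinus_Zero w \<top>) * exp_neg w ^ n"
  by (cases "n = 0"; cases "w = \<top>"; cases "w = 0")
    (auto simp: laplace_kernel_eq exp_neg_power ennreal_top_mult ennreal_mult_top mult.commute)

text \<open>Dominated convergence. Under this convention the kernel is continuous in x at 0 for
  every z; at \<open>z = \<top>\<close> it vanishes for all x, 0 included.\<close>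

lemma laplace_integral_tendsto_0:
  assumes q: "q \<in> space (prob_algebra borel)"
  shows "((\<lambda>x. \<integral>z. laplace_kernel ZeroPlus_Infty c2 x z \<partial>q) \<longlongrightarrow>
    (\<integral>z. laplace_kernel ZeroPlus_Infty c2 0 z \<partial>q)) (at_right 0)"
  unfolding tendsto_at_iff_sequentially comp_def
proof (intro allI impI)
  interpret prob_space q
    by (rule prob_algebraD[OF q])
  note [measurable_cong] = prob_algebraD(2)[OF q]
  fix X :: "nat \<Rightarrow> ennreal" assume X: "\<forall>i. X i \<in> {0<..} - {0}" and lim: "X \<longlonglongrightarrow> 0"
  have "(\<lambda>i. laplace_kernel ZeroPlus_Infty c2 (X i) z) \<longlonglongrightarrow> laplace_kernel ZeroPlus_Infty c2 0 z" for z
  proof (cases "z = \<top>")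
    case True
    have "X i \<noteq> 0" for i
      using X by blast
    then show ?thesis
      using True by simp
  next
    case False
    have "\<forall>\<^sub>F i in sequentially. X i < \<top>"
      using lim by (rule order_tendstoD) simp
    then have "\<forall>\<^sub>F i in sequentially. exp_neg (z * X i) = laplace_kernel ZeroPlus_Infty c2 (X i) z"
      by eventually_elim (use X False in \<open>auto simp: laplace_kernel_eq mult.commute\<close>)
    moreover have "(\<lambda>i. exp_neg (z * X i)) \<longlonglongrightarrow> exp_neg (z * 0)"
      using lim False by (intro tendsto_exp_neg ennreal_tendsto_cmult) (auto simp: less_top)
    ultimately show ?thesis
      using False by (simp add: tendsto_cong)
  qed
  then show "(\<lambda>i. \<integral>z. laplace_kernel ZeroPlus_Infty c2 (X i) z \<partial>q)
      \<longlonglongrightarrow> (\<integral>z. laplace_kernel ZeroPlus_Infty c2 0 z \<partial>q)"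
    by (intro integral_dominated_convergence[where w = "\<lambda>_. 1"]) (auto simp del: laplace_kernel_simps)
qed

text \<open>The mirror image: under this convention the kernel at z = 0 is 1 for all x, \<infinity>
  included, and for z > 0 the exponent tends to \<open>\<top>\<close>.\<close>

lemma laplace_integral_tendsto_infty:
  assumes q: "q \<in> space (prob_algebra borel)"
  shows "((\<lambda>x. \<integral>z. laplace_kernel c1 InftyMinus_Zero x z \<partial>q) \<longlongrightarrow>
    (\<integral>z. laplace_kernel c1 InftyMinus_Zero \<infinity> z \<partial>q)) (at_left \<infinity>)"
  unfolding tendsto_at_iff_sequentially comp_def
proof (intro allI impI)
  interpret prob_space q
    by (rule prob_algebraD[OF q])
  note [measurable_cong] = prob_algebraD(2)[OF q]
  fix X :: "nat \<Rightarrow> ennreal" assume X: "\<forall>i. X i \<in> {..<\<infinity>} - {\<infinity>}" and lim: "X \<longlonglongrightarrow> \<infinity>"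
  have "(\<lambda>i. laplace_kernel c1 InftyMinus_Zero (X i) z) \<longlonglongrightarrow> laplace_kernel c1 InftyMinus_Zero \<infinity> z" for z
  proof (cases "z = 0")
    case True
    then show ?thesis
      by simp
  next
    case False
    have "\<forall>\<^sub>F i in sequentially. 0 < X i"
      using lim by (rule order_tendstoD) simp
    then have ev: "\<forall>\<^sub>F i in sequentially. exp_neg (X i * z) = laplace_kernel c1 InftyMinus_Zero (X i) z"
      by eventually_elim (use X False in \<open>auto simp: laplace_kernel_eq\<close>)
    have "(\<lambda>i. X i * z) \<longlonglongrightarrow> \<top>"
    proof (cases "z = \<top>")
      case True
      have "\<forall>\<^sub>F i in sequentially. X i * z = \<top>"
        using \<open>\<forall>\<^sub>F i in sequentially. 0 < X i\<close> by eventually_elim (simp add: True ennreal_mult_top)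
      then show ?thesis
        by (rule tendsto_eventually)
    next
      case z: False
      have "(\<lambda>i. z * X i) \<longlonglongrightarrow> z * \<infinity>"
        using lim z by (intro ennreal_tendsto_cmult) (simp_all add: less_top)
      then show ?thesis
        using False by (simp add: ennreal_mult_top mult.commute)
    qed
    from tendsto_exp_neg[OF this] ev show ?thesis
      using False by (simp add: tendsto_cong)
  qed
  then show "(\<lambda>i. \<integral>z. laplace_kernel c1 InftyMinus_Zero (X i) z \<partial>q)
      \<longlonglongrightarrow> (\<integral>z. laplace_kernel c1 InftyMinus_Zero \<infinity> z \<partial>q)"
    by (intro integral_dominated_convergence[where w = "\<lambda>_. 1"]) (auto simp del: laplace_kernel_simps)
qed

lemma prob_algebra_eq_return:
  assumes q: "q \<in> space (prob_algebra borel)" and ae: "AE z in q. z = (a :: ennreal)"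
  shows "q = return borel a"
proof -
  interpret prob_space q
    by (rule prob_algebraD[OF q])
  note [measurable_cong] = prob_algebraD(2)[OF q]
  have "q = distr q borel (\<lambda>z. z)"
    using prob_algebraD[OF q] by (simp add: distr_id2)
  also have "\<dots> = distr q borel (\<lambda>_. a)"
    using ae by (intro distr_cong_AE) auto
  also have "\<dots> = return borel a"
    by (rule distr_const) simp
  finally show ?thesis .
qed

text \<open>The same product read with its factors exchanged, as happens when Y takes the place of
  X.\<close>

fun swap_zero_infty :: "zero_infty_convention \<Rightarrow> infty_zero_convention" where
  "swap_zero_infty ZeroPlus_Infty = Infty_ZeroPlus"
| "swap_zero_infty Zero_InftyMinus = InftyMinus_Zero"

fun swap_infty_zero :: "infty_zero_convention \<Rightarrow> zero_infty_convention" where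
  "swap_infty_zero Infty_ZeroPlus = ZeroPlus_Infty"
| "swap_infty_zero InftyMinus_Zero = Zero_InftyMinus"

lemma laplace_kernel_swap:
  "laplace_kernel (swap_infty_zero c2) (swap_zero_infty c1) y x = laplace_kernel c1 c2 x y"
  by (cases c1; cases c2) (auto simp: laplace_kernel_eq mult.commute)

lemma dual_kernels_swap:
  "dual_kernels c1 c2 p q \<Longrightarrow> dual_kernels (swap_infty_zero c2) (swap_zero_infty c1) q p"
  by (simp add: dual_kernels_def laplace_kernel_swap)

section \<open>Necessary conditions on a kernel that has a dual\<close>

context
  fixes p q :: "ennreal \<Rightarrow> ennreal measure" and c1 c2
  assumes p: "p \<in> borel \<rightarrow>\<^sub>M prob_algebra borel" and q: "q \<in> borel \<rightarrow>\<^sub>M prob_algebra borel"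
    and dual: "dual_kernels c1 c2 p q"
begin

lemma
  shows dual_p: "p x \<in> space (prob_algebra borel)"
    and dual_q: "q y \<in> space (prob_algebra borel)"
    and dual_eq: "(\<integral>w. laplace_kernel c1 c2 w y \<partial>p x) = (\<integral>z. laplace_kernel c1 c2 x z \<partial>q y)"
  using measurable_space[OF p] measurable_space[OF q] dual by (auto simp: dual_kernels_def)

lemma dual_kernels_cm:
  assumes "f \<in> cm_ennreal"
  shows "(\<lambda>x. integral\<^sup>L (p x) f) \<in> cm_ennreal"
  using p _ assms
proof (rule laplace_mixture_cm)
  fix r :: real assume "0 < r"
  then have "(\<integral>w. exp_neg (w * ennreal r) \<partial>p x) = (\<integral>z. laplace_kernel c1 c2 x z \<partial>q (ennreal r))" for x
    using dual_eq[where y = "ennreal r" and x = x] by (simp add: laplace_kernel_pos)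
  then show "(\<lambda>x. \<integral>w. exp_neg (w * ennreal r) \<partial>p x) \<in> cm_ennreal"
    using cm_ennreal_integral[of "\<lambda>x z. laplace_kernel c1 c2 x z" "q (ennreal r)"] dual_q
    by (simp add: laplace_kernel_cm)
qed

text \<open>If the kernel is constantly 1 at x = 0, duality at y = 1 gives \<open>exp_neg\<close>
  the integral 1 under \<open>p 0\<close>, which forces the point mass at 0. Otherwise duality turns
  the weighted moments into integrals that are continuous at 0, and
  \<open>weighted_weak_convergence\<close> concludes.\<close>

lemma dual_kernels_boundary_0: "boundary_0 c1 c2 p"
proof (cases c1)
  case Zero_InftyMinus
  have one: "0 < (1 :: real)"
    by simp
  interpret p0: prob_space "p 0"
    by (rule prob_algebraD[OF dual_p])
  interpret q1: prob_space "q 1"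
    by (rule prob_algebraD[OF dual_q])
  note [measurable_cong] = prob_algebraD(2)[OF dual_p[of 0]]
  have "(\<integral>w. exp_neg (w * ennreal 1) \<partial>p 0) = (\<integral>z. 1 \<partial>q (ennreal 1))"
    using dual_eq[where y = "ennreal 1" and x = 0] Zero_InftyMinus
    unfolding laplace_kernel_pos[OF one] by simp
  then have "(\<integral>w. exp_neg w \<partial>p 0) = 1"
    by (simp add: q1.prob_space)
  moreover have int: "integrable (p 0) exp_neg"
    by (intro p0.integrable_const_bound[of _ 1]) auto
  ultimately have "(\<integral>w. 1 - exp_neg w \<partial>p 0) = 0"
    by (simp add: p0.prob_space)
  then have "AE w in p 0. 1 - exp_neg w = 0"
    using int by (subst (asm) integral_nonneg_eq_0_iff_AE) auto
  then have "AE w in p 0. w = 0"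
  proof eventually_elim
    case (elim w)
    then have "exp_neg w = exp_neg 0"
      by simp
    then show ?case
      by (simp del: exp_neg_0)
  qed
  then show ?thesis
    using Zero_InftyMinus by (simp add: boundary_0_def prob_algebra_eq_return[OF dual_p])
next
  case ZeroPlus_Infty
  have "((\<lambda>x. \<integral>w. laplace_kernel c1 c2 w 0 * f w \<partial>p x) \<longlongrightarrow>
      (\<integral>w. laplace_kernel c1 c2 w 0 * f w \<partial>p 0)) (at_right 0)" if "continuous_on UNIV f" for f
    using dual_p _ _ _ that
  proof (rule weighted_weak_convergence)
    fix n
    show "((\<lambda>x. \<integral>w. laplace_kernel c1 c2 w 0 * exp_neg w ^ n \<partial>p x) \<longlongrightarrow>
        (\<integral>w. laplace_kernel c1 c2 w 0 * exp_neg w ^ n \<partial>p 0)) (at_right 0)"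
      unfolding laplace_kernel_of_nat[symmetric] dual_eq
      unfolding ZeroPlus_Infty by (rule laplace_integral_tendsto_0[OF dual_q])
  qed (auto simp del: laplace_kernel_simps)
  then show ?thesis
    using ZeroPlus_Infty by (simp add: boundary_0_def)
qed

text \<open>If the kernel is constantly 0 at x = \<infinity>, \<open>exp_neg\<close> has integral 0
  under \<open>p \<infinity>\<close>, so all mass is at \<infinity>. Otherwise each weighted moment
  is a difference of two dual integrals, at \<open>of_nat n\<close> and at \<infinity>, both
  continuous at \<infinity>.\<close>

lemma dual_kernels_boundary_infty: "boundary_infty c1 c2 p"
proof (cases c2)
  case Infty_ZeroPlus
  have one: "0 < (1 :: real)"
    by simp
  have "(\<integral>w. exp_neg (w * ennreal 1) \<partial>p \<infinity>) = 0"
    using dual_eq[where y = "ennreal 1" and x = \<infinity>] Infty_ZeroPlus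
    unfolding laplace_kernel_pos[OF one] by simp
  moreover have "integrable (p \<infinity>) exp_neg"
    by (rule prob_algebra_integrable_bounded[OF dual_p, of _ 1]) auto
  ultimately have "AE w in p \<infinity>. exp_neg w = 0"
    by (subst integral_nonneg_eq_0_iff_AE[symmetric]) auto
  then have "AE w in p \<infinity>. w = \<infinity>"
  proof eventually_elim
    case (elim w)
    then have "exp_neg w = exp_neg \<top>"
      by simp
    then show ?case
      by (simp del: exp_neg_top)
  qed
  then have "p \<infinity> = return borel \<infinity>"
    by (rule prob_algebra_eq_return[OF dual_p])
  then show ?thesis
    using Infty_ZeroPlus by (simp add: boundary_infty_def)
next
  case InftyMinus_Zero
  have "((\<lambda>x. \<integral>w. (1 - laplace_kernel c1 c2 w \<infinity>) * f w \<partial>p x) \<longlongrightarrow>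
      (\<integral>w. (1 - laplace_kernel c1 c2 w \<infinity>) * f w \<partial>p \<infinity>)) (at_left \<infinity>)" if "continuous_on UNIV f" for f
    using dual_p _ _ _ that
  proof (rule weighted_weak_convergence)
    fix n
    have *: "(\<integral>w. (1 - laplace_kernel c1 c2 w \<infinity>) * exp_neg w ^ n \<partial>p x) =
        (\<integral>z. laplace_kernel c1 c2 x z \<partial>q (of_nat n)) - (\<integral>z. laplace_kernel c1 c2 x z \<partial>q \<infinity>)" for x
      using laplace_kernel_of_nat'[symmetric, of c1 _ n] dual_p[of x]
      by (simp add: InftyMinus_Zero[symmetric] dual_eq[symmetric] Bochner_Integration.integral_diff del: laplace_kernel_simps)
    show "((\<lambda>x. \<integral>w. (1 - laplace_kernel c1 c2 w \<infinity>) * exp_neg w ^ n \<partial>p x) \<longlongrightarrow>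
        (\<integral>w. (1 - laplace_kernel c1 c2 w \<infinity>) * exp_neg w ^ n \<partial>p \<infinity>)) (at_left \<infinity>)"
      unfolding * unfolding InftyMinus_Zero
      by (intro tendsto_diff laplace_integral_tendsto_infty dual_q)
  qed (auto simp del: laplace_kernel_simps)
  then show ?thesis
    using InftyMinus_Zero by (simp add: boundary_infty_def)
qed

end

text \<open>Bernstein's theorem gives the formula for 0 < x < \<infinity>. At an endpoint where the
  kernel is constant, the prescribed value of g matches it; at the other kind of endpoint both sides
  are continuous and agree by uniqueness of limits.\<close>

lemma laplace_representation:
  assumes g: "g \<in> cm_ennreal" and le1: "\<And>x. g x \<le> 1"
    and g0: "case c1 of ZeroPlus_Infty \<Rightarrow> (g \<longlongrightarrow> g 0) (at_right 0) | Zero_InftyMinus \<Rightarrow> g 0 = 1"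
    and ginf: "case c2 of Infty_ZeroPlus \<Rightarrow> g \<infinity> = 0 | InftyMinus_Zero \<Rightarrow> (g \<longlongrightarrow> g \<infinity>) (at_left \<infinity>)"
  shows "\<exists>q\<in>space (prob_algebra borel). \<forall>x. g x = (\<integral>z. laplace_kernel c1 c2 x z \<partial>q)"
proof -
  obtain q where q: "q \<in> space (prob_algebra borel)"
    and eq: "\<And>r. 0 < r \<Longrightarrow> g (ennreal r) = (\<integral>z. exp_neg (ennreal r * z) \<partial>q)"
    using Bernstein[OF cm_ennrealD(3)[OF g]] le1 by blast
  interpret prob_space q
    by (rule prob_algebraD[OF q])
  have inner: "g x = (\<integral>z. laplace_kernel c1 c2 x z \<partial>q)" if "0 < x" "x < \<infinity>" for x
    using that eq by (cases x) (auto simp: laplace_kernel_pos')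
  have "g 0 = (\<integral>z. laplace_kernel c1 c2 0 z \<partial>q)"
  proof (cases c1)
    case ZeroPlus_Infty
    have "\<forall>\<^sub>F x in at_right 0. (\<integral>z. laplace_kernel c1 c2 x z \<partial>q) = g x"
      using inner by (intro eventually_at_rightI[of 0 1]) (auto intro!: inner[symmetric] intro: less_trans[OF _ ennreal_one_less_top])
    then have "(g \<longlongrightarrow> (\<integral>z. laplace_kernel c1 c2 0 z \<partial>q)) (at_right 0)"
      using laplace_integral_tendsto_0[OF q, of c2] ZeroPlus_Infty
      by (simp add: tendsto_cong del: laplace_kernel_simps)
    moreover have "(g \<longlongrightarrow> g 0) (at_right 0)"
      using g0 ZeroPlus_Infty by simp
    moreover have "at_right (0 :: ennreal) \<noteq> bot"
    proof
      assume "at_right (0 :: ennreal) = bot"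
      then have "\<forall>\<^sub>F x in at_right (0 :: ennreal). False"
        by simp
      then obtain b :: ennreal where "0 < b" "\<And>y. 0 < y \<Longrightarrow> y < b \<Longrightarrow> False"
        unfolding eventually_at_right[OF zero_less_one] by blast
      then show False
        using dense[of 0 b] by blast
    qed
    ultimately show ?thesis
      by (metis tendsto_unique)
  qed (use g0 in \<open>simp add: prob_space\<close>)
  moreover have "g \<infinity> = (\<integral>z. laplace_kernel c1 c2 \<infinity> z \<partial>q)"
  proof (cases c2)
    case InftyMinus_Zero
    have "\<forall>\<^sub>F x in at_left \<infinity>. (\<integral>z. laplace_kernel c1 c2 x z \<partial>q) = g x"
      using inner by (intro eventually_at_leftI[of 0]) auto
    then have "(g \<longlongrightarrow> (\<integral>z. laplace_kernel c1 c2 \<infinity> z \<partial>q)) (at_left \<infinity>)"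
      using laplace_integral_tendsto_infty[OF q, of c1] InftyMinus_Zero
      by (simp add: tendsto_cong del: laplace_kernel_simps)
    moreover have "(g \<longlongrightarrow> g \<infinity>) (at_left \<infinity>)"
      using ginf InftyMinus_Zero by simp
    moreover have "at_left (\<infinity> :: ennreal) \<noteq> bot"
    proof
      assume "at_left (\<infinity> :: ennreal) = bot"
      then have "\<forall>\<^sub>F x in at_left (\<infinity> :: ennreal). False"
        by simp
      moreover have "0 < (\<infinity> :: ennreal)"
        by simp
      ultimately obtain b :: ennreal where "b < \<infinity>" "\<And>y. b < y \<Longrightarrow> y < \<infinity> \<Longrightarrow> False"
        using eventually_at_left[of 0 "\<infinity> :: ennreal" "\<lambda>_. False"] by blast
      then show False
        using dense[of b \<infinity>] by blast
    qed
    ultimately show ?thesis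
      by (metis tendsto_unique)
  qed (use ginf in simp)
  ultimately have "g x = (\<integral>z. laplace_kernel c1 c2 x z \<partial>q)" for x
    using inner[of x] by (cases "x = 0"; cases "x = \<infinity>") (auto simp: zero_less_iff_neq_zero less_top)
  then show ?thesis
    using q by blast
qed

text \<open>Applies \<open>laplace_representation\<close> to the image of the kernel function with
  parameter y. For y < \<infinity> this function is the weight of \<open>boundary_0\<close> times a
  continuous function, and at y = \<infinity> it is constantly 0 under the convention that asks for
  continuity at 0. So the boundary conditions on p give those on the image for every y.\<close>

lemma dual_kernel_exists:
  assumes p: "p \<in> borel \<rightarrow>\<^sub>M prob_algebra borel"
    and cm: "\<And>f. f \<in> cm_ennreal \<Longrightarrow> (\<lambda>x. integral\<^sup>L (p x) f) \<in> cm_ennreal"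
    and b0: "boundary_0 c1 c2 p" and binf: "boundary_infty c1 c2 p"
  shows "\<exists>q\<in>space (prob_algebra borel).
    \<forall>x. (\<integral>w. laplace_kernel c1 c2 w y \<partial>p x) = (\<integral>z. laplace_kernel c1 c2 x z \<partial>q)"
proof (rule laplace_representation)
  have p_prob: "p x \<in> space (prob_algebra borel)" for x
    using measurable_space[OF p] by simp
  let ?g = "\<lambda>x. \<integral>w. laplace_kernel c1 c2 w y \<partial>p x"
  show "?g \<in> cm_ennreal"
    by (intro cm laplace_kernel_cm)
  show "?g x \<le> 1" for x
    using prob_algebraD[OF p_prob[of x]] p_prob by (intro prob_space.integral_le_const) auto
  have cont: "continuous_on UNIV (\<lambda>w. exp_neg (w * y))" if "y < \<top>"
    unfolding continuous_on_def mult.commute[of _ y]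
    using that by (auto intro!: tendsto_exp_neg ennreal_tendsto_cmult)
  show "case c1 of ZeroPlus_Infty \<Rightarrow> (?g \<longlongrightarrow> ?g 0) (at_right 0) | Zero_InftyMinus \<Rightarrow> ?g 0 = 1"
  proof (cases c1)
    case ZeroPlus_Infty
    have "(?g \<longlongrightarrow> ?g 0) (at_right 0)"
    proof (cases "y = \<top>")
      case False
      then have "laplace_kernel c1 c2 w y = laplace_kernel c1 c2 w 0 * exp_neg (w * y)" for w
        by (cases "y = 0"; cases "w = \<top>") (auto simp: laplace_kernel_eq ennreal_top_mult)
      then show ?thesis
        using b0 ZeroPlus_Infty cont False
        by (simp add: boundary_0_def less_top del: laplace_kernel_simps)
    qed (simp add: ZeroPlus_Infty)
    then show ?thesis
      by (simp add: ZeroPlus_Infty)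
  next
    case Zero_InftyMinus
    then show ?thesis
      using b0 by (simp add: boundary_0_def integral_return)
  qed
  show "case c2 of Infty_ZeroPlus \<Rightarrow> ?g \<infinity> = 0 | InftyMinus_Zero \<Rightarrow> (?g \<longlongrightarrow> ?g \<infinity>) (at_left \<infinity>)"
  proof (cases c2)
    case InftyMinus_Zero
    let ?v = "\<lambda>w. 1 - laplace_kernel c1 c2 w \<infinity>"
    \<comment> \<open>The complement is used because at this endpoint it is 1 minus the kernel that
      factors into the weight and a continuous function.\<close>
    have "((\<lambda>x. 1 - ?g x) \<longlongrightarrow> 1 - ?g \<infinity>) (at_left \<infinity>)"
    proof -
      obtain f where f: "continuous_on UNIV f" "\<And>w. 1 - laplace_kernel c1 c2 w y = ?v w * f w"
      proof (cases "y = \<top>")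
        case True
        then show ?thesis
          by (intro that[of "\<lambda>_. 1"]) (auto simp del: laplace_kernel_simps)
      next
        case False
        then have "1 - laplace_kernel c1 c2 w y = ?v w * (1 - exp_neg (w * y))" for w
          using InftyMinus_Zero by (cases "y = 0"; cases "w = \<top>"; cases "w = 0")
            (auto simp: laplace_kernel_eq ennreal_top_mult ennreal_mult_top)
        then show ?thesis
          using cont False by (intro that[of "\<lambda>w. 1 - exp_neg (w * y)"] continuous_intros) (auto simp: less_top)
      qed
      have "1 - ?g x = (\<integral>w. ?v w * f w \<partial>p x)" for x
      proof -
        interpret prob_space "p x"
          by (rule prob_algebraD[OF p_prob])
        have "(\<integral>w. ?v w * f w \<partial>p x) = (\<integral>w. 1 - laplace_kernel c1 c2 w y \<partial>p x)"
          by (simp only: f(2))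
        then show ?thesis
          using p_prob[of x] by (simp add: prob_space)
      qed
      then show ?thesis
        using binf f(1) InftyMinus_Zero by (simp add: boundary_infty_def del: laplace_kernel_simps)
    qed
    from tendsto_diff[OF tendsto_const[of 1] this] show ?thesis
      by (simp add: InftyMinus_Zero)
  next
    case Infty_ZeroPlus
    then show ?thesis
      using binf by (simp add: boundary_infty_def integral_return)
  qed
qed

section \<open>Markov processes from transition semigroups\<close>

locale transition_semigroup =
  fixes K :: "real \<Rightarrow> ennreal \<Rightarrow> ennreal measure"
  assumes kernel: "\<And>t. 0 \<le> t \<Longrightarrow> K t \<in> borel \<rightarrow>\<^sub>M prob_algebra borel"
    and kernel_0: "\<And>x. K 0 x = return borel x"
    and Chapman_Kolmogorov: "\<And>s t x. 0 \<le> s \<Longrightarrow> 0 \<le> t \<Longrightarrow> K (s + t) x = K s x \<bind> K t"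

section \<open>Finite-dimensional laws of the chain\<close>

abbreviation path_space :: "(real \<Rightarrow> ennreal) measure" where
  "path_space \<equiv> PiM UNIV (\<lambda>_. borel)"

text \<open>A projection that stays on one path space, since dropped coordinates become 0.\<close>

definition forget :: "real set \<Rightarrow> (real \<Rightarrow> ennreal) \<Rightarrow> real \<Rightarrow> ennreal" where
  "forget J \<eta> i = (if i \<in> J then \<eta> i else 0)"

lemma measurable_forget [measurable]: "forget J \<in> path_space \<rightarrow>\<^sub>M path_space"
  by (rule measurable_PiM_single') (auto simp: forget_def)

lemma measurable_path_upd [measurable (raw)]:
  assumes "f \<in> N \<rightarrow>\<^sub>M path_space" "g \<in> borel_measurable N"
  shows "(\<lambda>x. (f x)(t := g x)) \<in> N \<rightarrow>\<^sub>M path_space"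
  using assms by (intro measurable_fun_upd[where J = UNIV]) auto

context transition_semigroup
begin

text \<open>The chain starts in \<open>x\<close> at time \<open>s\<close>. Coordinates outside \<open>ts\<close> are set to \<open>0\<close>, so that the laws
  for all \<open>ts\<close> live on one measurable space.\<close>

fun chain :: "real \<Rightarrow> real list \<Rightarrow> ennreal \<Rightarrow> (real \<Rightarrow> ennreal) measure" where
  "chain s [] x = return path_space (\<lambda>_. 0)"
| "chain s (t # ts) x = K (t - s) x \<bind> (\<lambda>z. distr (chain t ts z) path_space (\<lambda>\<eta>. \<eta>(t := z)))"

lemma measurable_chain:
  assumes "sorted (s # ts)"
  shows "chain s ts \<in> borel \<rightarrow>\<^sub>M prob_algebra path_space"
  using assms
proof (induction ts arbitrary: s)
  case Nil
  then show ?case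
    by (simp add: space_prob_algebra prob_space_return space_PiM)
next
  case (Cons t ts)
  then have [measurable]: "chain t ts \<in> borel \<rightarrow>\<^sub>M prob_algebra path_space"
    and [measurable]: "K (t - s) \<in> borel \<rightarrow>\<^sub>M prob_algebra borel"
    by (auto intro: kernel)
  show ?case
    unfolding chain.simps by measurable
qed

lemma measurable_chain_step:
  assumes "sorted (t # ts)"
  shows "(\<lambda>z. distr (chain t ts z) path_space (\<lambda>\<eta>. \<eta>(t := z))) \<in> borel \<rightarrow>\<^sub>M prob_algebra path_space"
proof -
  note [measurable] = measurable_chain[OF assms]
  show ?thesis
    by measurable
qed

lemma kernel_space: "0 \<le> t \<Longrightarrow> K t x \<in> space (prob_algebra borel)"
  using measurable_space[OF kernel] by simp

lemma chain_space: "sorted (s # ts) \<Longrightarrow> chain s ts x \<in> space (prob_algebra path_space)"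
  using measurable_space[OF measurable_chain] by simp

text \<open>An unobserved intermediate time merges with the next step by Chapman-Kolmogorov. If no
  later time follows, only the total mass 1 of the kernel matters.\<close>

lemma chain_skip:
  assumes "sorted (s # t # ts)"
  shows "K (t - s) x \<bind> chain t ts = chain s ts x"
proof (cases ts)
  case Nil
  have "chain t ts = (\<lambda>_. return path_space (\<lambda>_. 0))"
    using Nil by auto
  moreover have "prob_space (K (t - s) x)"
    using assms by (intro prob_algebraD[OF kernel_space]) auto
  moreover have "subprob_space (return path_space (\<lambda>_. 0 :: ennreal))"
    by (intro prob_space_imp_subprob_space prob_space_return) (simp add: space_PiM)
  ultimately show ?thesis
    using Nil by (simp add: bind_const')
next
  case (Cons v vs)
  let ?G = "\<lambda>z. distr (chain v vs z) path_space (\<lambda>\<eta>. \<eta>(v := z))"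
  have "chain t ts = (\<lambda>z. K (v - t) z \<bind> ?G)"
    by (simp add: Cons fun_eq_iff)
  then have "K (t - s) x \<bind> chain t ts = K (t - s) x \<bind> (\<lambda>z. K (v - t) z \<bind> ?G)"
    by simp
  also have "\<dots> = (K (t - s) x \<bind> K (v - t)) \<bind> ?G"
  proof (rule bind_assoc[symmetric])
    show "K (v - t) \<in> K (t - s) x \<rightarrow>\<^sub>M subprob_algebra borel"
      using assms Cons
      by (simp add: prob_algebraD(4)[OF kernel_space] measurable_prob_algebraD kernel)
    show "?G \<in> borel \<rightarrow>\<^sub>M subprob_algebra path_space"
      using assms Cons by (intro measurable_prob_algebraD measurable_chain_step) auto
  qed
  also have "K (t - s) x \<bind> K (v - t) = K (v - s) x"
    using Chapman_Kolmogorov[of "t - s" "v - t" x] assms Cons by simp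
  also have "K (v - s) x \<bind> ?G = chain s ts x"
    unfolding Cons chain.simps ..
  finally show ?thesis .
qed

text \<open>The consistency needed for the extension theorem, by induction on the times: an update
  at a kept time commutes with \<open>forget\<close>, while a dropped time is erased and then
  removed by \<open>chain_skip\<close>.\<close>

lemma forget_chain:
  assumes "sorted (s # ts)"
  shows "distr (chain s ts x) path_space (forget J) = chain s (filter (\<lambda>t. t \<in> J) ts) x"
  using assms
proof (induction ts arbitrary: s x)
  case Nil
  have "forget J (\<lambda>_. 0) = (\<lambda>_. 0)"
    by (auto simp: forget_def)
  then show ?case
    by (simp add: distr_return space_PiM)
next
  case (Cons t ts)
  let ?f = "filter (\<lambda>t. t \<in> J)"
  have sorted: "sorted (t # ts)" and st: "0 \<le> t - s"
    using Cons.prems by auto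
  have sets: "sets (chain t ts z) = sets path_space" for z
    by (rule prob_algebraD[OF chain_space[OF sorted]])
  note meas_cong = measurable_cong_sets[OF sets refl]
  have upd [measurable]: "(\<lambda>\<eta>. \<eta>(t := z)) \<in> path_space \<rightarrow>\<^sub>M path_space" for z
    by measurable
  have "distr (chain s (t # ts) x) path_space (forget J) =
      K (t - s) x \<bind> (\<lambda>z. distr (distr (chain t ts z) path_space (\<lambda>\<eta>. \<eta>(t := z))) path_space (forget J))"
    unfolding chain.simps
  proof (rule distr_bind)
    show "(\<lambda>z. distr (chain t ts z) path_space (\<lambda>\<eta>. \<eta>(t := z))) \<in> K (t - s) x \<rightarrow>\<^sub>M subprob_algebra path_space"
      using measurable_chain_step[OF sorted]
      by (simp add: prob_algebraD(4)[OF kernel_space[OF st]] measurable_prob_algebraD)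
    show "space (K (t - s) x) \<noteq> {}"
      using prob_algebraD(3)[OF kernel_space[OF st]] by simp
  qed measurable
  also have "\<dots> = K (t - s) x \<bind> (\<lambda>z. distr (chain t ts z) path_space (\<lambda>\<eta>. forget J (\<eta>(t := z))))"
    by (subst distr_distr) (auto simp: meas_cong comp_def)
  also have "\<dots> = chain s (?f (t # ts)) x"
  proof (cases "t \<in> J")
    case True
    have "distr (chain t ts z) path_space (\<lambda>\<eta>. forget J (\<eta>(t := z))) =
        distr (chain t (?f ts) z) path_space (\<lambda>\<eta>. \<eta>(t := z))" for z
    proof -
      have "(\<lambda>\<eta>. forget J (\<eta>(t := z))) = (\<lambda>\<eta>. \<eta>(t := z)) \<circ> forget J"
        using True by (auto simp: forget_def fun_eq_iff)
      then show ?thesis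
        unfolding Cons.IH[OF sorted, symmetric] by (simp add: distr_distr meas_cong)
    qed
    then show ?thesis
      using True by simp
  next
    case False
    have "distr (chain t ts z) path_space (\<lambda>\<eta>. forget J (\<eta>(t := z))) = chain t (?f ts) z" for z
    proof -
      have "(\<lambda>\<eta>. forget J (\<eta>(t := z))) = forget J"
        using False by (auto simp: forget_def fun_eq_iff)
      then show ?thesis
        by (simp add: Cons.IH[OF sorted])
    qed
    moreover have "sorted (s # t # ?f ts)"
      using Cons.prems by (auto intro: sorted_wrt_filter)
    ultimately show ?thesis
      using False chain_skip by simp
  qed
  finally show ?case .
qed

text \<open>The recursion of \<open>chain\<close> peels off the earliest time, whereas the Markov
  property concerns the last one. Distinct times make the updates commute and leave the value at
  \<open>u\<close> untouched.\<close>

lemma chain_snoc: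
  assumes "sorted (s # us @ [u, t])" "distinct (us @ [u, t])"
  shows "chain s (us @ [u, t]) x =
    chain s (us @ [u]) x \<bind> (\<lambda>\<eta>. distr (K (t - u) (\<eta> u)) path_space (\<lambda>w. \<eta>(t := w)))"
  using assms
proof (induction us arbitrary: s x)
  case Nil
  then have su: "0 \<le> u - s" and ut: "0 \<le> t - u" "t \<noteq> u"
    by auto
  note [measurable] = kernel[OF ut(1)] kernel[OF su]
  note cong_su = prob_algebraD(4)[OF kernel_space[OF su]]
  let ?o = "\<lambda>_. 0 :: ennreal"
  let ?G = "\<lambda>\<eta>. distr (K (t - u) (\<eta> u)) path_space (\<lambda>w. \<eta>(t := w))"
  have G: "?G \<in> path_space \<rightarrow>\<^sub>M prob_algebra path_space"
    by measurable
  have upd: "(\<lambda>w. ?o(t := w)) \<in> borel \<rightarrow>\<^sub>M path_space"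
    by (intro measurable_path_upd) (auto simp: space_PiM)
  have inner: "distr (chain u [t] z) path_space (\<lambda>\<eta>. \<eta>(u := z)) = ?G (?o(u := z))" for z
  proof -
    have "chain u [t] z = distr (K (t - u) z) path_space (\<lambda>w. ?o(t := w))"
    proof -
      have "(\<lambda>w. distr (return path_space ?o) path_space (\<lambda>\<eta>. \<eta>(t := w))) = (\<lambda>w. return path_space (?o(t := w)))"
        by (subst distr_return) (auto simp: space_PiM)
      then have "chain u [t] z = K (t - u) z \<bind> (\<lambda>w. return path_space (?o(t := w)))"
        by simp
      also have "\<dots> = distr (K (t - u) z) path_space (\<lambda>w. ?o(t := w))"
        by (rule bind_return_distr')
          (use upd in \<open>simp_all add: prob_algebraD[OF kernel_space[OF ut(1)]]\<close>)
      finally show ?thesis .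
    qed
    then have "distr (chain u [t] z) path_space (\<lambda>\<eta>. \<eta>(u := z)) =
        distr (distr (K (t - u) z) path_space (\<lambda>w. ?o(t := w))) path_space (\<lambda>\<eta>. \<eta>(u := z))"
      by (simp only:)
    also have "\<dots> = distr (K (t - u) z) path_space ((\<lambda>\<eta>. \<eta>(u := z)) \<circ> (\<lambda>w. ?o(t := w)))"
      by (rule distr_distr) (use upd in \<open>simp_all add: prob_algebraD[OF kernel_space[OF ut(1)]]\<close>)
    also have "(\<lambda>\<eta>. \<eta>(u := z)) \<circ> (\<lambda>w. ?o(t := w)) = (\<lambda>w. ?o(u := z, t := w))"
      using ut(2) by (auto simp: fun_eq_iff)
    also have "distr (K (t - u) z) path_space (\<lambda>w. ?o(u := z, t := w)) = ?G (?o(u := z))"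
      by simp
    finally show ?thesis .
  qed
  have start: "chain s [u] x = K (u - s) x \<bind> (\<lambda>z. return path_space (?o(u := z)))"
    by (simp add: distr_return space_PiM)
  have ret: "(\<lambda>z. return path_space (?o(u := z))) \<in> borel \<rightarrow>\<^sub>M prob_algebra path_space"
    by (rule measurable_compose[OF _ measurable_return_prob_space], intro measurable_path_upd)
      (auto simp: space_PiM)
  have "chain s [u] x \<bind> ?G = K (u - s) x \<bind> (\<lambda>z. return path_space (?o(u := z)) \<bind> ?G)"
    unfolding start using G ret
    by (intro bind_assoc[where N = path_space and R = path_space]) (auto simp: cong_su intro!: measurable_prob_algebraD)
  also have "\<dots> = K (u - s) x \<bind> (\<lambda>z. ?G (?o(u := z)))"
    using measurable_prob_algebraD[OF G] by (intro bind_cong refl bind_return) (auto simp: space_PiM)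
  also have "\<dots> = chain s [u, t] x"
    unfolding chain.simps(2)[of s u "[t]"] inner ..
  finally show ?case
    unfolding append_Nil by (rule sym)
next
  case (Cons a us)
  then have sa: "0 \<le> a - s" and ut: "0 \<le> t - u" and neq: "a \<noteq> t" "a \<noteq> u"
    and sorted: "sorted (a # us @ [u])" "sorted (a # us @ [u, t])" and dist: "distinct (us @ [u, t])"
    by (auto simp: sorted_append)
  note [measurable] = kernel[OF ut] kernel[OF sa] measurable_chain[OF sorted(1)]
  note cong_sa = prob_algebraD(4)[OF kernel_space[OF sa]]
  note cong_ch = prob_algebraD[OF chain_space[OF sorted(1)]]
  let ?G = "\<lambda>\<eta>. distr (K (t - u) (\<eta> u)) path_space (\<lambda>w. \<eta>(t := w))"
  have G: "?G \<in> path_space \<rightarrow>\<^sub>M prob_algebra path_space"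
    by measurable
  have inner: "distr (chain a (us @ [u, t]) z) path_space (\<lambda>\<eta>. \<eta>(a := z)) =
      distr (chain a (us @ [u]) z) path_space (\<lambda>\<eta>. \<eta>(a := z)) \<bind> ?G" for z
  proof -
    have "distr (chain a (us @ [u, t]) z) path_space (\<lambda>\<eta>. \<eta>(a := z)) =
        chain a (us @ [u]) z \<bind> (\<lambda>\<eta>. distr (?G \<eta>) path_space (\<lambda>\<eta>. \<eta>(a := z)))"
      unfolding Cons.IH[OF sorted(2) dist]
      using measurable_prob_algebraD[OF G]
      by (intro distr_bind[where K = path_space]) (auto simp: space_PiM cong_ch)
    also have "\<dots> = chain a (us @ [u]) z \<bind> (\<lambda>\<eta>. ?G (\<eta>(a := z)))"
    proof (rule bind_cong[OF refl])
      fix \<eta> :: "real \<Rightarrow> ennreal"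
      have upd: "(\<lambda>w. \<eta>(t := w)) \<in> K (t - u) (\<eta> u) \<rightarrow>\<^sub>M path_space"
        unfolding prob_algebraD(4)[OF kernel_space[OF ut]]
        by (intro measurable_path_upd) (auto simp: space_PiM)
      have "distr (?G \<eta>) path_space (\<lambda>\<eta>. \<eta>(a := z)) =
          distr (K (t - u) (\<eta> u)) path_space ((\<lambda>\<eta>. \<eta>(a := z)) \<circ> (\<lambda>w. \<eta>(t := w)))"
        by (rule distr_distr[OF _ upd]) measurable
      also have "(\<lambda>\<eta>. \<eta>(a := z)) \<circ> (\<lambda>w. \<eta>(t := w)) = (\<lambda>w. \<eta>(a := z, t := w))"
        using neq by (auto simp: fun_eq_iff)
      also have "distr (K (t - u) (\<eta> u)) path_space (\<lambda>w. \<eta>(a := z, t := w)) = ?G (\<eta>(a := z))"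
        using neq by simp
      finally show "distr (?G \<eta>) path_space (\<lambda>\<eta>. \<eta>(a := z)) = ?G (\<eta>(a := z))" .
    qed
    also have "\<dots> = distr (chain a (us @ [u]) z) path_space (\<lambda>\<eta>. \<eta>(a := z)) \<bind> ?G"
    proof (rule bind_distr[symmetric, where K = path_space])
      show "(\<lambda>\<eta>. \<eta>(a := z)) \<in> chain a (us @ [u]) z \<rightarrow>\<^sub>M path_space"
        unfolding cong_ch(4) by measurable
    qed (use measurable_prob_algebraD[OF G] in \<open>auto simp: cong_ch space_PiM\<close>)
    finally show ?thesis .
  qed
  have "chain s (a # us @ [u]) x \<bind> ?G =
      K (a - s) x \<bind> (\<lambda>z. distr (chain a (us @ [u]) z) path_space (\<lambda>\<eta>. \<eta>(a := z)) \<bind> ?G)"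
    unfolding chain.simps
    using measurable_prob_algebraD[OF G] measurable_chain_step[OF sorted(1)]
    by (intro bind_assoc[where N = path_space and R = path_space]) (auto simp: cong_sa intro: measurable_prob_algebraD)
  also have "\<dots> = chain s (a # us @ [u, t]) x"
    by (simp add: inner)
  finally show ?case
    unfolding append_Cons by (rule sym)
qed

end

section \<open>Kolmogorov extension and the path laws\<close>

context transition_semigroup
begin

abbreviation time_axis :: "real set" where
  "time_axis \<equiv> {0..}"

lemma sorted_times:
  assumes "finite J" "J \<subseteq> time_axis"
  shows "sorted (0 # sorted_list_of_set J)"
  using assms by auto

lemma chain_projective:
  assumes "J \<subseteq> H" "finite H" "H \<subseteq> time_axis"
  shows "distr (chain 0 (sorted_list_of_set H) x) path_space (forget J) = chain 0 (sorted_list_of_set J) x"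
proof -
  have "filter (\<lambda>t. t \<in> J) (sorted_list_of_set H) = sorted_list_of_set J"
    using assms finite_subset[OF assms(1,2)]
    by (intro sorted_distinct_set_unique) (auto intro: sorted_wrt_filter)
  then show ?thesis
    using forget_chain[OF sorted_times[OF assms(2,3)]] by simp
qed

text \<open>Kolmogorov's extension theorem is available for Polish spaces only, so the state space is
  moved into the reals by \<open>exp_neg\<close>.\<close>

lemma Kolmogorov_extension:
  "\<exists>Q\<in>space (prob_algebra (PiM time_axis (\<lambda>_. borel))). \<forall>J. finite J \<longrightarrow> J \<subseteq> time_axis \<longrightarrow>
    distr Q (PiM J (\<lambda>_. borel)) (\<lambda>\<eta>. restrict \<eta> J) =
    distr (chain 0 (sorted_list_of_set J) x) (PiM J (\<lambda>_. borel)) (\<lambda>\<eta>. restrict \<eta> J)"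
proof -
  define E where "E J \<eta> = (\<lambda>j\<in>J. exp_neg (\<eta> j))" for J :: "real set" and \<eta>
  define L where "L J \<rho> = (\<lambda>j\<in>J. neg_ln (\<rho> j))" for J :: "real set" and \<rho>
  have E [measurable]: "E J \<in> path_space \<rightarrow>\<^sub>M PiM J (\<lambda>_. borel)" for J
    unfolding E_def by measurable
  have L [measurable]: "L J \<in> PiM J (\<lambda>_. borel) \<rightarrow>\<^sub>M PiM J (\<lambda>_. borel)" for J
    unfolding L_def by measurable
  let ?c = "\<lambda>J. chain 0 (sorted_list_of_set J) x"
  define F where "F J = distr (?c J) (PiM J (\<lambda>_. borel)) (E J)" for J
  have c: "?c J \<in> space (prob_algebra path_space)" if "finite J" "J \<subseteq> time_axis" for J
    using chain_space[OF sorted_times[OF that]] .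
  interpret polish_projective time_axis F
  proof (intro polish_projective.intro projective_family.intro)
    fix J H :: "real set" assume *: "J \<subseteq> H" "finite H" "H \<subseteq> time_axis"
    note H = prob_algebraD[OF c[OF *(2,3)]]
    have "F J = distr (distr (?c H) path_space (forget J)) (PiM J (\<lambda>_. borel)) (E J)"
      by (simp add: F_def chain_projective[OF *])
    also have "\<dots> = distr (?c H) (PiM J (\<lambda>_. borel)) (E J \<circ> forget J)"
      using H by (intro distr_distr) (auto simp: H(4))
    also have "E J \<circ> forget J = (\<lambda>f. restrict f J) \<circ> E H"
      using *(1) by (auto simp: E_def forget_def fun_eq_iff)
    also have "distr (?c H) (PiM J (\<lambda>_. borel)) \<dots> = distr (F H) (PiM J (\<lambda>_. borel)) (\<lambda>f. restrict f J)"
      unfolding F_def using *(1)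
      by (intro distr_distr[symmetric]) (auto simp: H(4) intro!: measurable_restrict_subset)
    finally show "F J = distr (F H) (PiM J (\<lambda>_. borel)) (\<lambda>f. restrict f J)" .
  next
    fix J :: "real set" assume "finite J" "J \<subseteq> time_axis"
    note J = prob_algebraD[OF c[OF this]]
    show "prob_space (F J)"
      unfolding F_def using J by (intro prob_space.prob_space_distr) (auto simp: J(4))
  qed
  \<comment> \<open>The projective limit lives on real-valued paths; \<open>L\<close> decodes each
    coordinate, and \<open>L J\<close> undoes \<open>E J\<close> up to restriction.\<close>
  define Q where "Q = distr lim (PiM time_axis (\<lambda>_. borel)) (L time_axis)"
  have lim_cong: "measurable lim M = measurable (PiM time_axis (\<lambda>_. borel)) M" for M
    by (rule measurable_cong_sets) auto
  have distr_lim: "distr lim (PiM J (\<lambda>_. borel)) (\<lambda>f. restrict f J) = F J"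
    if J: "finite J" "J \<subseteq> time_axis" for J
  proof (rule measure_eqI)
    fix A assume "A \<in> sets (distr lim (PiM J (\<lambda>_. borel)) (\<lambda>f. restrict f J))"
    then have A: "A \<in> sets (PiM J (\<lambda>_. borel))"
      by simp
    have "(\<lambda>f. restrict f J) -` A \<inter> space lim = prod_emb time_axis (\<lambda>_. borel) J A"
      by (auto simp: prod_emb_def space_PiM)
    then show "emeasure (distr lim (PiM J (\<lambda>_. borel)) (\<lambda>f. restrict f J)) A = emeasure (F J) A"
      using emeasure_lim_emb[OF J(2,1) A] A J
      by (subst emeasure_distr) (auto simp: lim_cong intro!: measurable_restrict_subset)
  qed (simp add: F_def)
  have "distr Q (PiM J (\<lambda>_. borel)) (\<lambda>\<eta>. restrict \<eta> J) = distr (?c J) (PiM J (\<lambda>_. borel)) (\<lambda>\<eta>. restrict \<eta> J)"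
    if J: "finite J" "J \<subseteq> time_axis" for J
  proof -
    note cJ = prob_algebraD[OF c[OF J]]
    have "distr Q (PiM J (\<lambda>_. borel)) (\<lambda>\<eta>. restrict \<eta> J) =
        distr lim (PiM J (\<lambda>_. borel)) ((\<lambda>\<eta>. restrict \<eta> J) \<circ> L time_axis)"
      unfolding Q_def using J
      by (intro distr_distr) (auto simp: lim_cong intro!: measurable_restrict_subset)
    also have "(\<lambda>\<eta>. restrict \<eta> J) \<circ> L time_axis = L J \<circ> (\<lambda>\<eta>. restrict \<eta> J)"
      using J by (auto simp: L_def fun_eq_iff)
    also have "distr lim (PiM J (\<lambda>_. borel)) \<dots> = distr (F J) (PiM J (\<lambda>_. borel)) (L J)"
      unfolding distr_lim[OF J, symmetric] using J
      by (intro distr_distr[symmetric]) (auto simp: lim_cong intro!: measurable_restrict_subset)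
    also have "\<dots> = distr (?c J) (PiM J (\<lambda>_. borel)) (L J \<circ> E J)"
      unfolding F_def by (intro distr_distr) (auto simp: cJ(4))
    also have "L J \<circ> E J = (\<lambda>\<eta>. restrict \<eta> J)"
      by (auto simp: L_def E_def fun_eq_iff)
    finally show ?thesis .
  qed
  moreover have "Q \<in> space (prob_algebra (PiM time_axis (\<lambda>_. borel)))"
    unfolding Q_def by (auto simp: space_prob_algebra lim_cong intro!: P.prob_space_distr)
  ultimately show ?thesis
    by blast
qed

definition paths :: "(real \<Rightarrow> ennreal) measure" where
  "paths = PiM time_axis (\<lambda>_. borel)"

text \<open>Chosen separately for each x. Measurability in x is recovered later for single
  coordinates, whose laws are the kernels \<open>K t\<close>.\<close>

definition path_law :: "ennreal \<Rightarrow> (real \<Rightarrow> ennreal) measure" where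
  "path_law x = (SOME Q. Q \<in> space (prob_algebra paths) \<and> (\<forall>J. finite J \<longrightarrow> J \<subseteq> time_axis \<longrightarrow>
    distr Q (PiM J (\<lambda>_. borel)) (\<lambda>\<eta>. restrict \<eta> J) =
    distr (chain 0 (sorted_list_of_set J) x) (PiM J (\<lambda>_. borel)) (\<lambda>\<eta>. restrict \<eta> J)))"

lemma
  shows path_law_space: "path_law x \<in> space (prob_algebra paths)"
    and path_law_fdd: "finite J \<Longrightarrow> J \<subseteq> time_axis \<Longrightarrow>
      distr (path_law x) (PiM J (\<lambda>_. borel)) (\<lambda>\<eta>. restrict \<eta> J) =
      distr (chain 0 (sorted_list_of_set J) x) (PiM J (\<lambda>_. borel)) (\<lambda>\<eta>. restrict \<eta> J)"
proof -
  let ?P = "\<lambda>Q. Q \<in> space (prob_algebra paths) \<and> (\<forall>J. finite J \<longrightarrow> J \<subseteq> time_axis \<longrightarrow>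
    distr Q (PiM J (\<lambda>_. borel)) (\<lambda>\<eta>. restrict \<eta> J) =
    distr (chain 0 (sorted_list_of_set J) x) (PiM J (\<lambda>_. borel)) (\<lambda>\<eta>. restrict \<eta> J))"
  have "\<exists>Q. ?P Q"
    using Kolmogorov_extension[of x] unfolding paths_def Bex_def .
  then have P: "?P (path_law x)"
    unfolding path_law_def by (rule someI_ex)
  show "path_law x \<in> space (prob_algebra paths)"
    using P by (rule conjunct1)
  show "distr (path_law x) (PiM J (\<lambda>_. borel)) (\<lambda>\<eta>. restrict \<eta> J) =
      distr (chain 0 (sorted_list_of_set J) x) (PiM J (\<lambda>_. borel)) (\<lambda>\<eta>. restrict \<eta> J)"
    if "finite J" "J \<subseteq> time_axis"
    using P[THEN conjunct2, rule_format, OF that] .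
qed

lemma measurable_coordinate: "0 \<le> t \<Longrightarrow> (\<lambda>\<eta>. \<eta> t) \<in> borel_measurable paths"
  unfolding paths_def by (rule measurable_component_singleton) simp

lemma nn_integral_path_law:
  assumes J: "finite J" "J \<subseteq> time_axis" and g: "g \<in> borel_measurable (PiM J (\<lambda>_. borel))"
  shows "(\<integral>\<^sup>+\<eta>. g (restrict \<eta> J) \<partial>path_law x) =
    (\<integral>\<^sup>+\<eta>. g (restrict \<eta> J) \<partial>chain 0 (sorted_list_of_set J) x)"
proof -
  have "(\<integral>\<^sup>+\<eta>. g (restrict \<eta> J) \<partial>path_law x) =
      (\<integral>\<^sup>+\<rho>. g \<rho> \<partial>distr (path_law x) (PiM J (\<lambda>_. borel)) (\<lambda>\<eta>. restrict \<eta> J))"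
  proof (rule nn_integral_distr[symmetric])
    show "(\<lambda>\<eta>. restrict \<eta> J) \<in> path_law x \<rightarrow>\<^sub>M PiM J (\<lambda>_. borel)"
      unfolding prob_algebraD(4)[OF path_law_space] paths_def
      using J(2) by (rule measurable_restrict_subset)
  qed (use g in simp)
  also have "\<dots> = (\<integral>\<^sup>+\<eta>. g (restrict \<eta> J) \<partial>chain 0 (sorted_list_of_set J) x)"
    unfolding path_law_fdd[OF J] using g
    by (intro nn_integral_distr) (auto simp: prob_algebraD(4)[OF chain_space[OF sorted_times[OF J]]])
  finally show ?thesis .
qed

lemma path_law_coordinate:
  assumes t: "0 \<le> t"
  shows "distr (path_law x) borel (\<lambda>\<eta>. \<eta> t) = K t x"
proof (rule measure_eqI)
  note Kt = prob_algebraD[OF kernel_space[OF t]]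
  show "sets (distr (path_law x) borel (\<lambda>\<eta>. \<eta> t)) = sets (K t x)"
    by (simp add: Kt)
  fix A assume "A \<in> sets (distr (path_law x) borel (\<lambda>\<eta>. \<eta> t))"
  then have A [measurable]: "A \<in> sets borel"
    by simp
  have meas: "(\<lambda>\<eta>. \<eta> t) \<in> path_law x \<rightarrow>\<^sub>M borel"
    using measurable_coordinate[OF t] by (simp add: prob_algebraD(4)[OF path_law_space])
  have "emeasure (distr (path_law x) borel (\<lambda>\<eta>. \<eta> t)) A =
      (\<integral>\<^sup>+z. indicator A z \<partial>distr (path_law x) borel (\<lambda>\<eta>. \<eta> t))"
    by simp
  also have "\<dots> = (\<integral>\<^sup>+\<eta>. indicator A (\<eta> t) \<partial>path_law x)"
    by (rule nn_integral_distr[OF meas]) simp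
  also have "\<dots> = (\<integral>\<^sup>+\<eta>. indicator A (\<eta> t) \<partial>chain 0 [t] x)"
    using nn_integral_path_law[of "{t}" "\<lambda>\<eta>. indicator A (\<eta> t)" x] t by simp
  also have "chain 0 [t] x = distr (K t x) path_space (\<lambda>z. (\<lambda>_. 0)(t := z))"
  proof -
    have upd: "(\<lambda>z. (\<lambda>_. 0 :: ennreal)(t := z)) \<in> borel \<rightarrow>\<^sub>M path_space"
      by (intro measurable_path_upd) (auto simp: space_PiM)
    have "chain 0 [t] x = K t x \<bind> (\<lambda>z. return path_space ((\<lambda>_. 0)(t := z)))"
      by (simp add: distr_return space_PiM)
    also have "\<dots> = distr (K t x) path_space (\<lambda>z. (\<lambda>_. 0)(t := z))"
      by (rule bind_return_distr') (use upd in \<open>simp_all add: Kt\<close>)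
    finally show ?thesis .
  qed
  also have "(\<integral>\<^sup>+\<eta>. indicator A (\<eta> t) \<partial>distr (K t x) path_space (\<lambda>z. (\<lambda>_. 0)(t := z))) =
      (\<integral>\<^sup>+z. indicator A (((\<lambda>_. 0)(t := z)) t) \<partial>K t x)"
  proof (rule nn_integral_distr)
    have "(\<lambda>z. (\<lambda>_. 0 :: ennreal)(t := z)) \<in> borel \<rightarrow>\<^sub>M path_space"
      by (intro measurable_path_upd) (auto simp: space_PiM)
    then show "(\<lambda>z. (\<lambda>_. 0)(t := z)) \<in> K t x \<rightarrow>\<^sub>M path_space"
      by (simp add: Kt)
  qed measurable
  also have "\<dots> = emeasure (K t x) A"
    by (simp add: Kt)
  finally show "emeasure (distr (path_law x) borel (\<lambda>\<eta>. \<eta> t)) A = emeasure (K t x) A" .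
qed

text \<open>Only finitely many times enter, with t the last of them. The integral is therefore taken
  over a chain, whose final transition \<open>chain_snoc\<close> isolates and integrates to
  \<open>emeasure (K (t - s) (\<eta> s)) A\<close>.\<close>

lemma path_law_Markov_cylinder:
  assumes st: "0 \<le> s" "s < t" and J: "finite J" "J \<subseteq> {0..s}"
    and C: "\<And>j. j \<in> J \<Longrightarrow> C j \<in> sets borel" and A: "A \<in> sets borel"
  shows "(\<integral>\<^sup>+\<eta>. (\<Prod>j\<in>J. indicator (C j) (\<eta> j)) * indicator A (\<eta> t) \<partial>path_law x) =
    (\<integral>\<^sup>+\<eta>. (\<Prod>j\<in>J. indicator (C j) (\<eta> j)) * emeasure (K (t - s) (\<eta> s)) A \<partial>path_law x)"
proof -
  note [measurable] = A kernel[of "t - s"] C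
  have ts: "0 \<le> t - s"
    using st by simp
  \<comment> \<open>The present time is added because the right-hand side reads
    \<open>\<eta> s\<close> even if s is not in J.\<close>
  define H where "H = insert s J"
  have H: "finite H" "H \<subseteq> time_axis" "s \<in> H" "J \<subseteq> H" "t \<notin> H" "\<And>j. j \<in> H \<Longrightarrow> j \<le> s"
    using J st by (auto simp: H_def)
  define us where "us = sorted_list_of_set (H - {s})"
  have us: "sorted us" "distinct us" "set us = H - {s}"
    using H by (auto simp: us_def)
  have "insert t H = set (us @ [s, t])" "H = set (us @ [s])"
    using us H by auto
  moreover have "sorted (us @ [s, t])" "distinct (us @ [s, t])"
    using us H st by (auto simp: sorted_append intro: order_trans[of _ s t])
  ultimately have us_s: "sorted_list_of_set H = us @ [s]"
    and us_t: "sorted_list_of_set (insert t H) = us @ [s, t]"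
    by (auto simp: sorted_append simp del: set_append intro!: sorted_list_of_set.idem_if_sorted_distinct)
  have sorted: "sorted (0 # us @ [s])" "sorted (0 # us @ [s, t])" "distinct (us @ [s, t])"
    using sorted_times[OF H(1,2)] sorted_times[of "insert t H"] distinct_sorted_list_of_set[of "insert t H"] H st
    unfolding us_s us_t by auto
  let ?R = "\<lambda>\<eta>. \<Prod>j\<in>J. indicator (C j) (\<eta> j) :: ennreal"
  have KA [measurable]: "(\<lambda>z. emeasure (K (t - s) z) A) \<in> borel_measurable borel"
    using kernel[OF ts] by (intro emeasure_measurable_subprob_algebra2[where N = borel] measurable_prob_algebraD) auto
  let ?step = "\<lambda>\<eta>. distr (K (t - s) (\<eta> s)) path_space (\<lambda>w. \<eta>(t := w))"
  have "(\<integral>\<^sup>+\<eta>. ?R \<eta> * indicator A (\<eta> t) \<partial>path_law x) =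
      (\<integral>\<^sup>+\<eta>. ?R (restrict \<eta> (insert t H)) * indicator A (restrict \<eta> (insert t H) t) \<partial>path_law x)"
    using H by (intro nn_integral_cong arg_cong2[where f = "(*)"] prod.cong) auto
  also have "\<dots> = (\<integral>\<^sup>+\<eta>. ?R (restrict \<eta> (insert t H)) * indicator A (restrict \<eta> (insert t H) t) \<partial>chain 0 (us @ [s, t]) x)"
    unfolding us_t[symmetric] using H st
    by (intro nn_integral_path_law[where g = "\<lambda>\<eta>. ?R \<eta> * indicator A (\<eta> t)"]) (auto intro!: borel_measurable_times_ennreal borel_measurable_prod_ennreal)
  also have "\<dots> = (\<integral>\<^sup>+\<eta>. ?R \<eta> * indicator A (\<eta> t) \<partial>chain 0 (us @ [s, t]) x)"
    using H by (intro nn_integral_cong arg_cong2[where f = "(*)"] prod.cong) auto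
  also have "\<dots> = (\<integral>\<^sup>+\<eta>. \<integral>\<^sup>+\<eta>'. ?R \<eta>' * indicator A (\<eta>' t) \<partial>?step \<eta> \<partial>chain 0 (us @ [s]) x)"
    unfolding chain_snoc[OF sorted(2,3)]
  proof (rule nn_integral_bind[where B = path_space])
    show "(\<lambda>\<eta>. ?R \<eta> * indicator A (\<eta> t)) \<in> borel_measurable path_space"
      by measurable
    have "?step \<in> path_space \<rightarrow>\<^sub>M prob_algebra path_space"
      using ts by measurable
    then show "?step \<in> chain 0 (us @ [s]) x \<rightarrow>\<^sub>M subprob_algebra path_space"
      by (simp add: prob_algebraD[OF chain_space[OF sorted(1)]] measurable_prob_algebraD)
  qed
  also have "\<dots> = (\<integral>\<^sup>+\<eta>. ?R \<eta> * emeasure (K (t - s) (\<eta> s)) A \<partial>chain 0 (us @ [s]) x)"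
  proof (rule nn_integral_cong)
    fix \<eta>
    note K = prob_algebraD[OF kernel_space[OF ts, of "\<eta> s"]]
    have upd: "(\<lambda>w. \<eta>(t := w)) \<in> K (t - s) (\<eta> s) \<rightarrow>\<^sub>M path_space"
      unfolding K(4) by (intro measurable_path_upd) (auto simp: space_PiM)
    have "(\<integral>\<^sup>+\<eta>'. ?R \<eta>' * indicator A (\<eta>' t) \<partial>?step \<eta>) =
        (\<integral>\<^sup>+w. ?R (\<eta>(t := w)) * indicator A ((\<eta>(t := w)) t) \<partial>K (t - s) (\<eta> s))"
      by (rule nn_integral_distr[OF upd]) measurable
    also have "\<dots> = (\<integral>\<^sup>+w. ?R \<eta> * indicator A w \<partial>K (t - s) (\<eta> s))"
      using H by (intro nn_integral_cong arg_cong2[where f = "(*)"] prod.cong) auto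
    also have "\<dots> = ?R \<eta> * emeasure (K (t - s) (\<eta> s)) A"
      by (simp add: nn_integral_cmult K)
    finally show "(\<integral>\<^sup>+\<eta>'. ?R \<eta>' * indicator A (\<eta>' t) \<partial>?step \<eta>) = ?R \<eta> * emeasure (K (t - s) (\<eta> s)) A" .
  qed
  also have "\<dots> = (\<integral>\<^sup>+\<eta>. ?R (restrict \<eta> H) * emeasure (K (t - s) (restrict \<eta> H s)) A \<partial>chain 0 (us @ [s]) x)"
    using H by (intro nn_integral_cong arg_cong2[where f = "(*)"] prod.cong) auto
  also have "\<dots> = (\<integral>\<^sup>+\<eta>. ?R (restrict \<eta> H) * emeasure (K (t - s) (restrict \<eta> H s)) A \<partial>path_law x)"
    unfolding us_s[symmetric] using H
    by (intro nn_integral_path_law[where g = "\<lambda>\<eta>. ?R \<eta> * emeasure (K (t - s) (\<eta> s)) A", symmetric])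
      (auto intro!: borel_measurable_times_ennreal borel_measurable_prod_ennreal measurable_compose[OF _ KA])
  also have "\<dots> = (\<integral>\<^sup>+\<eta>. ?R \<eta> * emeasure (K (t - s) (\<eta> s)) A \<partial>path_law x)"
    using H by (intro nn_integral_cong arg_cong2[where f = "(*)"] prod.cong) auto
  finally show ?thesis .
qed

end

section \<open>Histories, and the transition semigroup of a given process\<close>

lemma sets_history:
  "sets (history \<Omega> X s) = sigma_sets \<Omega> {X u -` A \<inter> \<Omega> | u A. 0 \<le> u \<and> u \<le> s \<and> A \<in> sets borel}"
  unfolding history_def by (rule sets_measure_of) auto

lemma space_history [simp]: "space (history \<Omega> X s) = \<Omega>"
  unfolding history_def by (rule space_measure_of) auto

lemma history_subalgebra:
  assumes X: "\<And>u. 0 \<le> u \<Longrightarrow> X u \<in> borel_measurable M" and N: "sets N = sets M"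
  shows "subalgebra N (history (space M) X s)"
proof -
  have "sets (history (space M) X s) \<subseteq> sets M"
    unfolding sets_history using X by (intro sets.sigma_sets_subset) auto
  then show ?thesis
    using N sets_eq_imp_space_eq[OF N] by (simp add: subalgebra_def)
qed

lemma measurable_history:
  assumes "0 \<le> s"
  shows "X s \<in> borel_measurable (history \<Omega> X s)"
proof (rule measurableI)
  fix A :: "ennreal set" assume "A \<in> sets borel"
  then show "X s -` A \<inter> space (history \<Omega> X s) \<in> sets (history \<Omega> X s)"
    using assms by (auto simp: sets_history intro!: sigma_sets.Basic)
qed simp

context positive_markov_process
begin

lemma
  shows P_prob_space: "prob_space (P x)"
    and sets_P: "sets (P x) = sets M"
    and space_P: "space (P x) = space M"
    and X_measurable_P: "0 \<le> t \<Longrightarrow> X t \<in> borel_measurable (P x)"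
  using prob[of x] X_measurable[of t] by (auto simp: prob_algebraD)

lemma transition_law_space:
  assumes "0 \<le> t"
  shows "transition_law P X t x \<in> space (prob_algebra borel)"
  unfolding transition_law_def space_prob_algebra
  using prob_space.prob_space_distr[OF P_prob_space X_measurable_P[OF assms]] by simp

lemma measure_transition_law:
  assumes "0 \<le> t" "A \<in> sets borel"
  shows "measure (transition_law P X t x) A = \<P>(\<omega> in P x. X t \<omega> \<in> A)"
  unfolding transition_law_def using X_measurable_P[OF assms(1)] assms(2)
  by (simp add: measure_distr vimage_def Int_def conj_commute)

lemma emeasure_transition_law:
  assumes "0 \<le> t" "A \<in> sets borel"
  shows "emeasure (transition_law P X t x) A = ennreal (\<P>(\<omega> in P x. X t \<omega> \<in> A))"
  using measure_transition_law[OF assms] prob_algebraD(1)[OF transition_law_space[OF assms(1)]]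
  by (simp add: finite_measure.emeasure_eq_measure[OF prob_space.finite_measure])

lemma integral_transition_law:
  fixes f :: "ennreal \<Rightarrow> real"
  assumes "0 \<le> t" "f \<in> borel_measurable borel"
  shows "(\<integral>w. f w \<partial>transition_law P X t x) = (\<integral>\<omega>. f (X t \<omega>) \<partial>P x)"
  unfolding transition_law_def using X_measurable_P[OF assms(1)] assms(2) by (rule integral_distr)

lemma measurable_transition_law:
  assumes t: "0 \<le> t"
  shows "transition_law P X t \<in> borel \<rightarrow>\<^sub>M prob_algebra borel"
proof (rule measurable_prob_algebra_generated[of _ UNIV "sets borel"])
  show "sets (borel :: ennreal measure) = sigma_sets UNIV (sets borel)"
    using sets.sigma_sets_eq[of "borel :: ennreal measure"] by simp
  show "(\<lambda>x. emeasure (transition_law P X t x) A) \<in> borel_measurable borel" if "A \<in> sets borel" for A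
    using kernel_measurable[OF t that] by (simp add: emeasure_transition_law[OF t that])
qed (use transition_law_space[OF t] in \<open>auto simp: space_prob_algebra sets.Int_stable\<close>)

lemma transition_law_0: "transition_law P X 0 x = return borel x"
proof (rule prob_algebra_eq_return[OF transition_law_space])
  interpret prob_space "P x"
    by (rule P_prob_space)
  have "AE \<omega> in P x. X 0 \<omega> = x"
    using start[of x] X_measurable_P[of 0 x] by (subst (asm) prob_Collect_eq_1) auto
  then show "AE z in transition_law P X 0 x. z = x"
    unfolding transition_law_def using X_measurable_P[of 0 x] by (subst AE_distr_iff) auto
qed simp

text \<open>Take expectations in the Markov property at time s: the conditional expectation
  integrates to the probability of \<open>X (s + t) \<in> A\<close>, its other form to the
  composition of the two kernels.\<close>

lemma transition_law_Chapman_Kolmogorov: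
  assumes s: "0 \<le> s" and t: "0 \<le> t"
  shows "transition_law P X (s + t) x = transition_law P X s x \<bind> transition_law P X t"
proof (rule measure_eqI)
  note [measurable] = X_measurable_P[OF s] X_measurable_P[OF t]
  have st: "0 \<le> s + t"
    using s t by simp
  note [measurable] = X_measurable_P[OF st]
  note s_space = transition_law_space[OF s, of x]
  show "sets (transition_law P X (s + t) x) = sets (transition_law P X s x \<bind> transition_law P X t)"
    using sets_bind'[OF s_space measurable_transition_law[OF t]] by (simp add: transition_law_def)
  fix A assume "A \<in> sets (transition_law P X (s + t) x)"
  then have A [measurable]: "A \<in> sets borel"
    by (simp add: transition_law_def)
  interpret prob_space "P x"
    by (rule P_prob_space)
  let ?F = "history (space M) X s"
  interpret finite_measure_subalgebra "P x" ?F
    by unfold_locales (rule history_subalgebra[OF X_measurable sets_P])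
  let ?E = "{\<omega> \<in> space M. X (s + t) \<omega> \<in> A}"
  have E: "?E \<in> sets (P x)"
    unfolding space_P[of x, symmetric] by measurable
  let ?g = "\<lambda>\<omega>. measure (transition_law P X t (X s \<omega>)) A"
  have [measurable]: "(\<lambda>z. measure (transition_law P X t z) A) \<in> borel_measurable borel"
    using measurable_transition_law[OF t] by measurable
  have "emeasure (transition_law P X (s + t) x) A = ennreal (measure (P x) ?E)"
    using emeasure_transition_law[OF st A] by (simp add: space_P)
  also have "measure (P x) ?E = (\<integral>\<omega>. real_cond_exp (P x) ?F (indicator ?E) \<omega> \<partial>P x)"
  proof -
    have "integrable (P x) (indicator ?E :: _ \<Rightarrow> real)"
      using E by (intro integrable_const_bound[of _ 1]) (auto intro: borel_measurable_indicator)
    then show ?thesis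
      using sets.sets_into_space[OF E] by (simp add: real_cond_exp_int(2) Int_absorb2)
  qed
  also have "\<dots> = (\<integral>\<omega>. ?g \<omega> \<partial>P x)"
  proof (rule integral_cong_AE)
    show "AE \<omega> in P x. real_cond_exp (P x) ?F (indicator ?E) \<omega> = ?g \<omega>"
      using markov[OF s _ A, of "s + t" x] t by (simp add: measure_transition_law)
  qed measurable
  also have "ennreal (\<integral>\<omega>. ?g \<omega> \<partial>P x) = (\<integral>\<^sup>+\<omega>. ennreal (?g \<omega>) \<partial>P x)"
  proof (intro nn_integral_eq_integral[symmetric] integrable_const_bound[of _ 1] AE_I2)
    show "norm (?g \<omega>) \<le> 1" for \<omega>
      using prob_space.prob_le_1[OF prob_algebraD(1)[OF transition_law_space[OF t]]] by simp
    show "?g \<in> borel_measurable (P x)"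
      by (rule measurable_compose[OF X_measurable_P[OF s]]) measurable
  qed simp
  also have "\<dots> = (\<integral>\<^sup>+\<omega>. emeasure (transition_law P X t (X s \<omega>)) A \<partial>P x)"
    by (simp add: emeasure_transition_law t measure_transition_law)
  also have "\<dots> = (\<integral>\<^sup>+z. emeasure (transition_law P X t z) A \<partial>transition_law P X s x)"
    unfolding transition_law_def[of P X s]
    by (rule nn_integral_distr[symmetric]) (auto simp: emeasure_transition_law t measure_transition_law[symmetric])
  also have "\<dots> = emeasure (transition_law P X s x \<bind> transition_law P X t) A"
    by (rule emeasure_bind_prob_algebra[OF s_space measurable_transition_law[OF t] A, symmetric])
  finally show "emeasure (transition_law P X (s + t) x) A = \<dots>" .
qed

lemma transition_semigroup_transition_law: "transition_semigroup (transition_law P X)"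
  by unfold_locales
    (simp_all add: measurable_transition_law transition_law_0 transition_law_Chapman_Kolmogorov)

end

section \<open>Markov property of the path laws\<close>

lemma prod_indicator_eq:
  assumes "finite J"
  shows "(\<Prod>j\<in>J. indicator (C j) (f j)) = (if \<forall>j\<in>J. f j \<in> C j then 1 else 0 :: ennreal)"
  using assms by (auto simp: indicator_def intro!: prod.neutral)

context transition_semigroup
begin

lemma measurable_emeasure_kernel:
  "0 \<le> t \<Longrightarrow> A \<in> sets borel \<Longrightarrow> (\<lambda>z. emeasure (K t z) A) \<in> borel_measurable borel"
  by (intro emeasure_measurable_subprob_algebra2[where N = borel] measurable_prob_algebraD kernel) auto

text \<open>Each side, as a function of the event, comes from the law \<open>\<mu> f\<close> of the
  path on [0, s] under the density f. The two measures agree on cylinders by the previous lemma,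
  hence everywhere, and every history event is the preimage of a measurable set of such path
  segments.\<close>

lemma path_law_Markov:
  assumes st: "0 \<le> s" "s < t" and A: "A \<in> sets borel"
    and B: "B \<in> sets (history (space paths) (\<lambda>t \<eta>. \<eta> t) s)"
  shows "(\<integral>\<^sup>+\<eta>. indicator B \<eta> * indicator A (\<eta> t) \<partial>path_law x) =
    (\<integral>\<^sup>+\<eta>. indicator B \<eta> * emeasure (K (t - s) (\<eta> s)) A \<partial>path_law x)"
proof -
  let ?Q = "path_law x"
  let ?S = "PiM {0..s} (\<lambda>_. borel) :: (real \<Rightarrow> ennreal) measure"
  let ?r = "\<lambda>\<eta>. restrict \<eta> {0..s}"
  note Q = prob_algebraD[OF path_law_space[of x]]
  have r: "?r \<in> paths \<rightarrow>\<^sub>M ?S"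
    unfolding paths_def by (rule measurable_restrict_subset) auto
  have "0 \<le> t" "0 \<le> t - s"
    using st by auto
  have f1: "(\<lambda>\<eta>. indicator A (\<eta> t) :: ennreal) \<in> borel_measurable paths"
    using measurable_compose[OF measurable_coordinate[OF \<open>0 \<le> t\<close>] borel_measurable_indicator[OF A]] .
  have f2: "(\<lambda>\<eta>. emeasure (K (t - s) (\<eta> s)) A) \<in> borel_measurable paths"
    using measurable_compose[OF measurable_coordinate[OF st(1)] measurable_emeasure_kernel[OF \<open>0 \<le> t - s\<close> A]] .
  define \<mu> where "\<mu> f = distr (density ?Q f) ?S ?r" for f
  have emeasure_\<mu>: "emeasure (\<mu> f) D = (\<integral>\<^sup>+\<eta>. f \<eta> * indicator (?r -` D \<inter> space paths) \<eta> \<partial>?Q)"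
    if "f \<in> borel_measurable paths" "D \<in> sets ?S" for f D
    unfolding \<mu>_def using that r Q measurable_sets[OF r that(2)]
    by (subst emeasure_distr) (auto simp: Q(2,3,4) emeasure_density cong: measurable_cong_sets)
  have "\<mu> (\<lambda>\<eta>. indicator A (\<eta> t)) = \<mu> (\<lambda>\<eta>. emeasure (K (t - s) (\<eta> s)) A)"
  proof (rule measure_eqI_PiM_infinite)
    fix C J assume J: "finite J" "J \<subseteq> {0..s}" and C: "\<And>i :: real. i \<in> J \<Longrightarrow> C i \<in> sets (borel :: ennreal measure)"
    let ?D = "prod_emb {0..s} (\<lambda>_. borel) J (Pi\<^sub>E J C)"
    have D: "?D \<in> sets ?S"
      using J C by (intro measurable_prod_emb sets_PiM_I_finite) auto
    have ind: "f \<eta> * indicator (?r -` ?D \<inter> space paths) \<eta> = (\<Prod>j\<in>J. indicator (C j) (\<eta> j)) * f \<eta>"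
      if "\<eta> \<in> space ?Q" for f :: "(real \<Rightarrow> ennreal) \<Rightarrow> ennreal" and \<eta>
    proof -
      have "?r \<eta> \<in> ?D \<longleftrightarrow> (\<forall>j\<in>J. \<eta> j \<in> C j)"
        using J(2) by (auto simp: prod_emb_iff Pi_iff PiE_iff restrict_def extensional_def subset_iff)
      then show ?thesis
        using that unfolding prod_indicator_eq[OF J(1)] by (auto simp: Q(3) indicator_def)
    qed
    show "emeasure (\<mu> (\<lambda>\<eta>. indicator A (\<eta> t))) ?D = emeasure (\<mu> (\<lambda>\<eta>. emeasure (K (t - s) (\<eta> s)) A)) ?D"
    proof -
      have "emeasure (\<mu> (\<lambda>\<eta>. indicator A (\<eta> t))) ?D =
          (\<integral>\<^sup>+\<eta>. (\<Prod>j\<in>J. indicator (C j) (\<eta> j)) * indicator A (\<eta> t) \<partial>?Q)"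
        unfolding emeasure_\<mu>[OF f1 D] by (intro nn_integral_cong ind)
      also have "\<dots> = (\<integral>\<^sup>+\<eta>. (\<Prod>j\<in>J. indicator (C j) (\<eta> j)) * emeasure (K (t - s) (\<eta> s)) A \<partial>?Q)"
        by (rule path_law_Markov_cylinder[OF st J _ A]) (rule C)
      also have "\<dots> = emeasure (\<mu> (\<lambda>\<eta>. emeasure (K (t - s) (\<eta> s)) A)) ?D"
        unfolding emeasure_\<mu>[OF f2 D] by (intro nn_integral_cong ind[symmetric])
      finally show ?thesis .
    qed
  next
    show "finite_measure (\<mu> (\<lambda>\<eta>. indicator A (\<eta> t)))"
    proof
      have "emeasure (\<mu> (\<lambda>\<eta>. indicator A (\<eta> t))) (space ?S) \<le> (\<integral>\<^sup>+\<eta>. 1 \<partial>?Q)"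
        unfolding emeasure_\<mu>[OF f1 sets.top] by (intro nn_integral_mono) (auto simp: indicator_def)
      also have "\<dots> < \<top>"
        using prob_space.emeasure_space_1[OF Q(1)] by simp
      finally show "emeasure (\<mu> (\<lambda>\<eta>. indicator A (\<eta> t))) (space (\<mu> (\<lambda>\<eta>. indicator A (\<eta> t)))) \<noteq> \<infinity>"
        by (simp add: \<mu>_def)
    qed
  qed (auto simp: \<mu>_def)
  \<comment> \<open>The generators of the history are pulled back from the product space over
    [0, s], so the whole history is contained in the pullback algebra.\<close>
  moreover obtain B' where B': "B' \<in> sets ?S" "B = ?r -` B' \<inter> space paths"
  proof -
    have "?r \<in> space paths \<rightarrow> space ?S"
      using measurable_space[OF r] by auto
    note V = sets_vimage_algebra2[OF this]
    have "sets (history (space paths) (\<lambda>t \<eta>. \<eta> t) s) \<subseteq> sets (vimage_algebra (space paths) ?r ?S)"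
      unfolding sets_history
    proof (rule sets.sigma_sets_subset')
      show "{(\<lambda>\<eta>. \<eta> u) -` A \<inter> space paths |u A. 0 \<le> u \<and> u \<le> s \<and> A \<in> sets borel}
          \<subseteq> sets (vimage_algebra (space paths) ?r ?S)"
      proof clarify
        fix u and A :: "ennreal set" assume u: "0 \<le> u" "u \<le> s" and "A \<in> sets borel"
        then have "(\<lambda>\<eta>. \<eta> u) -` A \<inter> space ?S \<in> sets ?S"
          by (intro measurable_sets[OF measurable_component_singleton]) auto
        moreover have "(\<lambda>\<eta>. \<eta> u) -` A \<inter> space paths = ?r -` ((\<lambda>\<eta>. \<eta> u) -` A \<inter> space ?S) \<inter> space paths"
          using u measurable_space[OF r] by auto
        ultimately show "(\<lambda>\<eta>. \<eta> u) -` A \<inter> space paths \<in> sets (vimage_algebra (space paths) ?r ?S)"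
          unfolding V by blast
      qed
    qed (use sets.top[of "vimage_algebra (space paths) ?r ?S"] in simp)
    then show ?thesis
      using B that unfolding V by blast
  qed
  ultimately have "(\<integral>\<^sup>+\<eta>. indicator A (\<eta> t) * indicator B \<eta> \<partial>?Q) =
      (\<integral>\<^sup>+\<eta>. emeasure (K (t - s) (\<eta> s)) A * indicator B \<eta> \<partial>?Q)"
    using emeasure_\<mu>[OF f1 B'(1)] emeasure_\<mu>[OF f2 B'(1)] by (simp add: B'(2))
  then show ?thesis
    by (simp add: mult.commute)
qed

lemma transition_law_path_law:
  "0 \<le> t \<Longrightarrow> transition_law path_law (\<lambda>t \<eta>. \<eta> t) t x = K t x"
  by (simp add: transition_law_def path_law_coordinate)

text \<open>A conditional expectation is characterised by its integrals over history events. The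
  candidate is measurable for the history because it depends on the path through
  \<open>\<eta> s\<close> alone.\<close>

theorem positive_markov_process_path_law: "positive_markov_process paths path_law (\<lambda>t \<eta>. \<eta> t)"
proof
  note Q = prob_algebraD[OF path_law_space]
  have meas: "(\<lambda>\<eta>. \<eta> t) \<in> borel_measurable (path_law x)" if "0 \<le> t" for t x
    using measurable_coordinate[OF that] by (simp add: Q(4))
  have law: "\<P>(\<eta> in path_law x. \<eta> t \<in> A) = measure (K t x) A" if "0 \<le> t" "A \<in> sets borel" for t x A
    unfolding path_law_coordinate[OF that(1), symmetric]
    using meas[OF that(1)] that(2) by (simp add: measure_distr vimage_def Int_def conj_commute)
  have K_meas: "(\<lambda>z. measure (K t z) A) \<in> borel_measurable borel" if "0 \<le> t" "A \<in> sets borel" for t A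
    using kernel[OF that(1)] that(2) by measurable
  show "path_law x \<in> space (prob_algebra paths)" for x
    by (rule path_law_space)
  show "(\<lambda>\<eta>. \<eta> t) \<in> borel_measurable paths" if "0 \<le> t" for t
    by (rule measurable_coordinate[OF that])
  show "(\<lambda>x. \<P>(\<eta> in path_law x. \<eta> t \<in> A)) \<in> borel_measurable borel" if "0 \<le> t" "A \<in> sets borel" for t A
    using K_meas[OF that] by (simp add: law[OF that])
  show "\<P>(\<eta> in path_law x. \<eta> 0 = x) = 1" for x
    using law[of 0 "{x}" x] by (simp add: kernel_0 measure_return)
  fix x :: ennreal and s t :: real and A :: "ennreal set" assume st: "0 \<le> s" "s \<le> t" and A: "A \<in> sets borel"
  let ?F = "history (space paths) (\<lambda>t \<eta>. \<eta> t) s"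
  let ?f = "indicator {\<eta> \<in> space paths. \<eta> t \<in> A} :: _ \<Rightarrow> real"
  let ?g = "\<lambda>\<eta>. measure (K (t - s) (\<eta> s)) A"
  have ts: "0 \<le> t - s" "0 \<le> t"
    using st by auto
  interpret prob_space "path_law x"
    by (rule Q)
  interpret finite_measure_subalgebra "path_law x" ?F
    by unfold_locales (rule history_subalgebra[OF measurable_coordinate Q(2)])
  have K_prob: "prob_space (K (t - s) z)" for z
    by (rule prob_algebraD[OF kernel_space[OF ts(1)]])
  have f_set: "{\<eta> \<in> space paths. \<eta> t \<in> A} \<in> sets (path_law x)"
    using measurable_sets[OF meas[OF ts(2)] A, of x] by (simp add: Q(3) vimage_def Int_def conj_commute)
  have g_F: "?g \<in> borel_measurable ?F"
    using measurable_compose[OF measurable_history[OF st(1), of "\<lambda>t \<eta>. \<eta> t"] K_meas[OF ts(1) A]] .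
  have g_Q: "?g \<in> borel_measurable (path_law x)"
    using measurable_compose[OF meas[OF st(1)] K_meas[OF ts(1) A]] .
  have g1: "?g \<eta> \<le> 1" for \<eta>
    by (rule prob_space.prob_le_1[OF K_prob])
  have "AE \<eta> in path_law x. real_cond_exp (path_law x) ?F ?f \<eta> = ?g \<eta>"
  proof (rule real_cond_exp_charact[OF _ _ _ g_F])
    show "integrable (path_law x) ?f"
      using f_set by (intro integrable_const_bound[of _ 1]) (auto intro: borel_measurable_indicator)
    show "integrable (path_law x) ?g"
      using g_Q g1 by (intro integrable_const_bound[of _ 1]) auto
    fix B assume B: "B \<in> sets ?F"
    then have B_Q: "B \<in> sets (path_law x)"
      using subalg by (auto simp: subalgebra_def)
    have nn: "(\<integral>\<^sup>+\<eta>. indicator B \<eta> * ennreal (?f \<eta>) \<partial>path_law x) =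
        (\<integral>\<^sup>+\<eta>. indicator B \<eta> * ennreal (?g \<eta>) \<partial>path_law x)"
    proof (cases "s = t")
      \<comment> \<open>At equal times the kernel is the point mass at \<open>\<eta> s\<close>. The
        cylinder argument covers s < t, where the list of times has no repetition.\<close>
      case True
      then show ?thesis
        using A by (intro nn_integral_cong) (auto simp: kernel_0 measure_return Q(3) indicator_def)
    next
      case False
      have "(\<integral>\<^sup>+\<eta>. indicator B \<eta> * ennreal (?f \<eta>) \<partial>path_law x) =
          (\<integral>\<^sup>+\<eta>. indicator B \<eta> * indicator A (\<eta> t) \<partial>path_law x)"
        by (intro nn_integral_cong) (auto simp: Q(3) indicator_def)
      also have "\<dots> = (\<integral>\<^sup>+\<eta>. indicator B \<eta> * emeasure (K (t - s) (\<eta> s)) A \<partial>path_law x)"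
        using False st by (intro path_law_Markov[OF _ _ A B]) auto
      finally show ?thesis
        by (simp add: finite_measure.emeasure_eq_measure[OF prob_space.finite_measure[OF K_prob]])
    qed
    \<comment> \<open>Converts the real integrals of the characterisation into the nonnegative
      integrals in which the Markov identity is available.\<close>
    have int: "set_lebesgue_integral (path_law x) B h =
        enn2real (\<integral>\<^sup>+\<eta>. indicator B \<eta> * ennreal (h \<eta>) \<partial>path_law x)"
      if "h \<in> borel_measurable (path_law x)" "\<And>\<eta>. 0 \<le> h \<eta>" for h
      unfolding set_lebesgue_integral_def using that B_Q
      by (subst integral_eq_nn_integral)
        (auto intro!: arg_cong[of _ _ enn2real] nn_integral_cong simp: indicator_def)
    show "set_lebesgue_integral (path_law x) B ?f = set_lebesgue_integral (path_law x) B ?g"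
      using nn g_Q f_set by (subst (1 2) int) auto
  qed
  then show "AE \<eta> in path_law x. real_cond_exp (path_law x) ?F ?f \<eta> =
      \<P>(\<eta>' in path_law (\<eta> s). \<eta>' (t - s) \<in> A)"
    by (simp add: law[OF ts(1) A])
qed

end

section \<open>Dual processes\<close>

lemma integral_bind_prob_algebra:
  fixes f :: "'b \<Rightarrow> real"
  assumes q: "q \<in> space (prob_algebra M)" and k: "k \<in> M \<rightarrow>\<^sub>M prob_algebra N"
    and f: "f \<in> borel_measurable N" "\<And>x. \<bar>f x\<bar> \<le> B"
  shows "integral\<^sup>L (q \<bind> k) f = (\<integral>x. integral\<^sup>L (k x) f \<partial>q)"
proof (rule integral_bind[where K = N and B = B and B' = 1])
  note q' = prob_algebraD[OF q]
  show "k \<in> q \<rightarrow>\<^sub>M subprob_algebra N"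
    using k by (simp add: q'(4) measurable_prob_algebraD)
  show "finite_measure q"
    using q'(1) by (rule prob_space.finite_measure)
  have "emeasure (k x) (space (k x)) \<le> ennreal 1" if "x \<in> space q" for x
    using prob_space.emeasure_space_1[OF prob_algebraD(1)[OF measurable_space[OF k]]] that q'(3) by simp
  then show "AE x in q. emeasure (k x) (space (k x)) \<le> ennreal 1"
    by (rule AE_I2)
qed (use f in auto)

lemma laplace_kernel_of_nat_pos:
  "0 < n \<Longrightarrow> laplace_kernel c1 c2 (of_nat n) z = exp_neg z ^ n"
  by (simp add: laplace_kernel_eq exp_neg_power)

lemma laplace_integral_measurable [measurable]:
  assumes "q \<in> space (prob_algebra borel)"
  shows "(\<lambda>y. \<integral>w. laplace_kernel c1 c2 w y \<partial>q) \<in> borel_measurable borel"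
    "(\<lambda>x. \<integral>z. laplace_kernel c1 c2 x z \<partial>q) \<in> borel_measurable borel"
proof -
  interpret prob_space q
    by (rule prob_algebraD[OF assms])
  note [measurable_cong] = prob_algebraD(2)[OF assms]
  show "(\<lambda>y. \<integral>w. laplace_kernel c1 c2 w y \<partial>q) \<in> borel_measurable borel"
    "(\<lambda>x. \<integral>z. laplace_kernel c1 c2 x z \<partial>q) \<in> borel_measurable borel"
    by measurable
qed

lemma laplace_Fubini:
  assumes p: "p \<in> space (prob_algebra borel)" and q: "q \<in> space (prob_algebra borel)"
  shows "(\<integral>z. \<integral>w. laplace_kernel c1 c2 w z \<partial>p \<partial>q) = (\<integral>w. \<integral>z. laplace_kernel c1 c2 w z \<partial>q \<partial>p)"
proof -
  interpret p: prob_space p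
    by (rule prob_algebraD[OF p])
  interpret q: prob_space q
    by (rule prob_algebraD[OF q])
  interpret pq: pair_prob_space p q ..
  note [measurable_cong] = prob_algebraD(2)[OF p] prob_algebraD(2)[OF q]
  have "integrable (p \<Otimes>\<^sub>M q) (\<lambda>(w, z). laplace_kernel c1 c2 w z)"
    by (intro pq.integrable_const_bound[of _ 1] AE_I2) auto
  then show ?thesis
    using pq.Fubini_integral[of "laplace_kernel c1 c2"] by (simp add: split_beta')
qed

text \<open>At positive integers x the kernel is a power of \<open>exp_neg\<close> under every
  convention, so moments suffice.\<close>

lemma laplace_determines:
  assumes "p \<in> space (prob_algebra borel)" "q \<in> space (prob_algebra borel)"
    and "\<And>x. (\<integral>z. laplace_kernel c1 c2 x z \<partial>p) = (\<integral>z. laplace_kernel c1 c2 x z \<partial>q)"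
  shows "p = q"
  using assms(1,2)
proof (rule exp_neg_moments_unique)
  fix n :: nat assume "0 < n"
  then show "(\<integral>z. exp_neg z ^ n \<partial>p) = (\<integral>z. exp_neg z ^ n \<partial>q)"
    using assms(3)[of "of_nat n"] by (simp add: laplace_kernel_of_nat_pos)
qed

text \<open>The dual semigroup inherits its Chapman--Kolmogorov equations from \<open>p\<close>, since both sides have
  the same Laplace transform.\<close>

lemma dual_transition_semigroup:
  assumes "transition_semigroup p"
    and q: "\<And>t y. 0 \<le> t \<Longrightarrow> q t y \<in> space (prob_algebra borel)"
    and dual: "\<And>t. 0 \<le> t \<Longrightarrow> dual_kernels c1 c2 (p t) (q t)"
  shows "transition_semigroup q"
proof -
  interpret p: transition_semigroup p
    by fact
  have eq: "(\<integral>z. laplace_kernel c1 c2 x z \<partial>q t y) = (\<integral>w. laplace_kernel c1 c2 w y \<partial>p t x)"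
    if "0 \<le> t" for t x y
    using dual[OF that] by (simp add: dual_kernels_def)
  have kernel: "q t \<in> borel \<rightarrow>\<^sub>M prob_algebra borel" if "0 \<le> t" for t
  \<comment> \<open>Duality exchanges the variables: the n-th moment of \<open>q t y\<close> is an
    integral against the single law \<open>p t (of_nat n)\<close>, in which y is only a parameter of
    the integrand.\<close>
  proof (rule measurable_exp_neg_moments[OF q[OF that]])
    fix n :: nat assume "0 < n"
    then have "(\<integral>z. exp_neg z ^ n \<partial>q t y) = (\<integral>w. laplace_kernel c1 c2 w y \<partial>p t (of_nat n))" for y
      using eq[OF that, where x = "of_nat n" and y = y] by (simp add: laplace_kernel_of_nat_pos)
    then show "(\<lambda>y. \<integral>z. exp_neg z ^ n \<partial>q t y) \<in> borel_measurable borel"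
      by (simp add: laplace_integral_measurable p.kernel_space[OF that])
  qed
  show ?thesis
  proof
    show "q t \<in> borel \<rightarrow>\<^sub>M prob_algebra borel" if "0 \<le> t" for t
      by (rule kernel[OF that])
    show "q 0 y = return borel y" for y
    proof (rule laplace_determines[OF q])
      show "(\<integral>z. laplace_kernel c1 c2 x z \<partial>q 0 y) = (\<integral>z. laplace_kernel c1 c2 x z \<partial>return borel y)" for x
        unfolding eq[OF order_refl] by (simp add: p.kernel_0 integral_return)
    qed (auto simp: space_prob_algebra prob_space_return)
    show "q (s + t) y = q s y \<bind> q t" if st: "0 \<le> s" "0 \<le> t" for s t y
    proof (rule laplace_determines[OF q])
      show "0 \<le> s + t"
        using st by simp
      show "q s y \<bind> q t \<in> space (prob_algebra borel)"
        using prob_space_bind'[OF q[OF st(1)] kernel[OF st(2)]] sets_bind'[OF q[OF st(1)] kernel[OF st(2)]]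
        by (simp add: space_prob_algebra)
      fix x
      have "(\<integral>z. laplace_kernel c1 c2 x z \<partial>(q s y \<bind> q t)) =
          (\<integral>w. \<integral>z. laplace_kernel c1 c2 x z \<partial>q t w \<partial>q s y)"
        by (rule integral_bind_prob_algebra[OF q[OF st(1)] kernel[OF st(2)], of _ 1]) auto
      also have "\<dots> = (\<integral>w. \<integral>v. laplace_kernel c1 c2 v w \<partial>p t x \<partial>q s y)"
        by (simp add: eq[OF st(2)])
      also have "\<dots> = (\<integral>v. \<integral>w. laplace_kernel c1 c2 v w \<partial>q s y \<partial>p t x)"
        by (rule laplace_Fubini[OF p.kernel_space[OF st(2)] q[OF st(1)]])
      also have "\<dots> = (\<integral>v. \<integral>w. laplace_kernel c1 c2 w y \<partial>p s v \<partial>p t x)"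
        by (simp add: eq[OF st(1)])
      also have "\<dots> = (\<integral>w. laplace_kernel c1 c2 w y \<partial>(p t x \<bind> p s))"
        by (rule integral_bind_prob_algebra[OF p.kernel_space[OF st(2)] p.kernel[OF st(1)], of _ 1, symmetric]) auto
      \<comment> \<open>Dualising has reversed the order of the two transitions, which is harmless
        because s + t = t + s.\<close>
      also have "p t x \<bind> p s = p (s + t) x"
        using p.Chapman_Kolmogorov[OF st(2,1)] by (simp add: add.commute)
      also have "(\<integral>w. laplace_kernel c1 c2 w y \<partial>p (s + t) x) = (\<integral>z. laplace_kernel c1 c2 x z \<partial>q (s + t) y)"
        using st by (simp add: eq)
      finally show "(\<integral>z. laplace_kernel c1 c2 x z \<partial>q (s + t) y) =
          (\<integral>z. laplace_kernel c1 c2 x z \<partial>(q s y \<bind> q t))" ..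
    qed
  qed
qed

section \<open>Conditions on processes as conditions on their kernels\<close>

lemma laplace_dual_iff:
  assumes X: "positive_markov_process M P X" and Y: "positive_markov_process N Q Y"
  shows "laplace_dual c1 c2 P X Q Y \<longleftrightarrow>
    (\<forall>t\<ge>0. dual_kernels c1 c2 (transition_law P X t) (transition_law Q Y t))"
  unfolding laplace_dual_def dual_kernels_def
  by (simp add: positive_markov_process.integral_transition_law[OF X]
    positive_markov_process.integral_transition_law[OF Y])

lemma semigroup_op_eq:
  assumes "positive_markov_process M P X" "0 \<le> t" "f \<in> borel_measurable borel"
  shows "semigroup_op P X t f = (\<lambda>x. integral\<^sup>L (transition_law P X t x) f)"
  using positive_markov_process.integral_transition_law[OF assms] by (simp add: semigroup_op_def fun_eq_iff)

lemma completely_monotone_process_iff: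
  assumes "positive_markov_process M P X"
  shows "completely_monotone_process P X \<longleftrightarrow>
    (\<forall>t\<ge>0. \<forall>f\<in>cm_ennreal. (\<lambda>x. integral\<^sup>L (transition_law P X t x) f) \<in> cm_ennreal)"
  unfolding completely_monotone_process_def image_subset_iff
  using semigroup_op_eq[OF assms] cm_ennreal_measurable by auto

lemma weakly_finite_continuous_at_0_iff:
  assumes "positive_markov_process M P X"
  shows "weakly_finite_continuous_at_0 P X \<longleftrightarrow>
    (\<forall>t\<ge>0. boundary_0 ZeroPlus_Infty Infty_ZeroPlus (transition_law P X t))"
proof -
  interpret positive_markov_process M P X
    by fact
  have "(LINT \<omega>:{\<omega> \<in> space (P x). X t \<omega> < \<infinity>}|P x. f (X t \<omega>)) =
      (\<integral>w. laplace_kernel ZeroPlus_Infty Infty_ZeroPlus w 0 * f w \<partial>transition_law P X t x)"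
    if "0 \<le> t" "continuous_on UNIV f" for t f x
  proof -
    have [measurable]: "f \<in> borel_measurable borel"
      using that(2) by (rule borel_measurable_continuous_onI)
    have "(\<integral>w. laplace_kernel ZeroPlus_Infty Infty_ZeroPlus w 0 * f w \<partial>transition_law P X t x) =
        (\<integral>\<omega>. laplace_kernel ZeroPlus_Infty Infty_ZeroPlus (X t \<omega>) 0 * f (X t \<omega>) \<partial>P x)"
      by (rule integral_transition_law[OF that(1)]) measurable
    also have "\<dots> = (LINT \<omega>:{\<omega> \<in> space (P x). X t \<omega> < \<infinity>}|P x. f (X t \<omega>))"
      unfolding set_lebesgue_integral_def
      by (rule Bochner_Integration.integral_cong)
        (auto simp: indicator_def zero_less_iff_neq_zero less_top[symmetric])
    finally show ?thesis ..
  qed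
  then show ?thesis
    by (simp add: weakly_finite_continuous_at_0_def boundary_0_def del: laplace_kernel_simps)
qed

lemma weakly_positive_continuous_at_infty_iff:
  assumes "positive_markov_process M P X"
  shows "weakly_positive_continuous_at_infty P X \<longleftrightarrow>
    (\<forall>t\<ge>0. boundary_infty Zero_InftyMinus InftyMinus_Zero (transition_law P X t))"
proof -
  interpret positive_markov_process M P X
    by fact
  have "(LINT \<omega>:{\<omega> \<in> space (P x). X t \<omega> > 0}|P x. f (X t \<omega>)) =
      (\<integral>w. (1 - laplace_kernel Zero_InftyMinus InftyMinus_Zero w \<infinity>) * f w \<partial>transition_law P X t x)"
    if "0 \<le> t" "continuous_on UNIV f" for t f x
  proof -
    have [measurable]: "f \<in> borel_measurable borel"
      using that(2) by (rule borel_measurable_continuous_onI)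
    have "(\<integral>w. (1 - laplace_kernel Zero_InftyMinus InftyMinus_Zero w \<infinity>) * f w \<partial>transition_law P X t x) =
        (\<integral>\<omega>. (1 - laplace_kernel Zero_InftyMinus InftyMinus_Zero (X t \<omega>) \<infinity>) * f (X t \<omega>) \<partial>P x)"
      by (rule integral_transition_law[OF that(1)]) measurable
    also have "\<dots> = (LINT \<omega>:{\<omega> \<in> space (P x). X t \<omega> > 0}|P x. f (X t \<omega>))"
      unfolding set_lebesgue_integral_def
      by (rule Bochner_Integration.integral_cong)
        (auto simp: indicator_def zero_less_iff_neq_zero less_top[symmetric])
    finally show ?thesis ..
  qed
  then show ?thesis
    by (simp add: weakly_positive_continuous_at_infty_def boundary_infty_def del: laplace_kernel_simps)
qed

lemma at_0_ennreal: "at (0 :: ennreal) = at_right 0"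
proof -
  have "UNIV - {0 :: ennreal} = {0<..}"
    by (auto simp: zero_less_iff_neq_zero)
  then show ?thesis
    by (simp add: at_within_def)
qed

lemma at_infty_ennreal: "at (\<infinity> :: ennreal) = at_left \<infinity>"
proof -
  have "UNIV - {\<infinity> :: ennreal} = {..<\<infinity>}"
    by (auto simp: less_top[symmetric])
  then show ?thesis
    by (simp add: at_within_def)
qed

lemma weakly_continuous_at_0_iff:
  assumes "positive_markov_process M P X"
  shows "weakly_continuous_at P X 0 \<longleftrightarrow>
    (\<forall>t\<ge>0. boundary_0 ZeroPlus_Infty InftyMinus_Zero (transition_law P X t))"
  by (simp add: weakly_continuous_at_def boundary_0_def continuous_within at_0_ennreal
      semigroup_op_eq[OF assms] borel_measurable_continuous_onI)

lemma weakly_continuous_at_infty_iff: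
  assumes "positive_markov_process M P X"
  shows "weakly_continuous_at P X \<infinity> \<longleftrightarrow>
    (\<forall>t\<ge>0. boundary_infty ZeroPlus_Infty InftyMinus_Zero (transition_law P X t))"
  unfolding weakly_continuous_at_def boundary_infty_def at_infty_ennreal
  by (simp add: continuous_within semigroup_op_eq[OF assms] borel_measurable_continuous_onI)

lemma boundary_absorbing:
  "boundary_0 Zero_InftyMinus c2 p \<longleftrightarrow> p 0 = return borel 0"
  "boundary_infty c1 Infty_ZeroPlus p \<longleftrightarrow> p \<infinity> = return borel \<infinity>"
  by (simp_all add: boundary_0_def boundary_infty_def)

text \<open>The common form of the four characterisations; \<open>regular_process_iff\<close> spells
  it out for each pair of conventions.\<close>

definition regular_process ::
    "zero_infty_convention \<Rightarrow> infty_zero_convention \<Rightarrow>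
     (ennreal \<Rightarrow> 'a measure) \<Rightarrow> (real \<Rightarrow> 'a \<Rightarrow> ennreal) \<Rightarrow> bool" where
  "regular_process c1 c2 P X \<longleftrightarrow> completely_monotone_process P X \<and>
    (\<forall>t\<ge>0. boundary_0 c1 c2 (transition_law P X t)) \<and>
    (\<forall>t\<ge>0. boundary_infty c1 c2 (transition_law P X t))"

lemma laplace_dual_regular:
  assumes X: "positive_markov_process M P X" and Y: "positive_markov_process N Q Y"
    and dual: "laplace_dual c1 c2 P X Q Y"
  shows "regular_process c1 c2 P X"
    and "regular_process (swap_infty_zero c2) (swap_zero_infty c1) Q Y"
proof -
  have p: "transition_law P X t \<in> borel \<rightarrow>\<^sub>M prob_algebra borel" if "0 \<le> t" for t
    by (rule positive_markov_process.measurable_transition_law[OF X that])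
  have q: "transition_law Q Y t \<in> borel \<rightarrow>\<^sub>M prob_algebra borel" if "0 \<le> t" for t
    by (rule positive_markov_process.measurable_transition_law[OF Y that])
  have d: "dual_kernels c1 c2 (transition_law P X t) (transition_law Q Y t)" if "0 \<le> t" for t
    using dual that by (simp add: laplace_dual_iff[OF X Y])
  show "regular_process c1 c2 P X"
    unfolding regular_process_def completely_monotone_process_iff[OF X]
    using dual_kernels_cm[OF p q d] dual_kernels_boundary_0[OF p q d] dual_kernels_boundary_infty[OF p q d]
    by blast
  show "regular_process (swap_infty_zero c2) (swap_zero_infty c1) Q Y"
    unfolding regular_process_def completely_monotone_process_iff[OF Y]
    using dual_kernels_cm[OF q p dual_kernels_swap[OF d]]
      dual_kernels_boundary_0[OF q p dual_kernels_swap[OF d]]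
      dual_kernels_boundary_infty[OF q p dual_kernels_swap[OF d]]
    by blast
qed

text \<open>The dual laws are picked independently for each t and y. Since transforms determine
  laws, \<open>dual_transition_semigroup\<close> still makes them a measurable semigroup, whose path
  laws form the dual process.\<close>

lemma regular_has_laplace_dual:
  assumes X: "positive_markov_process M P X" and reg: "regular_process c1 c2 P X"
  shows "has_laplace_dual c1 c2 P X"
proof -
  let ?p = "transition_law P X"
  have "\<exists>q\<in>space (prob_algebra borel).
      \<forall>x. (\<integral>w. laplace_kernel c1 c2 w y \<partial>?p t x) = (\<integral>z. laplace_kernel c1 c2 x z \<partial>q)"
    if "0 \<le> t" for t y
    using reg that unfolding regular_process_def completely_monotone_process_iff[OF X]
    by (intro dual_kernel_exists positive_markov_process.measurable_transition_law[OF X]) auto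
  then obtain q where q: "\<And>t y. 0 \<le> t \<Longrightarrow> q t y \<in> space (prob_algebra borel)"
    and eq: "\<And>t y x. 0 \<le> t \<Longrightarrow>
      (\<integral>w. laplace_kernel c1 c2 w y \<partial>?p t x) = (\<integral>z. laplace_kernel c1 c2 x z \<partial>q t y)"
    by metis
  interpret q: transition_semigroup q
  proof (rule dual_transition_semigroup[OF _ q])
    show "transition_semigroup ?p"
      by (rule positive_markov_process.transition_semigroup_transition_law[OF X])
    show "dual_kernels c1 c2 (?p t) (q t)" if "0 \<le> t" for t
      using eq[OF that] by (simp add: dual_kernels_def)
  qed
  note Y = q.positive_markov_process_path_law
  have "laplace_dual c1 c2 P X q.path_law (\<lambda>t \<eta>. \<eta> t)"
    unfolding laplace_dual_iff[OF X Y] by (simp add: dual_kernels_def q.transition_law_path_law eq)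
  then show ?thesis
    unfolding has_laplace_dual_def using Y by blast
qed

lemma has_laplace_dual_iff:
  assumes "positive_markov_process M P X"
  shows "has_laplace_dual c1 c2 P X \<longleftrightarrow> regular_process c1 c2 P X"
  using regular_has_laplace_dual[OF assms] laplace_dual_regular(1)[OF assms]
  unfolding has_laplace_dual_def by blast

lemma regular_process_iff:
  assumes "positive_markov_process M P X"
  shows
    "regular_process ZeroPlus_Infty Infty_ZeroPlus P X \<longleftrightarrow>
      completely_monotone_process P X \<and> weakly_finite_continuous_at_0 P X \<and> absorbing P X \<infinity>"
    "regular_process Zero_InftyMinus InftyMinus_Zero P X \<longleftrightarrow>
      completely_monotone_process P X \<and> weakly_positive_continuous_at_infty P X \<and> absorbing P X 0"
    "regular_process Zero_InftyMinus Infty_ZeroPlus P X \<longleftrightarrow>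
      completely_monotone_process P X \<and> absorbing P X 0 \<and> absorbing P X \<infinity>"
    "regular_process ZeroPlus_Infty InftyMinus_Zero P X \<longleftrightarrow>
      completely_monotone_process P X \<and> weakly_continuous_at P X 0 \<and> weakly_continuous_at P X \<infinity>"
  unfolding regular_process_def weakly_finite_continuous_at_0_iff[OF assms]
    weakly_positive_continuous_at_infty_iff[OF assms] weakly_continuous_at_0_iff[OF assms]
    weakly_continuous_at_infty_iff[OF assms]
  by (auto simp only: boundary_absorbing absorbing_def)

section \<open>Boundary identities and the four cases\<close>

lemma integral_of_bool: "(\<integral>\<omega>. of_bool (R \<omega>) \<partial>N) = measure N {\<omega> \<in> space N. R \<omega>}"
proof -
  have "(\<integral>\<omega>. of_bool (R \<omega>) \<partial>N) = (\<integral>\<omega>. indicator {\<omega> \<in> space N. R \<omega>} \<omega> \<partial>N)"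
    by (intro Bochner_Integration.integral_cong) (auto simp: indicator_def)
  also have "\<dots> = measure N ({\<omega> \<in> space N. R \<omega>} \<inter> space N)"
    by (rule Bochner_Integration.integral_indicator)
  also have "{\<omega> \<in> space N. R \<omega>} \<inter> space N = {\<omega> \<in> space N. R \<omega>}"
    by auto
  finally show ?thesis .
qed

text \<open>Duality is evaluated with one variable at an endpoint, where the convention makes the
  kernel an indicator in the other variable. Each convention yields one identity, and each pair of
  conventions selects two of them.\<close>

lemma laplace_dual_boundary_values:
  assumes X: "positive_markov_process M P X" and Y: "positive_markov_process N Q Y"
    and dual: "laplace_dual c1 c2 P X Q Y" and t: "0 \<le> t"
  shows "c1 = ZeroPlus_Infty \<Longrightarrow>
      (\<integral>\<omega>. laplace_kernel c1 c2 (X t \<omega>) y \<partial>P 0) = \<P>(\<omega> in Q y. Y t \<omega> < \<infinity>)"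
    and "c1 = Zero_InftyMinus \<Longrightarrow>
      \<P>(\<omega> in P x. X t \<omega> = 0) = (\<integral>\<omega>. laplace_kernel c1 c2 x (Y t \<omega>) \<partial>Q \<infinity>)"
    and "c2 = Infty_ZeroPlus \<Longrightarrow>
      \<P>(\<omega> in P x. X t \<omega> < \<infinity>) = (\<integral>\<omega>. laplace_kernel c1 c2 x (Y t \<omega>) \<partial>Q 0)"
    and "c2 = InftyMinus_Zero \<Longrightarrow>
      (\<integral>\<omega>. laplace_kernel c1 c2 (X t \<omega>) y \<partial>P \<infinity>) = \<P>(\<omega> in Q y. Y t \<omega> = 0)"
proof -
  have eq: "(\<integral>\<omega>. laplace_kernel c1 c2 (X t \<omega>) y \<partial>P x) = (\<integral>\<omega>. laplace_kernel c1 c2 x (Y t \<omega>) \<partial>Q y)" for x y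
    using dual t by (simp add: laplace_dual_def)
  show "(\<integral>\<omega>. laplace_kernel c1 c2 (X t \<omega>) y \<partial>P 0) = \<P>(\<omega> in Q y. Y t \<omega> < \<infinity>)" if "c1 = ZeroPlus_Infty"
  proof -
    have "laplace_kernel c1 c2 0 (Y t \<omega>) = of_bool (Y t \<omega> < \<infinity>)" for \<omega>
      using that by (auto simp: less_top[symmetric])
    then show ?thesis
      unfolding eq by (simp only: integral_of_bool)
  qed
  show "\<P>(\<omega> in P x. X t \<omega> = 0) = (\<integral>\<omega>. laplace_kernel c1 c2 x (Y t \<omega>) \<partial>Q \<infinity>)" if "c1 = Zero_InftyMinus"
  proof -
    have "laplace_kernel c1 c2 (X t \<omega>) \<infinity> = of_bool (X t \<omega> = 0)" for \<omega>
      using that by auto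
    then show ?thesis
      unfolding eq[symmetric] by (simp only: integral_of_bool)
  qed
  show "\<P>(\<omega> in P x. X t \<omega> < \<infinity>) = (\<integral>\<omega>. laplace_kernel c1 c2 x (Y t \<omega>) \<partial>Q 0)" if "c2 = Infty_ZeroPlus"
  proof -
    have "laplace_kernel c1 c2 (X t \<omega>) 0 = of_bool (X t \<omega> < \<infinity>)" for \<omega>
      using that by (auto simp: less_top[symmetric])
    then show ?thesis
      unfolding eq[symmetric] by (simp only: integral_of_bool)
  qed
  show "(\<integral>\<omega>. laplace_kernel c1 c2 (X t \<omega>) y \<partial>P \<infinity>) = \<P>(\<omega> in Q y. Y t \<omega> = 0)" if "c2 = InftyMinus_Zero"
  proof -
    have "laplace_kernel c1 c2 \<infinity> (Y t \<omega>) = of_bool (Y t \<omega> = 0)" for \<omega>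
      using that by auto
    then show ?thesis
      unfolding eq by (simp only: integral_of_bool)
  qed
qed

theorem theorem3p13:
  fixes M :: "'a measure" and P :: "ennreal \<Rightarrow> 'a measure" and X :: "real \<Rightarrow> 'a \<Rightarrow> ennreal"
  assumes "positive_markov_process M P X"
  shows
    "((has_laplace_dual ZeroPlus_Infty Infty_ZeroPlus P X \<longleftrightarrow>
         completely_monotone_process P X \<and>
         weakly_finite_continuous_at_0 P X \<and>
         absorbing P X \<infinity>) \<and>
      (\<forall>(N :: 'b measure) Q Y. positive_markov_process N Q Y \<and> laplace_dual ZeroPlus_Infty Infty_ZeroPlus P X Q Y \<longrightarrow>
         completely_monotone_process P X \<and>
         weakly_finite_continuous_at_0 P X \<and>
         absorbing P X \<infinity> \<and>
         completely_monotone_process Q Y \<and>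
         weakly_finite_continuous_at_0 Q Y \<and>
         absorbing Q Y \<infinity> \<and>
         (\<forall>t\<ge>0. \<forall>y. (\<integral>\<omega>. laplace_kernel ZeroPlus_Infty Infty_ZeroPlus (X t \<omega>) y \<partial>P 0) = \<P>(\<omega> in Q y. Y t \<omega> < \<infinity>)) \<and>
         (\<forall>t\<ge>0. \<forall>x. \<P>(\<omega> in P x. X t \<omega> < \<infinity>) = (\<integral>\<omega>. laplace_kernel ZeroPlus_Infty Infty_ZeroPlus x (Y t \<omega>) \<partial>Q 0)))) \<and>
     ((has_laplace_dual Zero_InftyMinus InftyMinus_Zero P X \<longleftrightarrow>
         completely_monotone_process P X \<and>
         weakly_positive_continuous_at_infty P X \<and>
         absorbing P X 0) \<and>
      (\<forall>(N :: 'b measure) Q Y. positive_markov_process N Q Y \<and> laplace_dual Zero_InftyMinus InftyMinus_Zero P X Q Y \<longrightarrow>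
         completely_monotone_process P X \<and>
         weakly_positive_continuous_at_infty P X \<and>
         absorbing P X 0 \<and>
         completely_monotone_process Q Y \<and>
         weakly_positive_continuous_at_infty Q Y \<and>
         absorbing Q Y 0 \<and>
         (\<forall>t\<ge>0. \<forall>y. (\<integral>\<omega>. laplace_kernel Zero_InftyMinus InftyMinus_Zero (X t \<omega>) y \<partial>P \<infinity>) = \<P>(\<omega> in Q y. Y t \<omega> = 0)) \<and>
         (\<forall>t\<ge>0. \<forall>x. \<P>(\<omega> in P x. X t \<omega> = 0) = (\<integral>\<omega>. laplace_kernel Zero_InftyMinus InftyMinus_Zero x (Y t \<omega>) \<partial>Q \<infinity>)))) \<and>
     ((has_laplace_dual Zero_InftyMinus Infty_ZeroPlus P X \<longleftrightarrow>
         completely_monotone_process P X \<and>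
         absorbing P X 0 \<and>
         absorbing P X \<infinity>) \<and>
      (\<forall>(N :: 'b measure) Q Y. positive_markov_process N Q Y \<and> laplace_dual Zero_InftyMinus Infty_ZeroPlus P X Q Y \<longrightarrow>
         completely_monotone_process P X \<and>
         absorbing P X 0 \<and>
         absorbing P X \<infinity> \<and>
         completely_monotone_process Q Y \<and>
         weakly_continuous_at Q Y 0 \<and>
         weakly_continuous_at Q Y \<infinity> \<and>
         (\<forall>t\<ge>0. \<forall>x. \<P>(\<omega> in P x. X t \<omega> < \<infinity>) = (\<integral>\<omega>. laplace_kernel Zero_InftyMinus Infty_ZeroPlus x (Y t \<omega>) \<partial>Q 0)) \<and>
         (\<forall>t\<ge>0. \<forall>x. \<P>(\<omega> in P x. X t \<omega> = 0) = (\<integral>\<omega>. laplace_kernel Zero_InftyMinus Infty_ZeroPlus x (Y t \<omega>) \<partial>Q \<infinity>)))) \<and>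
     ((has_laplace_dual ZeroPlus_Infty InftyMinus_Zero P X \<longleftrightarrow>
         completely_monotone_process P X \<and>
         weakly_continuous_at P X 0 \<and>
         weakly_continuous_at P X \<infinity>) \<and>
      (\<forall>(N :: 'b measure) Q Y. positive_markov_process N Q Y \<and> laplace_dual ZeroPlus_Infty InftyMinus_Zero P X Q Y \<longrightarrow>
         completely_monotone_process P X \<and>
         weakly_continuous_at P X 0 \<and>
         weakly_continuous_at P X \<infinity> \<and>
         completely_monotone_process Q Y \<and>
         absorbing Q Y 0 \<and>
         absorbing Q Y \<infinity> \<and>
         (\<forall>t\<ge>0. \<forall>y. (\<integral>\<omega>. laplace_kernel ZeroPlus_Infty InftyMinus_Zero (X t \<omega>) y \<partial>P 0) = \<P>(\<omega> in Q y. Y t \<omega> < \<infinity>)) \<and>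
         (\<forall>t\<ge>0. \<forall>y. (\<integral>\<omega>. laplace_kernel ZeroPlus_Infty InftyMinus_Zero (X t \<omega>) y \<partial>P \<infinity>) = \<P>(\<omega> in Q y. Y t \<omega> = 0))))"
proof -
  note X = assms
  note equivalences = has_laplace_dual_iff[OF X] regular_process_iff[OF X]
  show ?thesis
  proof (intro conjI, goal_cases)
    \<comment> \<open>Odd goals are the equivalences, closed together at the end; even goals concern
      a given dual, whose regularity is that of the swapped conventions.\<close>
    case 2
    show ?case
    proof (intro allI impI, elim conjE, goal_cases)
      case (1 N Q Y)
      then show ?case
        using laplace_dual_regular[OF X 1] laplace_dual_boundary_values(1,3)[OF X 1 _ refl]
        unfolding swap_infty_zero.simps swap_zero_infty.simps
          regular_process_iff[OF X] regular_process_iff[OF 1(1)]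
        by blast
    qed
  next
    case 4
    show ?case
    proof (intro allI impI, elim conjE, goal_cases)
      case (1 N Q Y)
      then show ?case
        using laplace_dual_regular[OF X 1] laplace_dual_boundary_values(2,4)[OF X 1 _ refl]
        unfolding swap_infty_zero.simps swap_zero_infty.simps
          regular_process_iff[OF X] regular_process_iff[OF 1(1)]
        by blast
    qed
  next
    case 6
    show ?case
    proof (intro allI impI, elim conjE, goal_cases)
      case (1 N Q Y)
      then show ?case
        using laplace_dual_regular[OF X 1] laplace_dual_boundary_values(2,3)[OF X 1 _ refl]
        unfolding swap_infty_zero.simps swap_zero_infty.simps
          regular_process_iff[OF X] regular_process_iff[OF 1(1)]
        by blast
    qed
  next
    case 8
    show ?case
    proof (intro allI impI, elim conjE, goal_cases)
      case (1 N Q Y)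
      then show ?case
        using laplace_dual_regular[OF X 1] laplace_dual_boundary_values(1,4)[OF X 1 _ refl]
        unfolding swap_infty_zero.simps swap_zero_infty.simps
          regular_process_iff[OF X] regular_process_iff[OF 1(1)]
        by blast
    qed
  qed (simp_all only: equivalences)
qed

end
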